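(* Let $\mathcal{N}=\Gamma\backslash G$, where $G$ is $\mathbb{R}^4$ with the group law $$(a,b,c,d)\cdot(x,y,z,t)=\left(x+a,\;y+b,\;z+ay+c,\;t+\tfrac12a^2y+az+d\right)$$ and $\Gamma=(2\mathbb{Z})^4$, a discrete subgroup of $G$. On the compact $4$-manifold $\mathcal{N}$ there exists a non integrable almost Hermitian structure $(J,\omega)$ which is not locally conformally almost Kähler and which satisfies $$h^{1,1}_{\bar\partial}(\mathcal{N},J,\omega)=2=b^-+1.$$
   Context: An almost Hermitian structure $(J,\omega)$ on a $4$-manifold consists of an almost complex structure $J$ and the fundamental form $\omega$ of a $J$-Hermitian Riemannian metric $g$ (a positive real $(1,1)$-form; if $\psi^1,\psi^2$ is a suitably normalized unitary $(1,0)$-coframe then $\omega=\frac i2(\psi^1\wedge\overline{\psi^1}+\psi^2\wedge\overline{\psi^2})$). The structure is non integrable if $J$ is not induced by a complex manifold structure. There is a unique real $1$-form $\theta$ with $d\omega=\theta\wedge\omega$; $\omega$ is locally conformally almost Kähler if $d\theta=0$ (either $\theta$ exact or closed non exact). The space of complex $(p,q)$-forms with respect to $J$ is $A^{p,q}$; the exterior derivative decomposes as $d=\mu+\partial+\bar\partial+\bar\mu$, where $\mu,\partial,\bar\partial,\bar\mu$ are the components of bidegree $(2,-1),(1,0),(0,1),(-1,2)$. The Hodge operator $*$ is the $\mathbb{C}$-linear extension of the real Hodge operator of $g$ for the orientation induced by $J$ (volume form $\omega^2/2$). Put $\bar\partial^*=-*\partial*$, $\Delta_{\bar\partial}=\bar\partial\bar\partial^*+\bar\partial^*\bar\partial$,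 $\mathcal{H}^{p,q}_{\bar\partial}=\ker\Delta_{\bar\partial}\cap A^{p,q}$, and $h^{p,q}_{\bar\partial}=\dim_{\mathbb{C}}\mathcal{H}^{p,q}_{\bar\partial}$. $b^-$ is the dimension of the space of real anti-self-dual $d$-harmonic $2$-forms (a topological invariant of the oriented manifold, with the orientation induced by the almost complex structure). *)

theory Defs
  imports "HOL-Analysis.Analysis" "HOL-Algebra.Coset" "HOL-Library.Function_Algebras"
begin

section \<open>The group, the lattice and the nilmanifold\<close>

definition nil_mult :: "real^4 \<Rightarrow> real^4 \<Rightarrow> real^4" where
  "nil_mult g u = vector
     [u$1 + g$1,
      u$2 + g$2,
      u$3 + g$1 * u$2 + g$3,
      u$4 + (1/2) * (g$1)^2 * u$2 + g$1 * u$3 + g$4]"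

definition nil_group :: "(real^4) monoid" where
  "nil_group = \<lparr>carrier = UNIV, mult = nil_mult, one = 0\<rparr>"

definition nil_lattice :: "(real^4) set" where
  "nil_lattice = {g. \<forall>i. \<exists>m::int. g$i = 2 * of_int m}"

definition nil_proj :: "real^4 \<Rightarrow> (real^4) set" where
  "nil_proj u = nil_lattice #>\<^bsub>nil_group\<^esub> u"

text \<open>The space \<open>\<Gamma>\<setminus>G\<close> of cosets \<open>\<Gamma>u\<close>, with the quotient topology.\<close>

definition nil_manifold :: "(real^4) set topology" where
  "nil_manifold = topology (\<lambda>U. U \<subseteq> rcosets\<^bsub>nil_group\<^esub> nil_lattice \<and> open (nil_proj -` U))"

lemma vector_4:
  "(vector [a,b,c,d] :: 'a::zero^4)$1 = a"
  "(vector [a,b,c,d] :: 'a::zero^4)$2 = b"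
  "(vector [a,b,c,d] :: 'a::zero^4)$3 = c"
  "(vector [a,b,c,d] :: 'a::zero^4)$4 = d"
  unfolding vector_def by simp_all

lemma nil_mult_nth:
  "nil_mult g u $ 1 = u$1 + g$1"
  "nil_mult g u $ 2 = u$2 + g$2"
  "nil_mult g u $ 3 = u$3 + g$1 * u$2 + g$3"
  "nil_mult g u $ 4 = u$4 + (1/2) * (g$1)^2 * u$2 + g$1 * u$3 + g$4"
  by (simp_all add: nil_mult_def vector_4)

definition nil_inv :: "real^4 \<Rightarrow> real^4" where
  "nil_inv g = vector
     [- g$1, - g$2, g$1 * g$2 - g$3, - g$4 + g$1 * g$3 - (1/2) * (g$1)^2 * g$2]"

lemma nil_inv_nth:
  "nil_inv g $ 1 = - g$1"
  "nil_inv g $ 2 = - g$2"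
  "nil_inv g $ 3 = g$1 * g$2 - g$3"
  "nil_inv g $ 4 = - g$4 + g$1 * g$3 - (1/2) * (g$1)^2 * g$2"
  by (simp_all add: nil_inv_def vector_4)

lemma nil_mult_assoc: "nil_mult (nil_mult g h) u = nil_mult g (nil_mult h u)"
  by (simp add: vec_eq_iff forall_4 nil_mult_nth algebra_simps power2_eq_square)

lemma nil_mult_0 [simp]: "nil_mult 0 u = u" "nil_mult u 0 = u"
  by (simp_all add: vec_eq_iff forall_4 nil_mult_nth)

lemma nil_mult_inv [simp]: "nil_mult (nil_inv g) g = 0" "nil_mult g (nil_inv g) = 0"
  by (simp_all add: vec_eq_iff forall_4 nil_mult_nth nil_inv_nth algebra_simps power2_eq_square)

lemma group_nil_group: "group nil_group"
proof (rule groupI)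
  show "\<exists>y\<in>carrier nil_group. y \<otimes>\<^bsub>nil_group\<^esub> x = \<one>\<^bsub>nil_group\<^esub>" for x
    by (rule bexI[of _ "nil_inv x"]) (simp_all add: nil_group_def)
qed (simp_all add: nil_group_def nil_mult_assoc)

lemma inv_nil_group: "inv\<^bsub>nil_group\<^esub> g = nil_inv g"
  by (rule group.inv_equality[OF group_nil_group]) (simp_all add: nil_group_def)

lemma nil_lattice_coords:
  "g \<in> nil_lattice \<longleftrightarrow> (\<exists>a b c d :: int. g = vector
     [2 * of_int a, 2 * of_int b, 2 * of_int c, 2 * of_int d])"
  unfolding nil_lattice_def mem_Collect_eq forall_4 vec_eq_iff vector_4 by blast

lemma nil_mult_lattice:
  assumes "g \<in> nil_lattice" "h \<in> nil_lattice"
  shows "nil_mult g h \<in> nil_lattice"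
proof -
  obtain a b c d :: int where g: "g = vector [2 * of_int a, 2 * of_int b, 2 * of_int c, 2 * of_int d]"
    using assms nil_lattice_coords by blast
  obtain x y z t :: int where h: "h = vector [2 * of_int x, 2 * of_int y, 2 * of_int z, 2 * of_int t]"
    using assms nil_lattice_coords by blast
  have "nil_mult g h = vector [2 * of_int (x + a), 2 * of_int (y + b),
      2 * of_int (z + 2 * a * y + c), 2 * of_int (t + 2 * a^2 * y + 2 * a * z + d)]"
    by (simp add: vec_eq_iff forall_4 nil_mult_nth g h vector_4 algebra_simps power2_eq_square)
  then show ?thesis using nil_lattice_coords by blast
qed

lemma nil_inv_lattice:
  assumes "g \<in> nil_lattice"
  shows "nil_inv g \<in> nil_lattice"
proof -
  obtain a b c d :: int where g: "g = vector [2 * of_int a, 2 * of_int b, 2 * of_int c, 2 * of_int d]"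
    using assms nil_lattice_coords by blast
  have "nil_inv g = vector [2 * of_int (- a), 2 * of_int (- b),
      2 * of_int (2 * a * b - c), 2 * of_int (- d + 2 * a * c - 2 * a^2 * b)]"
    by (simp add: vec_eq_iff forall_4 nil_inv_nth g vector_4 algebra_simps power2_eq_square)
  then show ?thesis using nil_lattice_coords by blast
qed

lemma zero_lattice: "0 \<in> nil_lattice"
  unfolding nil_lattice_def by (auto intro: exI[of _ 0])

lemma subgroup_nil_lattice: "subgroup nil_lattice nil_group"
proof (rule group.subgroupI[OF group_nil_group])
  show "nil_lattice \<noteq> {}" using zero_lattice by blast
  show "inv\<^bsub>nil_group\<^esub> g \<in> nil_lattice" if "g \<in> nil_lattice" for g
    using nil_inv_lattice[OF that] by (simp add: inv_nil_group)
  show "g \<otimes>\<^bsub>nil_group\<^esub> h \<in> nil_lattice" if "g \<in> nil_lattice" "h \<in> nil_lattice" for g h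
    using nil_mult_lattice[OF that] by (simp add: nil_group_def)
qed (simp add: nil_group_def)

lemma nil_lattice_sep:
  assumes "g \<in> nil_lattice" "h \<in> nil_lattice" "dist g h < 2"
  shows "g = h"
proof -
  have "g $ i = h $ i" for i
  proof -
    obtain m n :: int where "g$i = 2 * of_int m" "h$i = 2 * of_int n"
      using assms unfolding nil_lattice_def by blast
    moreover have "\<bar>g$i - h$i\<bar> < 2"
      using dist_vec_nth_le[of g i h] assms by (simp add: dist_real_def)
    ultimately have "\<bar>of_int (m - n) :: real\<bar> < 1" by simp
    then have "m = n" by linarith
    then show ?thesis using \<open>g$i = _\<close> \<open>h$i = _\<close> by simp
  qed
  then show ?thesis by (simp add: vec_eq_iff)
qed

lemma uniform_discrete_nil_lattice: "uniform_discrete nil_lattice"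
  unfolding uniform_discrete_def using nil_lattice_sep by (intro exI[of _ 2]) auto

lemma discrete_nil_lattice: "discrete nil_lattice"
  using uniform_discrete_nil_lattice uniform_discrete_imp_discrete by blast

lemma closed_nil_lattice: "closed nil_lattice"
  using uniform_discrete_nil_lattice uniform_discrete_imp_closed by blast

lemma nil_proj_eq: "nil_proj u = nil_proj v \<longleftrightarrow> nil_mult v (nil_inv u) \<in> nil_lattice"
proof -
  have "nil_proj u = nil_proj v \<longleftrightarrow> v \<in> nil_proj u"
    unfolding nil_proj_def
    using group.repr_independence[OF group_nil_group _ _ subgroup_nil_lattice, of v u]
      group.rcos_self[OF group_nil_group _ subgroup_nil_lattice, of v]
    by (auto simp: nil_group_def)
  also have "\<dots> \<longleftrightarrow> (\<exists>g\<in>nil_lattice. v = nil_mult g u)"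
    by (auto simp: nil_proj_def r_coset_def nil_group_def)
  also have "\<dots> \<longleftrightarrow> nil_mult v (nil_inv u) \<in> nil_lattice"
    by (metis nil_mult_assoc nil_mult_0 nil_mult_inv)
  finally show ?thesis .
qed

lemma openin_nil_manifold:
  "openin nil_manifold U \<longleftrightarrow> U \<subseteq> rcosets\<^bsub>nil_group\<^esub> nil_lattice \<and> open (nil_proj -` U)"
proof -
  have "istopology (\<lambda>U. U \<subseteq> rcosets\<^bsub>nil_group\<^esub> nil_lattice \<and> open (nil_proj -` U))"
    unfolding istopology_def by (auto simp: vimage_Union)
  then show ?thesis unfolding nil_manifold_def by (simp add: topology_inverse')
qed

lemma nil_proj_range: "range nil_proj = rcosets\<^bsub>nil_group\<^esub> nil_lattice"
  by (auto simp: nil_proj_def RCOSETS_def nil_group_def)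

lemma topspace_nil_manifold: "topspace nil_manifold = rcosets\<^bsub>nil_group\<^esub> nil_lattice"
proof
  show "rcosets\<^bsub>nil_group\<^esub> nil_lattice \<subseteq> topspace nil_manifold"
    by (rule openin_subset) (auto simp: openin_nil_manifold nil_proj_range[symmetric] vimage_def)
  show "topspace nil_manifold \<subseteq> rcosets\<^bsub>nil_group\<^esub> nil_lattice"
    using openin_nil_manifold openin_topspace by blast
qed

lemma quotient_map_nil_proj: "quotient_map euclidean nil_manifold nil_proj"
  unfolding quotient_map_def
  by (auto simp: topspace_nil_manifold openin_nil_manifold nil_proj_range vimage_def)

lemma continuous_on_vector_4:
  fixes a b c d :: "'b::topological_space \<Rightarrow> real"
  assumes "continuous_on S a" "continuous_on S b" "continuous_on S c" "continuous_on S d"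
  shows "continuous_on S (\<lambda>x. vector [a x, b x, c x, d x] :: real^4)"
proof -
  have "continuous_on S (\<lambda>x. (vector [a x, b x, c x, d x] :: real^4) $ i)" for i
    using exhaust_4[of i] assms by (elim disjE) (simp_all add: vector_4)
  then have "continuous_on S (\<lambda>x. \<chi> i. (vector [a x, b x, c x, d x] :: real^4) $ i)"
    by (rule continuous_on_vec_lambda)
  then show ?thesis by simp
qed

lemma continuous_nil_mult_inv:
  "continuous_on UNIV (\<lambda>p. nil_mult (snd p) (nil_inv (fst p)))"
  unfolding nil_mult_def nil_inv_nth
  by (intro continuous_on_vector_4 continuous_intros)

lemma compact_nil_manifold: "compact_space nil_manifold"
proof -
  define K :: "(real^4) set" where "K = cbox 0 (vector [2,2,2,2])"
  have red: "\<exists>m::int. 0 \<le> r + 2 * of_int m \<and> r + 2 * of_int m \<le> 2" for r :: real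
    by (intro exI[of _ "- \<lfloor>r / 2\<rfloor>"]) (simp, linarith)
  have "\<exists>v\<in>K. nil_proj v = nil_proj u" for u
  proof -
    obtain a b :: int where a: "0 \<le> u$1 + 2 * of_int a" "u$1 + 2 * of_int a \<le> 2"
      and b: "0 \<le> u$2 + 2 * of_int b" "u$2 + 2 * of_int b \<le> 2"
      using red by meson
    obtain c :: int where c: "0 \<le> (u$3 + 2 * of_int a * u$2) + 2 * of_int c"
        "(u$3 + 2 * of_int a * u$2) + 2 * of_int c \<le> 2"
      using red by meson
    obtain d :: int where d:
        "0 \<le> (u$4 + (1/2) * (2 * of_int a)^2 * u$2 + 2 * of_int a * u$3) + 2 * of_int d"
        "(u$4 + (1/2) * (2 * of_int a)^2 * u$2 + 2 * of_int a * u$3) + 2 * of_int d \<le> 2"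
      using red by meson
    define g :: "real^4" where
      "g = vector [2 * of_int a, 2 * of_int b, 2 * of_int c, 2 * of_int d]"
    have g: "g \<in> nil_lattice" unfolding g_def nil_lattice_coords by blast
    have "nil_mult g u \<in> K"
      unfolding K_def mem_box_cart forall_4 nil_mult_nth g_def vector_4
      using a b c d by simp
    moreover have "nil_proj (nil_mult g u) = nil_proj u"
      using g by (subst eq_commute) (simp add: nil_proj_eq nil_mult_assoc)
    ultimately show ?thesis by blast
  qed
  then have img: "nil_proj ` K = topspace nil_manifold"
    unfolding topspace_nil_manifold nil_proj_range[symmetric]
  proof (intro subset_antisym subsetI)
    fix X assume *: "\<And>u. \<exists>v\<in>K. nil_proj v = nil_proj u" and "X \<in> range nil_proj"
    then obtain u where "X = nil_proj u" by blast
    then show "X \<in> nil_proj ` K" using *[of u] by (metis imageI)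
  qed blast
  have "compactin nil_manifold (nil_proj ` K)"
    using quotient_imp_continuous_map[OF quotient_map_nil_proj]
    by (rule image_compactin[rotated]) (simp add: K_def compactin_euclidean_iff compact_cbox)
  then show ?thesis using img by (simp add: compact_space_def)
qed

lemma open_map_nil_proj: "open_map euclidean nil_manifold nil_proj"
proof -
  have "open (nil_proj -` (nil_proj ` U))" if "open U" for U :: "(real^4) set"
  proof -
    have "nil_proj -` (nil_proj ` U) = (\<Union>g\<in>nil_lattice. nil_mult g -` U)"
    proof (intro Set.set_eqI iffI)
      fix v assume "v \<in> nil_proj -` (nil_proj ` U)"
      then obtain u where u: "u \<in> U" "nil_proj v = nil_proj u" by auto
      then have "nil_mult u (nil_inv v) \<in> nil_lattice" by (simp add: nil_proj_eq)
      moreover have "nil_mult (nil_mult u (nil_inv v)) v = u" by (simp add: nil_mult_assoc)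
      ultimately show "v \<in> (\<Union>g\<in>nil_lattice. nil_mult g -` U)"
        using u by (metis UN_iff vimageI)
    next
      fix v assume "v \<in> (\<Union>g\<in>nil_lattice. nil_mult g -` U)"
      then obtain g where "g \<in> nil_lattice" "nil_mult g v \<in> U" by auto
      moreover have "nil_proj v = nil_proj (nil_mult g v)"
        using \<open>g \<in> nil_lattice\<close> by (simp add: nil_proj_eq nil_mult_assoc)
      ultimately show "v \<in> nil_proj -` (nil_proj ` U)" by auto
    qed
    moreover have "continuous_on UNIV (nil_mult g)" for g
      unfolding nil_mult_def by (intro continuous_on_vector_4 continuous_intros)
    ultimately show ?thesis using that by (simp add: open_UN open_vimage)
  qed
  then show ?thesis
    unfolding open_map_def openin_nil_manifold nil_proj_range[symmetric] by auto
qed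

lemma Hausdorff_nil_manifold: "Hausdorff_space nil_manifold"
  unfolding Hausdorff_space_def
proof (intro allI impI, elim conjE)
  fix X Y assume "X \<in> topspace nil_manifold" "Y \<in> topspace nil_manifold" "X \<noteq> Y"
  then obtain x y where xy: "X = nil_proj x" "Y = nil_proj y"
    unfolding topspace_nil_manifold nil_proj_range[symmetric] by auto
  define W where "W = (\<lambda>p. nil_mult (snd p) (nil_inv (fst p))) -` (- nil_lattice)"
  have "open W" unfolding W_def
    using continuous_nil_mult_inv closed_nil_lattice by (auto intro: open_vimage)
  moreover have "(x, y) \<in> W"
    using \<open>X \<noteq> Y\<close> unfolding xy W_def by (simp add: nil_proj_eq)
  ultimately obtain A B where AB: "open A" "open B" "x \<in> A" "y \<in> B" "A \<times> B \<subseteq> W"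
    by (auto elim!: open_prod_elim)
  have "disjnt (nil_proj ` A) (nil_proj ` B)"
  proof -
    have "nil_proj a \<noteq> nil_proj b" if "a \<in> A" "b \<in> B" for a b
      using AB(5) that by (auto simp: W_def nil_proj_eq)
    then show ?thesis unfolding disjnt_def by blast
  qed
  then show "\<exists>U V. openin nil_manifold U \<and> openin nil_manifold V \<and> X \<in> U \<and> Y \<in> V \<and> disjnt U V"
    using AB open_map_nil_proj unfolding open_map_def xy by (metis image_eqI open_openin)
qed

lemma locally_inj_nil_proj: "\<exists>U. open U \<and> x \<in> U \<and> inj_on nil_proj U"
proof -
  define W where "W = (\<lambda>p. nil_mult (snd p) (nil_inv (fst p))) -` ball 0 2"
  have "open W" unfolding W_def using continuous_nil_mult_inv by (auto intro: open_vimage)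
  moreover have "(x, x) \<in> W" by (simp add: W_def)
  ultimately obtain A B where AB: "open A" "open B" "x \<in> A" "x \<in> B" "A \<times> B \<subseteq> W"
    by (auto elim!: open_prod_elim)
  have "inj_on nil_proj (A \<inter> B)"
  proof (rule inj_onI)
    fix a b assume ab: "a \<in> A \<inter> B" "b \<in> A \<inter> B" "nil_proj a = nil_proj b"
    then have "nil_mult b (nil_inv a) \<in> nil_lattice" by (simp add: nil_proj_eq)
    moreover have "dist 0 (nil_mult b (nil_inv a)) < 2"
      using AB(5) ab unfolding W_def by auto
    ultimately have "nil_mult b (nil_inv a) = 0"
      using nil_lattice_sep zero_lattice by metis
    then show "a = b"
      by (metis nil_mult_assoc nil_mult_0 nil_mult_inv(1))
  qed
  then show ?thesis using AB by blast
qed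


section \<open>Smooth functions, tensors and differential forms on the nilmanifold\<close>

text \<open>
  The projection \<open>G \<rightarrow> \<Gamma>\<setminus>G\<close> is a covering map, so tensor fields on \<open>\<Gamma>\<setminus>G\<close> are the
  same as tensor fields on \<open>G = \<real>\<^sup>4\<close> that are invariant under the left translations by
  elements of \<open>\<Gamma>\<close>; this is how they are represented here.
\<close>

definition partial_deriv :: "4 \<Rightarrow> (real^4 \<Rightarrow> 'b::real_normed_vector) \<Rightarrow> real^4 \<Rightarrow> 'b" where
  "partial_deriv j f x = frechet_derivative f (at x) (axis j 1)"

text \<open>Only meant for open \<open>U\<close>.\<close>

primrec C_k_on :: "nat \<Rightarrow> (real^4) set \<Rightarrow> (real^4 \<Rightarrow> 'b::real_normed_vector) \<Rightarrow> bool" where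
  "C_k_on 0 U f = continuous_on U f"
| "C_k_on (Suc k) U f =
     ((\<forall>x\<in>U. f differentiable (at x)) \<and> (\<forall>j. C_k_on k U (partial_deriv j f)))"

definition smooth_on :: "(real^4) set \<Rightarrow> (real^4 \<Rightarrow> 'b::real_normed_vector) \<Rightarrow> bool" where
  "smooth_on U f \<longleftrightarrow> (\<forall>k. C_k_on k U f)"

definition cvec :: "real^'n \<Rightarrow> complex^'n" where
  "cvec v = (\<chi> i. complex_of_real (v$i))"

definition cvec_conj :: "complex^'n \<Rightarrow> complex^'n" where
  "cvec_conj v = (\<chi> i. cnj (v$i))"

definition cmat :: "real^'n^'m \<Rightarrow> complex^'n^'m" where
  "cmat A = (\<chi> i j. complex_of_real (A$i$j))"

text \<open>
  A complex differential form assigns to each point a function of a list of complexified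
  tangent vectors; a form of degree \<open>k\<close> vanishes on lists of length other than \<open>k\<close>, so a
  general element of this type is an inhomogeneous form.
\<close>

type_synonym cform = "real^4 \<Rightarrow> (complex^4) list \<Rightarrow> complex"

definition alternating_form :: "nat \<Rightarrow> ((complex^4) list \<Rightarrow> complex) \<Rightarrow> bool" where
  "alternating_form k a \<longleftrightarrow>
     (\<forall>vs. length vs \<noteq> k \<longrightarrow> a vs = 0) \<and>
     (\<forall>us vs. length us + length vs + 1 = k \<longrightarrow>
        Vector_Spaces.linear (*s) (*) (\<lambda>v. a (us @ v # vs))) \<and>
     (\<forall>vs. \<not> distinct vs \<longrightarrow> a vs = 0)"

definition nil_diff :: "real^4 \<Rightarrow> real^4 \<Rightarrow> real^4^4" where
  "nil_diff g x = matrix (frechet_derivative (nil_mult g) (at x))"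

definition nil_invariant :: "cform \<Rightarrow> bool" where
  "nil_invariant \<alpha> \<longleftrightarrow> (\<forall>g\<in>nil_lattice. \<forall>x vs.
     \<alpha> (nil_mult g x) (map (\<lambda>v. cmat (nil_diff g x) *v v) vs) = \<alpha> x vs)"

text \<open>The space \<open>A\<^sup>k\<close> of smooth complex \<open>k\<close>-forms on \<open>\<Gamma>\<setminus>G\<close>.\<close>

definition nil_forms :: "nat \<Rightarrow> cform set" where
  "nil_forms k = {\<alpha>. (\<forall>x. alternating_form k (\<alpha> x)) \<and>
     (\<forall>vs. smooth_on UNIV (\<lambda>x. \<alpha> x vs)) \<and> nil_invariant \<alpha>}"

definition real_form :: "cform \<Rightarrow> bool" where
  "real_form \<alpha> \<longleftrightarrow> (\<forall>x vs. \<alpha> x (map cvec_conj vs) = cnj (\<alpha> x vs))"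

text \<open>
  The normalization of the wedge product is the one with
  \<open>(\<alpha> \<and> \<beta>)(u,v) = \<alpha>(u) \<beta>(v) - \<alpha>(v) \<beta>(u)\<close> for 1-forms.
\<close>

definition shuffle_sign :: "nat set \<Rightarrow> nat \<Rightarrow> complex" where
  "shuffle_sign S n = (- 1) ^ card {(i, j). i \<in> S \<and> j \<in> {..<n} - S \<and> j < i}"

definition wedge :: "cform \<Rightarrow> cform \<Rightarrow> cform" where
  "wedge \<alpha> \<beta> = (\<lambda>x vs. \<Sum>S\<in>Pow {..<length vs}.
     shuffle_sign S (length vs) * \<alpha> x (nths vs S) * \<beta> x (nths vs (- S)))"

text \<open>
  \<open>d\<alpha>(v\<^sub>0,\<dots>,v\<^sub>k) = \<Sum>\<^sub>i (-1)\<^sup>i v\<^sub>i(\<alpha>(v\<^sub>0,\<dots>,v\<^sub>i\<^sub>-\<^sub>1,v\<^sub>i\<^sub>+\<^sub>1,\<dots>,v\<^sub>k))\<close>, where the vectors are extended to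
  constant vector fields on \<open>\<real>\<^sup>4\<close>, so that no bracket terms occur.
\<close>

definition ext_d :: "cform \<Rightarrow> cform" where
  "ext_d \<alpha> = (\<lambda>x vs. \<Sum>i<length vs. (- 1) ^ i *
     (\<Sum>j\<in>UNIV. (vs ! i) $ j * partial_deriv j (\<lambda>y. \<alpha> y (nths vs (- {i}))) x))"


section \<open>Almost complex structures and bidegrees\<close>

definition almost_complex :: "(real^4 \<Rightarrow> real^4^4) \<Rightarrow> bool" where
  "almost_complex J \<longleftrightarrow> smooth_on UNIV J \<and> (\<forall>x. J x ** J x = - mat 1) \<and>
     (\<forall>g\<in>nil_lattice. \<forall>x. nil_diff g x ** J x = J (nil_mult g x) ** nil_diff g x)"

text \<open>
  \<open>J\<close> is induced by a complex manifold structure iff there are local complex coordinates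
  around every point for which \<open>J\<close> is multiplication by \<open>\<i>\<close> (the coordinate changes are
  then automatically holomorphic). Local coordinates of \<open>\<Gamma>\<setminus>G\<close> are local coordinates of \<open>G\<close>.
\<close>

definition integrable_acs :: "(real^4 \<Rightarrow> real^4^4) \<Rightarrow> bool" where
  "integrable_acs J \<longleftrightarrow> (\<forall>p. \<exists>U (\<phi> :: real^4 \<Rightarrow> complex^2).
     open U \<and> p \<in> U \<and> smooth_on U \<phi> \<and> inj_on \<phi> U \<and> open (\<phi> ` U) \<and>
     (\<forall>x\<in>U. bij (frechet_derivative \<phi> (at x)) \<and>
        (\<forall>v. frechet_derivative \<phi> (at x) (J x *v v) = \<i> *s frechet_derivative \<phi> (at x) v)))"

definition part10 :: "real^4^4 \<Rightarrow> complex^4 \<Rightarrow> complex^4" where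
  "part10 A v = (1/2) *s (v - \<i> *s (cmat A *v v))"

definition part01 :: "real^4^4 \<Rightarrow> complex^4 \<Rightarrow> complex^4" where
  "part01 A v = (1/2) *s (v + \<i> *s (cmat A *v v))"

text \<open>The component of bidegree \<open>(p,q)\<close> of a form.\<close>

definition bideg :: "(real^4 \<Rightarrow> real^4^4) \<Rightarrow> nat \<Rightarrow> nat \<Rightarrow> cform \<Rightarrow> cform" where
  "bideg J p q \<alpha> = (\<lambda>x vs. if length vs = p + q then
     (\<Sum>S | S \<subseteq> {..<p + q} \<and> card S = p.
        \<alpha> x (map (\<lambda>i. (if i \<in> S then part10 (J x) else part01 (J x)) (vs ! i)) [0..<p + q]))
     else 0)"

definition pq_forms :: "(real^4 \<Rightarrow> real^4^4) \<Rightarrow> nat \<Rightarrow> nat \<Rightarrow> cform set" where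
  "pq_forms J p q = {\<alpha> \<in> nil_forms (p + q). bideg J p q \<alpha> = \<alpha>}"

text \<open>The components of \<open>d\<close> of bidegree \<open>(1,0)\<close> and \<open>(0,1)\<close>.\<close>

definition del :: "(real^4 \<Rightarrow> real^4^4) \<Rightarrow> cform \<Rightarrow> cform" where
  "del J \<alpha> = (\<Sum>p\<le>2. \<Sum>q\<le>2. bideg J (p + 1) q (ext_d (bideg J p q \<alpha>)))"

definition delbar :: "(real^4 \<Rightarrow> real^4^4) \<Rightarrow> cform \<Rightarrow> cform" where
  "delbar J \<alpha> = (\<Sum>p\<le>2. \<Sum>q\<le>2. bideg J p (q + 1) (ext_d (bideg J p q \<alpha>)))"


section \<open>Almost Hermitian structures and harmonic forms\<close>

definition almost_hermitian :: "(real^4 \<Rightarrow> real^4^4) \<Rightarrow> cform \<Rightarrow> bool" where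
  "almost_hermitian J \<omega> \<longleftrightarrow> almost_complex J \<and> \<omega> \<in> pq_forms J 1 1 \<and> real_form \<omega> \<and>
     (\<forall>x v. v \<noteq> 0 \<longrightarrow> Re (\<omega> x [cvec v, cvec (J x *v v)]) > 0)"

definition lee_form :: "cform \<Rightarrow> cform" where
  "lee_form \<omega> = (THE \<theta>. \<theta> \<in> nil_forms 1 \<and> real_form \<theta> \<and> ext_d \<omega> = wedge \<theta> \<omega>)"

definition loc_conf_almost_kaehler :: "cform \<Rightarrow> bool" where
  "loc_conf_almost_kaehler \<omega> \<longleftrightarrow> ext_d (lee_form \<omega>) = 0"

text \<open>The Gram matrix of \<open>g(u,v) = \<omega>(u,Jv)\<close> in the standard frame.\<close>

definition metric :: "(real^4 \<Rightarrow> real^4^4) \<Rightarrow> cform \<Rightarrow> real^4 \<Rightarrow> real^4^4" where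
  "metric J \<omega> x = (\<chi> i j. Re (\<omega> x [cvec (axis i 1), cvec (J x *v axis j 1)]))"

definition vol_form :: "cform \<Rightarrow> cform" where
  "vol_form \<omega> = (\<lambda>x vs. (1/2) * wedge \<omega> \<omega> x vs)"

text \<open>
  The dual frame \<open>e\<^sup>i = \<Sum>\<^sub>j g\<^sup>i\<^sup>j e\<^sub>j\<close>, where \<open>(g\<^sup>i\<^sup>j)\<close> is the inverse of the Gram matrix.
\<close>

definition dual_frame :: "(real^4 \<Rightarrow> real^4^4) \<Rightarrow> cform \<Rightarrow> real^4 \<Rightarrow> 4 \<Rightarrow> real^4" where
  "dual_frame J \<omega> x i = matrix_inv (metric J \<omega> x) *v axis i 1"

text \<open>
  The complex linear Hodge operator, given on forms of degree \<open>k\<close> by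
  \<open>(*\<alpha>)(w) = 1/k! \<Sum>\<^bsub>i\<^sub>1,\<dots>,i\<^sub>k\<^esub> \<alpha>(e\<^sup>i\<^sup>1,\<dots>,e\<^sup>i\<^sup>k) vol(e\<^sub>i\<^sub>1,\<dots>,e\<^sub>i\<^sub>k,w)\<close>, so that
  \<open>\<alpha> \<and> *\<beta> = g(\<alpha>,\<beta>) vol\<close> with \<open>g\<close> extended complex bilinearly.
\<close>

definition hodge :: "(real^4 \<Rightarrow> real^4^4) \<Rightarrow> cform \<Rightarrow> cform \<Rightarrow> cform" where
  "hodge J \<omega> \<alpha> = (\<lambda>x ws. 1 / fact (4 - length ws) *
     (\<Sum>is | length is = 4 - length ws.
        \<alpha> x (map (\<lambda>i. cvec (dual_frame J \<omega> x i)) is) *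
        vol_form \<omega> x (map (\<lambda>i. cvec (axis i 1)) is @ ws)))"

definition delbar_adj :: "(real^4 \<Rightarrow> real^4^4) \<Rightarrow> cform \<Rightarrow> cform \<Rightarrow> cform" where
  "delbar_adj J \<omega> \<alpha> = - hodge J \<omega> (del J (hodge J \<omega> \<alpha>))"

definition laplace_delbar :: "(real^4 \<Rightarrow> real^4^4) \<Rightarrow> cform \<Rightarrow> cform \<Rightarrow> cform" where
  "laplace_delbar J \<omega> \<alpha> = delbar J (delbar_adj J \<omega> \<alpha>) + delbar_adj J \<omega> (delbar J \<alpha>)"

definition harmonic_delbar :: "(real^4 \<Rightarrow> real^4^4) \<Rightarrow> cform \<Rightarrow> nat \<Rightarrow> nat \<Rightarrow> cform set" where
  "harmonic_delbar J \<omega> p q = {\<alpha> \<in> pq_forms J p q. laplace_delbar J \<omega> \<alpha> = 0}"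

definition cscale :: "complex \<Rightarrow> cform \<Rightarrow> cform" where
  "cscale c \<alpha> = (\<lambda>x vs. c * \<alpha> x vs)"

definition rscale :: "real \<Rightarrow> cform \<Rightarrow> cform" where
  "rscale r \<alpha> = (\<lambda>x vs. complex_of_real r * \<alpha> x vs)"

lemma vector_space_cscale: "vector_space cscale"
  by unfold_locales (auto simp: cscale_def fun_eq_iff algebra_simps)

lemma vector_space_rscale: "vector_space rscale"
  by unfold_locales (auto simp: rscale_def fun_eq_iff algebra_simps)

text \<open>
  \<open>vector_space.dim\<close> is 0 for an infinite-dimensional space, so that a positive value
  includes finite-dimensionality.
\<close>

definition h_delbar :: "(real^4 \<Rightarrow> real^4^4) \<Rightarrow> cform \<Rightarrow> nat \<Rightarrow> nat \<Rightarrow> nat" where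
  "h_delbar J \<omega> p q = vector_space.dim cscale (harmonic_delbar J \<omega> p q)"

definition d_adj :: "(real^4 \<Rightarrow> real^4^4) \<Rightarrow> cform \<Rightarrow> cform \<Rightarrow> cform" where
  "d_adj J \<omega> \<alpha> = - hodge J \<omega> (ext_d (hodge J \<omega> \<alpha>))"

definition laplace_d :: "(real^4 \<Rightarrow> real^4^4) \<Rightarrow> cform \<Rightarrow> cform \<Rightarrow> cform" where
  "laplace_d J \<omega> \<alpha> = ext_d (d_adj J \<omega> \<alpha>) + d_adj J \<omega> (ext_d \<alpha>)"

definition b_minus :: "(real^4 \<Rightarrow> real^4^4) \<Rightarrow> cform \<Rightarrow> nat" where
  "b_minus J \<omega> = vector_space.dim rscale
     {\<alpha> \<in> nil_forms 2. real_form \<alpha> \<and> hodge J \<omega> \<alpha> = - \<alpha> \<and> laplace_d J \<omega> \<alpha> = 0}"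

end

theory Submission
  imports Defs
begin

text \<open>
  The structure is left invariant. On \<open>G\<close> take the left invariant frame \<open>X\<^sub>1 = \<partial>\<^sub>x\<close>,
  \<open>X\<^sub>2 = \<partial>\<^sub>y + x \<partial>\<^sub>z + (x\<^sup>2/2) \<partial>\<^sub>t\<close>, \<open>X\<^sub>3 = \<partial>\<^sub>z + x \<partial>\<^sub>t\<close>, \<open>X\<^sub>4 = \<partial>\<^sub>t\<close>, whose only brackets are
  \<open>[X\<^sub>1,X\<^sub>2] = X\<^sub>3\<close> and \<open>[X\<^sub>1,X\<^sub>3] = X\<^sub>4\<close>, and its dual coframe, with \<open>de\<^sup>3 = -e\<^sup>1\<^sup>2\<close>, \<open>de\<^sup>4 = -e\<^sup>1\<^sup>3\<close>.
  Put \<open>JX\<^sub>1 = X\<^sub>2\<close>, \<open>JX\<^sub>3 = X\<^sub>4\<close> and \<open>\<omega> = e\<^sup>1\<^sup>2 + e\<^sup>3\<^sup>4\<close>, so that the frame is orthonormal. Then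
  \<open>[X\<^sub>1 + \<i>X\<^sub>2, X\<^sub>3 + \<i>X\<^sub>4] = X\<^sub>4\<close> is not of type (0,1) and \<open>J\<close> is not integrable
  (\<open>not_integrable_nil_J\<close>), while \<open>d\<omega> = -e\<^sup>1\<^sup>2\<^sup>4 = -e\<^sup>4 \<and> \<omega>\<close> shows that the Lee form is \<open>-e\<^sup>4\<close>, which
  is not closed (\<open>not_lcak_nil_omega\<close>).

  A (1,1)-form is \<open>\<alpha> = f\<omega> + \<i>\<gamma>\<close> with
  \<open>\<gamma> = a(e\<^sup>1\<^sup>2 - e\<^sup>3\<^sup>4) + b(e\<^sup>1\<^sup>3 + e\<^sup>2\<^sup>4) + c(e\<^sup>1\<^sup>4 - e\<^sup>2\<^sup>3)\<close> anti-self-dual. The factor \<open>\<i>\<close> makes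
  everything real: with the 3-form \<open>R = d\<gamma> - d\<^sup>c(f\<omega>)\<close> one has \<open>\<partial>bar \<alpha> = \<i>R\<^sup>0\<^sup>1\<close> and
  \<open>\<partial>*\<alpha> = -\<i>R\<^sup>1\<^sup>0\<close>, where \<open>R\<^sup>1\<^sup>0\<close> and \<open>R\<^sup>0\<^sup>1\<close> are the parts of bidegree (2,1) and (1,2). The map
  \<open>D: (f,a,b,c) \<mapsto> R\<close> is a first order operator with constant coefficients in the \<open>X\<^sub>i\<close>, and the
  Laplacian of \<open>\<alpha>\<close> has the components \<open>D\<^sup>*D(f,a,b,c) / 2\<close> (\<open>laplace_delbar_form11\<close>). The same operator
  with \<open>f = 0\<close> describes the \<open>d\<close>-Laplacian on anti-self-dual forms (\<open>laplace_d_form11\<close>).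

  The fields \<open>X\<^sub>i\<close> are divergence free on the compact quotient (\<open>nil_int_lie\<close>), so a nonnegative function
  that is a divergence vanishes (\<open>nonneg_divergence_eq_0\<close>). Hence the kernel of \<open>D\<^sup>*D\<close> is that of \<open>D\<close>
  (\<open>dirac_adjoint_kernel\<close>). From \<open>R = 0\<close> follows \<open>dd\<^sup>c(f\<omega>) = dd\<gamma> = 0\<close>, a scalar equation whose only solutions
  are the constants (\<open>dirac_kernel_function_const\<close>). For \<open>f = u\<close> constant, \<open>d\<^sup>c(u\<omega>) = -u d(e\<^sup>1\<^sup>3 + e\<^sup>2\<^sup>4)\<close>
  is the differential of an anti-self-dual form; this is where the extra harmonic form comes from.
  What remains is a closed anti-self-dual form, and energy identities in the directions \<open>X\<^sub>4\<close>, \<open>X\<^sub>3\<close>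
  and then \<open>X\<^sub>1, X\<^sub>2\<close> show that it is a multiple of \<open>e\<^sup>1\<^sup>4 - e\<^sup>2\<^sup>3\<close> (\<open>closed_asd_real\<close>).

  So the \<open>\<partial>bar\<close>-harmonic (1,1)-forms are spanned over \<open>\<complex>\<close> by \<open>\<omega> - \<i>(e\<^sup>1\<^sup>3 + e\<^sup>2\<^sup>4)\<close> and
  \<open>e\<^sup>1\<^sup>4 - e\<^sup>2\<^sup>3\<close>, and the real anti-self-dual harmonic forms over \<open>\<real>\<close> by the second one.
\<close>

section \<open>Smooth functions\<close>

lemma frechet_derivative_partial:
  fixes f :: "real^4 \<Rightarrow> 'b::real_normed_vector"
  assumes "f differentiable (at x)"
  shows "frechet_derivative f (at x) v = (\<Sum>j\<in>UNIV. v$j *\<^sub>R partial_deriv j f x)"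
proof -
  have l: "linear (frechet_derivative f (at x))"
    using assms linear_frechet_derivative by blast
  have "frechet_derivative f (at x) v = frechet_derivative f (at x) (\<Sum>j\<in>UNIV. v$j *\<^sub>R axis j 1)"
    using basis_expansion[of v] by (simp add: scalar_mult_eq_scaleR)
  also have "\<dots> = (\<Sum>j\<in>UNIV. v$j *\<^sub>R frechet_derivative f (at x) (axis j 1))"
    using l by (simp add: linear_sum linear_cmul)
  finally show ?thesis by (simp add: partial_deriv_def)
qed

lemma frechet_derivative_eqI:
  "(f has_derivative f') (at x) \<Longrightarrow> frechet_derivative f (at x) v = f' v"
  using frechet_derivative_at by metis

lemma partial_deriv_eqI:
  "(f has_derivative f') (at x) \<Longrightarrow> partial_deriv j f x = f' (axis j 1)"
  unfolding partial_deriv_def by (rule frechet_derivative_eqI)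

lemma C_k_on_SucD: "C_k_on (Suc k) U f \<Longrightarrow> C_k_on k U f"
proof (induction k arbitrary: f)
  case 0
  then show ?case
    by (simp add: continuous_at_imp_continuous_on differentiable_imp_continuous_within)
next
  case (Suc k)
  then show ?case using C_k_on.simps(2) by metis
qed

lemma smooth_on_iff:
  "smooth_on U f \<longleftrightarrow> (\<forall>x\<in>U. f differentiable (at x)) \<and> (\<forall>j. smooth_on U (partial_deriv j f))"
proof -
  have "smooth_on U f \<longleftrightarrow> (\<forall>k. C_k_on (Suc k) U f)"
    unfolding smooth_on_def using C_k_on_SucD by blast
  then show ?thesis unfolding smooth_on_def by auto
qed

lemma smooth_on_differentiable: "smooth_on UNIV f \<Longrightarrow> f differentiable (at x)"
  using smooth_on_iff by blast

lemma smooth_on_has_derivative: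
  "smooth_on UNIV f \<Longrightarrow> (f has_derivative frechet_derivative f (at x)) (at x)"
  using smooth_on_differentiable frechet_derivative_works by blast

lemma smooth_on_continuous: "smooth_on U f \<Longrightarrow> continuous_on U f"
  unfolding smooth_on_def using C_k_on.simps(1) by blast

named_theorems smooth_intros

lemma C_k_on_const: "C_k_on k UNIV (\<lambda>x. c)"
proof (induction k arbitrary: c)
  case (Suc k)
  have "partial_deriv j (\<lambda>x. c) = (\<lambda>x. 0)" for j
    by (rule ext) (rule partial_deriv_eqI[where f' = "\<lambda>x. 0", simplified], simp)
  then show ?case using Suc[of 0] by simp
qed simp

lemma smooth_const [smooth_intros]: "smooth_on UNIV (\<lambda>x. c)"
  unfolding smooth_on_def using C_k_on_const by blast

lemma frechet_derivative_cong_open: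
  assumes "open U" "x \<in> U" "\<And>y. y \<in> U \<Longrightarrow> f y = g y"
  shows "frechet_derivative f (at x) = frechet_derivative g (at x)"
proof -
  have "(f has_derivative D) (at x) \<longleftrightarrow> (g has_derivative D) (at x)" for D
    using assms has_derivative_transform_within_open[of _ _ x UNIV U] by (metis (no_types, lifting))
  then show ?thesis unfolding frechet_derivative_def by simp
qed

lemma differentiable_cong_open:
  assumes "open U" "x \<in> U" "\<And>y. y \<in> U \<Longrightarrow> f y = g y"
  shows "f differentiable (at x) \<longleftrightarrow> g differentiable (at x)"
  unfolding differentiable_def
  using assms has_derivative_transform_within_open[of _ _ x UNIV U] by (metis (no_types, lifting))

lemma C_k_on_cong:
  "open U \<Longrightarrow> (\<And>x. x \<in> U \<Longrightarrow> f x = g x) \<Longrightarrow> C_k_on k U f \<Longrightarrow> C_k_on k U g"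
proof (induction k arbitrary: f g)
  case 0
  then show ?case using continuous_on_cong by (metis C_k_on.simps(1))
next
  case (Suc k)
  have "C_k_on k U (partial_deriv j g)" for j
  proof (rule Suc.IH[OF Suc.prems(1)])
    show "partial_deriv j f x = partial_deriv j g x" if "x \<in> U" for x
      unfolding partial_deriv_def using frechet_derivative_cong_open[OF Suc.prems(1) that] Suc.prems(2) by metis
    show "C_k_on k U (partial_deriv j f)" using Suc.prems(3) by simp
  qed
  moreover have "g differentiable (at x)" if "x \<in> U" for x
    using differentiable_cong_open[OF Suc.prems(1) that, of f g] Suc.prems(2,3) that by simp
  ultimately show ?case by simp
qed

lemma C_k_on_linear:
  assumes h: "bounded_linear h" and U: "open U"
  shows "C_k_on k U f \<Longrightarrow> C_k_on k U (\<lambda>x. h (f x))"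
proof (induction k arbitrary: f)
  case 0
  then show ?case using h by (auto intro: bounded_linear.continuous_on)
next
  case (Suc k)
  have d: "((\<lambda>x. h (f x)) has_derivative (\<lambda>v. h (frechet_derivative f (at x) v))) (at x)" if "x \<in> U" for x
    using Suc.prems that by (auto intro!: bounded_linear.has_derivative[OF h] simp: frechet_derivative_works)
  have "C_k_on k U (partial_deriv j (\<lambda>x. h (f x)))" for j
  proof (rule C_k_on_cong[OF U])
    show "C_k_on k U (\<lambda>x. h (partial_deriv j f x))" using Suc by simp
    show "h (partial_deriv j f x) = partial_deriv j (\<lambda>x. h (f x)) x" if "x \<in> U" for x
      by (simp add: partial_deriv_eqI[OF d[OF that]], simp add: partial_deriv_def)
  qed
  then show ?case using differentiableI[OF d] by auto
qed

lemma smooth_linear: "bounded_linear h \<Longrightarrow> smooth_on UNIV f \<Longrightarrow> smooth_on UNIV (\<lambda>x. h (f x))"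
  unfolding smooth_on_def using C_k_on_linear[OF _ open_UNIV] by blast

lemma C_k_on_add: "C_k_on k UNIV f \<Longrightarrow> C_k_on k UNIV g \<Longrightarrow> C_k_on k UNIV (\<lambda>x. f x + g x)"
proof (induction k arbitrary: f g)
  case 0
  then show ?case by (auto intro: continuous_on_add)
next
  case (Suc k)
  have d: "((\<lambda>x. f x + g x) has_derivative
      (\<lambda>v. frechet_derivative f (at x) v + frechet_derivative g (at x) v)) (at x)" for x
    using Suc.prems by (auto intro!: has_derivative_add simp: frechet_derivative_works)
  have "partial_deriv j (\<lambda>x. f x + g x) = (\<lambda>x. partial_deriv j f x + partial_deriv j g x)" for j
    by (rule ext) (simp add: partial_deriv_eqI[OF d], simp add: partial_deriv_def)
  then show ?case using Suc differentiableI[OF d] by auto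
qed

lemma smooth_add [smooth_intros]:
  "smooth_on UNIV f \<Longrightarrow> smooth_on UNIV g \<Longrightarrow> smooth_on UNIV (\<lambda>x. f x + g x)"
  unfolding smooth_on_def using C_k_on_add by blast

lemma C_k_on_bilinear:
  assumes h: "bounded_bilinear h"
  shows "C_k_on k UNIV f \<Longrightarrow> C_k_on k UNIV g \<Longrightarrow> C_k_on k UNIV (\<lambda>x. h (f x) (g x))"
proof (induction k arbitrary: f g)
  case 0
  then show ?case using h by (auto intro: bounded_bilinear.continuous_on)
next
  case (Suc k)
  have d: "((\<lambda>x. h (f x) (g x)) has_derivative
      (\<lambda>v. h (f x) (frechet_derivative g (at x) v) + h (frechet_derivative f (at x) v) (g x))) (at x)" for x
    using Suc.prems by (auto intro!: bounded_bilinear.FDERIV[OF h] simp: frechet_derivative_works)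
  have "partial_deriv j (\<lambda>x. h (f x) (g x))
      = (\<lambda>x. h (f x) (partial_deriv j g x) + h (partial_deriv j f x) (g x))" for j
    by (rule ext) (simp add: partial_deriv_eqI[OF d], simp add: partial_deriv_def)
  moreover have "C_k_on k UNIV f" "C_k_on k UNIV g" using Suc.prems C_k_on_SucD by blast+
  ultimately show ?case using Suc differentiableI[OF d] by (auto intro!: C_k_on_add)
qed

lemma smooth_bilinear:
  "bounded_bilinear h \<Longrightarrow> smooth_on UNIV f \<Longrightarrow> smooth_on UNIV g \<Longrightarrow>
    smooth_on UNIV (\<lambda>x. h (f x) (g x))"
  unfolding smooth_on_def using C_k_on_bilinear by blast

lemma smooth_mult [smooth_intros]:
  fixes f g :: "real^4 \<Rightarrow> 'b::real_normed_algebra"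
  shows "smooth_on UNIV f \<Longrightarrow> smooth_on UNIV g \<Longrightarrow> smooth_on UNIV (\<lambda>x. f x * g x)"
  by (rule smooth_bilinear[OF bounded_bilinear_mult])

lemma smooth_scaleR [smooth_intros]:
  "smooth_on UNIV f \<Longrightarrow> smooth_on UNIV g \<Longrightarrow> smooth_on UNIV (\<lambda>x. f x *\<^sub>R g x)"
  by (rule smooth_bilinear[OF bounded_bilinear_scaleR])

lemma smooth_minus [smooth_intros]: "smooth_on UNIV f \<Longrightarrow> smooth_on UNIV (\<lambda>x. - f x)"
  by (rule smooth_linear[OF bounded_linear_minus[OF bounded_linear_ident]])

lemma smooth_diff [smooth_intros]:
  "smooth_on UNIV f \<Longrightarrow> smooth_on UNIV g \<Longrightarrow> smooth_on UNIV (\<lambda>x. f x - g x)"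
  using smooth_add[of f "\<lambda>x. - g x"] smooth_minus[of g] by simp

lemma smooth_divide_numeral [smooth_intros]:
  fixes f :: "real^4 \<Rightarrow> 'b::real_normed_field"
  shows "smooth_on UNIV f \<Longrightarrow> smooth_on UNIV (\<lambda>x. f x / numeral n)"
  using smooth_mult[OF _ smooth_const[of "1 / numeral n"]] by fastforce

lemma smooth_power [smooth_intros]:
  fixes f :: "real^4 \<Rightarrow> 'b::real_normed_field"
  shows "smooth_on UNIV f \<Longrightarrow> smooth_on UNIV (\<lambda>x. f x ^ n)"
  by (induction n) (auto intro: smooth_intros)

lemma smooth_sum [smooth_intros]:
  "(\<And>i. i \<in> I \<Longrightarrow> smooth_on UNIV (f i)) \<Longrightarrow> smooth_on UNIV (\<lambda>x. \<Sum>i\<in>I. f i x)"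
  by (induction I rule: infinite_finite_induct) (auto intro: smooth_intros)

lemma smooth_of_real [smooth_intros]:
  "smooth_on UNIV f \<Longrightarrow> smooth_on UNIV (\<lambda>x. complex_of_real (f x))"
  by (rule smooth_linear[OF bounded_linear_of_real])

lemma smooth_Re [smooth_intros]: "smooth_on UNIV f \<Longrightarrow> smooth_on UNIV (\<lambda>x. Re (f x))"
  by (rule smooth_linear[OF bounded_linear_Re])

lemma smooth_Im [smooth_intros]: "smooth_on UNIV f \<Longrightarrow> smooth_on UNIV (\<lambda>x. Im (f x))"
  by (rule smooth_linear[OF bounded_linear_Im])

lemma has_derivative_coord: "((\<lambda>x. x$i) has_derivative (\<lambda>v. v$i)) (at x)"
  by (rule bounded_linear_imp_has_derivative) (rule bounded_linear_vec_nth)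

lemma smooth_coord [smooth_intros]: "smooth_on UNIV (\<lambda>x::real^4. x$i)"
proof -
  have "partial_deriv j (\<lambda>x::real^4. x$i) = (\<lambda>x. axis j 1 $ i)" for j
    by (rule ext) (rule partial_deriv_eqI[OF has_derivative_coord])
  then show ?thesis
    using has_derivative_coord
    by (subst smooth_on_iff) (auto simp: differentiable_def intro: smooth_intros)
qed

lemma smooth_partial_deriv [smooth_intros]: "smooth_on UNIV f \<Longrightarrow> smooth_on UNIV (partial_deriv j f)"
  using smooth_on_iff by blast

subsection \<open>Symmetry of second derivatives\<close>

lemma has_real_derivative_line:
  fixes f :: "real^4 \<Rightarrow> real"
  assumes "f differentiable (at (p + s *\<^sub>R axis i 1))"
  shows "((\<lambda>s. f (p + s *\<^sub>R axis i 1)) has_real_derivative partial_deriv i f (p + s *\<^sub>R axis i 1)) (at s)"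
proof -
  have "((\<lambda>s. f (p + s *\<^sub>R axis i 1)) has_derivative
     (\<lambda>h. frechet_derivative f (at (p + s *\<^sub>R axis i 1)) (0 + h *\<^sub>R axis i 1))) (at s)"
    by (rule has_derivative_compose[where f = "\<lambda>s. p + s *\<^sub>R axis i 1"])
       (use assms in \<open>auto intro!: derivative_eq_intros simp: frechet_derivative_works[symmetric]\<close>)
  moreover have "frechet_derivative f (at (p + s *\<^sub>R axis i 1)) (0 + h *\<^sub>R axis i 1)
      = partial_deriv i f (p + s *\<^sub>R axis i 1) * h" for h
    using linear_cmul[OF linear_frechet_derivative[OF assms]]
    by (simp add: partial_deriv_def)
  ultimately show ?thesis by (simp add: has_field_derivative_def)
qed

text \<open>Two applications of the mean value theorem, first in the direction \<open>i\<close> and then in the direction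
  \<open>j\<close>. The second difference is symmetric in \<open>i\<close> and \<open>j\<close>, so it is also a value of the other mixed
  derivative; letting \<open>h\<close> tend to 0 proves Schwarz's theorem.\<close>

lemma second_difference_mvt:
  fixes f :: "real^4 \<Rightarrow> real"
  assumes "h > 0"
    and f: "\<And>s t. \<lbrakk>0 \<le> s; s \<le> h; 0 \<le> t; t \<le> h\<rbrakk> \<Longrightarrow> f differentiable (at (p + s *\<^sub>R axis i 1 + t *\<^sub>R axis j 1))"
    and g: "\<And>s t. \<lbrakk>0 \<le> s; s \<le> h; 0 \<le> t; t \<le> h\<rbrakk> \<Longrightarrow>
      partial_deriv i f differentiable (at (p + s *\<^sub>R axis i 1 + t *\<^sub>R axis j 1))"
  obtains s t where "0 < s" "s < h" "0 < t" "t < h"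
    "f (p + h *\<^sub>R axis i 1 + h *\<^sub>R axis j 1) - f (p + h *\<^sub>R axis i 1) - f (p + h *\<^sub>R axis j 1) + f p
      = h^2 * partial_deriv j (partial_deriv i f) (p + s *\<^sub>R axis i 1 + t *\<^sub>R axis j 1)"
proof -
  let ?F = "\<lambda>s. f (p + h *\<^sub>R axis j 1 + s *\<^sub>R axis i 1) - f (p + s *\<^sub>R axis i 1)"
  let ?F' = "\<lambda>s. partial_deriv i f (p + h *\<^sub>R axis j 1 + s *\<^sub>R axis i 1) - partial_deriv i f (p + s *\<^sub>R axis i 1)"
  have "(?F has_real_derivative ?F' s) (at s)" if "0 \<le> s" "s \<le> h" for s
    using f[of s h] f[of s 0] that \<open>h > 0\<close>
    by (intro DERIV_diff has_real_derivative_line) (simp_all add: algebra_simps)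
  then obtain s where s: "0 < s" "s < h" "?F h - ?F 0 = (h - 0) * ?F' s"
    using MVT2[of 0 h ?F ?F'] \<open>h > 0\<close> by blast
  let ?G = "\<lambda>t. partial_deriv i f (p + s *\<^sub>R axis i 1 + t *\<^sub>R axis j 1)"
  let ?G' = "\<lambda>t. partial_deriv j (partial_deriv i f) (p + s *\<^sub>R axis i 1 + t *\<^sub>R axis j 1)"
  have "(?G has_real_derivative ?G' t) (at t)" if "0 \<le> t" "t \<le> h" for t
    using g[of s t] that s by (intro has_real_derivative_line) simp_all
  then obtain t where t: "0 < t" "t < h" "?G h - ?G 0 = (h - 0) * ?G' t"
    using MVT2[of 0 h ?G ?G'] \<open>h > 0\<close> by blast
  have "?F h - ?F 0 = h * (h * ?G' t)"
    using s(3) t(3) by (simp add: algebra_simps)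
  then show ?thesis
    using that[of s t] s t by (simp add: algebra_simps power2_eq_square)
qed

lemma partial_deriv_commute_real:
  fixes f :: "real^4 \<Rightarrow> real"
  assumes U: "open U" "p \<in> U" and sm: "smooth_on U f"
  shows "partial_deriv i (partial_deriv j f) p = partial_deriv j (partial_deriv i f) p"
proof -
  let ?L = "partial_deriv i (partial_deriv j f)" and ?R = "partial_deriv j (partial_deriv i f)"
  have d: "f differentiable (at x)" "partial_deriv k f differentiable (at x)" if "x \<in> U" for x k
    using sm that smooth_on_iff by blast+
  have c: "isCont ?L p" "isCont ?R p"
    using sm smooth_on_iff smooth_on_continuous continuous_on_eq_continuous_at U by metis+
  have "\<bar>?L p - ?R p\<bar> < e" if "e > 0" for e
  proof -
    have "(?L \<longlongrightarrow> ?L p) (nhds p)" "(?R \<longlongrightarrow> ?R p) (nhds p)"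
      using c unfolding isCont_def tendsto_at_iff_tendsto_nhds .
    then have "\<forall>\<^sub>F x in nhds p. dist (?L x) (?L p) < e/2" "\<forall>\<^sub>F x in nhds p. dist (?R x) (?R p) < e/2"
      by (auto intro!: tendstoD half_gt_zero that simp del: less_divide_eq_numeral1)
    then have "\<forall>\<^sub>F x in nhds p. x \<in> U \<and> dist (?L x) (?L p) < e/2 \<and> dist (?R x) (?R p) < e/2"
      using eventually_nhds_in_open[OF U] by (auto simp del: le_divide_eq_numeral1 less_divide_eq_numeral1 intro: eventually_conj)
    then obtain r where r: "r > 0" "\<And>x. dist x p < r \<Longrightarrow>
        x \<in> U \<and> dist (?L x) (?L p) < e/2 \<and> dist (?R x) (?R p) < e/2"
      unfolding eventually_nhds_metric by blast
    define h where "h = r / 3"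
    have h: "h > 0" using r by (simp add: h_def)
    have near: "dist (p + s *\<^sub>R axis k 1 + t *\<^sub>R axis l 1) p < r"
      if "0 \<le> s" "s \<le> h" "0 \<le> t" "t \<le> h" for s t and k l :: 4
    proof -
      have "dist (p + s *\<^sub>R axis k 1 + t *\<^sub>R axis l 1) p = norm (s *\<^sub>R axis k 1 + t *\<^sub>R axis l 1 :: real^4)"
        by (simp add: dist_norm add.assoc)
      also have "\<dots> \<le> norm (s *\<^sub>R axis k 1 :: real^4) + norm (t *\<^sub>R axis l 1 :: real^4)"
        by (rule norm_triangle_ineq)
      also have "\<dots> \<le> h + h" using that by (simp add: norm_axis_1)
      also have "\<dots> < r" using r by (simp add: h_def)
      finally show ?thesis .
    qed
    have inU: "p + s *\<^sub>R axis k 1 + t *\<^sub>R axis l 1 \<in> U"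
      if "0 \<le> s" "s \<le> h" "0 \<le> t" "t \<le> h" for s t and k l :: 4
      using near[OF that] r(2) by blast
    obtain s t where st: "0 < s" "s < h" "0 < t" "t < h"
      "f (p + h *\<^sub>R axis i 1 + h *\<^sub>R axis j 1) - f (p + h *\<^sub>R axis i 1) - f (p + h *\<^sub>R axis j 1) + f p
      = h^2 * ?R (p + s *\<^sub>R axis i 1 + t *\<^sub>R axis j 1)"
      by (rule second_difference_mvt[OF h d(1)[OF inU] d(2)[OF inU]])
    obtain s' t' where st': "0 < s'" "s' < h" "0 < t'" "t' < h"
      "f (p + h *\<^sub>R axis j 1 + h *\<^sub>R axis i 1) - f (p + h *\<^sub>R axis j 1) - f (p + h *\<^sub>R axis i 1) + f p
      = h^2 * ?L (p + s' *\<^sub>R axis j 1 + t' *\<^sub>R axis i 1)"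
      by (rule second_difference_mvt[OF h d(1)[OF inU] d(2)[OF inU]])
    have "h^2 * ?R (p + s *\<^sub>R axis i 1 + t *\<^sub>R axis j 1) = h^2 * ?L (p + s' *\<^sub>R axis j 1 + t' *\<^sub>R axis i 1)"
      using st(5) st'(5) by (simp add: algebra_simps)
    then have eq: "?R (p + s *\<^sub>R axis i 1 + t *\<^sub>R axis j 1) = ?L (p + s' *\<^sub>R axis j 1 + t' *\<^sub>R axis i 1)"
      using h by simp
    have "dist (?R (p + s *\<^sub>R axis i 1 + t *\<^sub>R axis j 1)) (?R p) < e/2"
      using near[of s t i j] st r(2) by simp
    moreover have "dist (?L (p + s' *\<^sub>R axis j 1 + t' *\<^sub>R axis i 1)) (?L p) < e/2"
      using near[of s' t' j i] st' r(2) by simp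
    ultimately show ?thesis using eq unfolding dist_real_def by linarith
  qed
  from this[of "\<bar>?L p - ?R p\<bar>"] show ?thesis by auto
qed

section \<open>The invariant frame\<close>

text \<open>Smooth functions on \<open>\<Gamma>\<setminus>G\<close>, represented like the forms by invariant objects on \<open>G\<close>.\<close>

definition nil_smooth :: "(real^4 \<Rightarrow> 'b::real_normed_vector) \<Rightarrow> bool" where
  "nil_smooth f \<longleftrightarrow> smooth_on UNIV f \<and> (\<forall>g\<in>nil_lattice. \<forall>x. f (nil_mult g x) = f x)"

text \<open>The fields \<open>X\<^sub>i\<close>. They are invariant under all left translations (\<open>nil_lin_frame\<close>), hence descend to
  \<open>\<Gamma>\<setminus>G\<close> and act on the functions there.\<close>

definition frame :: "4 \<Rightarrow> real^4 \<Rightarrow> real^4" where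
  "frame i x = (if i = 1 then vector [1, 0, 0, 0]
     else if i = 2 then vector [0, 1, x$1, (x$1)^2 / 2]
     else if i = 3 then vector [0, 0, 1, x$1] else vector [0, 0, 0, 1])"

lemma frame_nth:
  "frame 1 x $ 1 = 1" "frame 1 x $ 2 = 0" "frame 1 x $ 3 = 0" "frame 1 x $ 4 = 0"
  "frame 2 x $ 1 = 0" "frame 2 x $ 2 = 1" "frame 2 x $ 3 = x$1" "frame 2 x $ 4 = (x$1)^2 / 2"
  "frame 3 x $ 1 = 0" "frame 3 x $ 2 = 0" "frame 3 x $ 3 = 1" "frame 3 x $ 4 = x$1"
  "frame 4 x $ 1 = 0" "frame 4 x $ 2 = 0" "frame 4 x $ 3 = 0" "frame 4 x $ 4 = 1"
  by (simp_all add: frame_def vector_4)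

lemma smooth_frame_nth [smooth_intros]: "smooth_on UNIV (\<lambda>x. frame i x $ j)"
  using exhaust_4[of i] exhaust_4[of j] by (elim disjE; simp add: frame_nth; intro smooth_intros)

definition lie :: "4 \<Rightarrow> (real^4 \<Rightarrow> 'b::real_normed_vector) \<Rightarrow> real^4 \<Rightarrow> 'b" where
  "lie i f x = frechet_derivative f (at x) (frame i x)"

lemma lie_partial:
  "f differentiable (at x) \<Longrightarrow> lie i f x = (\<Sum>j\<in>UNIV. frame i x $ j *\<^sub>R partial_deriv j f x)"
  unfolding lie_def by (rule frechet_derivative_partial)

lemma lie_partial_simps:
  fixes f :: "real^4 \<Rightarrow> 'b::real_normed_vector"
  assumes "f differentiable (at x)"
  shows "lie 1 f x = partial_deriv 1 f x"
    "lie 2 f x = partial_deriv 2 f x + x$1 *\<^sub>R partial_deriv 3 f x + ((x$1)^2 / 2) *\<^sub>R partial_deriv 4 f x"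
    "lie 3 f x = partial_deriv 3 f x + x$1 *\<^sub>R partial_deriv 4 f x"
    "lie 4 f x = partial_deriv 4 f x"
  using assms by (simp_all add: lie_partial sum_4 frame_nth)

lemma lie_eqI: "(f has_derivative D) (at x) \<Longrightarrow> lie i f x = D (frame i x)"
  unfolding lie_def by (rule frechet_derivative_eqI)

lemma smooth_lie [smooth_intros]: "smooth_on UNIV f \<Longrightarrow> smooth_on UNIV (lie i f)"
proof -
  assume f: "smooth_on UNIV f"
  have "lie i f = (\<lambda>x. \<Sum>j\<in>UNIV. frame i x $ j *\<^sub>R partial_deriv j f x)"
    using f smooth_on_differentiable lie_partial by blast
  then show ?thesis using f by (auto intro!: smooth_intros)
qed

text \<open>The differential of a left translation; it does not depend on the base point.\<close>

definition nil_lin :: "real^4 \<Rightarrow> real^4 \<Rightarrow> real^4" where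
  "nil_lin g v = vector [v$1, v$2, v$3 + g$1 * v$2, v$4 + (1/2) * (g$1)^2 * v$2 + g$1 * v$3]"

lemma nil_lin_nth:
  "nil_lin g v $ 1 = v$1" "nil_lin g v $ 2 = v$2" "nil_lin g v $ 3 = v$3 + g$1 * v$2"
  "nil_lin g v $ 4 = v$4 + (1/2) * (g$1)^2 * v$2 + g$1 * v$3"
  by (simp_all add: nil_lin_def vector_4)

lemma linear_nil_lin: "linear (nil_lin g)"
  by (rule linearI) (simp_all add: vec_eq_iff forall_4 nil_lin_nth algebra_simps)

lemma has_derivative_nil_mult: "(nil_mult g has_derivative nil_lin g) (at x)"
proof -
  have "nil_mult g = (\<lambda>u. nil_lin g u + g)"
    by (rule ext) (simp add: vec_eq_iff forall_4 nil_lin_nth nil_mult_nth)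
  moreover have "(nil_lin g has_derivative nil_lin g) (at x)"
    by (rule linear_imp_has_derivative) (rule linear_nil_lin)
  ultimately show ?thesis by (auto intro!: derivative_eq_intros)
qed

lemma nil_diff_eq: "nil_diff g x = matrix (nil_lin g)"
proof -
  have "frechet_derivative (nil_mult g) (at x) = nil_lin g"
    by (rule ext) (rule frechet_derivative_eqI[OF has_derivative_nil_mult])
  then show ?thesis by (simp add: nil_diff_def)
qed

lemma nil_diff_vec: "nil_diff g x *v v = nil_lin g v"
  unfolding nil_diff_eq using matrix_works[of "nil_lin g"] linear_nil_lin[of g]
  by (simp add: linear_matrix_vector_mul_eq)

lemma nil_lin_frame: "nil_lin g (frame i x) = frame i (nil_mult g x)"
  using exhaust_4[of i]
  by (elim disjE) (simp_all add: vec_eq_iff forall_4 nil_lin_nth frame_nth nil_mult_nth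
      algebra_simps power2_eq_square add_divide_distrib)

lemma lie_nil_mult:
  assumes "f differentiable (at (nil_mult g x))" "\<And>y. f (nil_mult g y) = f y"
  shows "lie i f (nil_mult g x) = lie i f x"
proof -
  have "((\<lambda>y. f (nil_mult g y)) has_derivative
      (\<lambda>v. frechet_derivative f (at (nil_mult g x)) (nil_lin g v))) (at x)"
    using assms(1) by (intro has_derivative_compose[OF has_derivative_nil_mult])
      (simp add: frechet_derivative_works[symmetric])
  then have "lie i f x = frechet_derivative f (at (nil_mult g x)) (nil_lin g (frame i x))"
    unfolding assms(2) by (rule lie_eqI)
  then show ?thesis by (simp add: lie_def nil_lin_frame)
qed

named_theorems nil_intros

lemma nil_smooth_lie [nil_intros]: "nil_smooth f \<Longrightarrow> nil_smooth (lie i f)"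
  unfolding nil_smooth_def
  using smooth_on_differentiable lie_nil_mult smooth_lie by blast

lemma nil_smooth_const [nil_intros]: "nil_smooth (\<lambda>x. c)"
  by (simp add: nil_smooth_def smooth_intros)

lemma nil_smooth_add [nil_intros]: "nil_smooth f \<Longrightarrow> nil_smooth g \<Longrightarrow> nil_smooth (\<lambda>x. f x + g x)"
  by (simp add: nil_smooth_def smooth_intros)

lemma nil_smooth_diff [nil_intros]: "nil_smooth f \<Longrightarrow> nil_smooth g \<Longrightarrow> nil_smooth (\<lambda>x. f x - g x)"
  by (simp add: nil_smooth_def smooth_intros)

lemma nil_smooth_minus [nil_intros]: "nil_smooth f \<Longrightarrow> nil_smooth (\<lambda>x. - f x)"
  by (simp add: nil_smooth_def smooth_intros)

lemma nil_smooth_mult [nil_intros]: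
  fixes f g :: "real^4 \<Rightarrow> 'b::real_normed_algebra"
  shows "nil_smooth f \<Longrightarrow> nil_smooth g \<Longrightarrow> nil_smooth (\<lambda>x. f x * g x)"
  by (simp add: nil_smooth_def smooth_intros)

lemma nil_smooth_divide [nil_intros]:
  fixes f :: "real^4 \<Rightarrow> 'b::real_normed_field"
  shows "nil_smooth f \<Longrightarrow> nil_smooth (\<lambda>x. f x / numeral n)"
  by (simp add: nil_smooth_def smooth_intros)

lemma nil_smooth_Re [nil_intros]: "nil_smooth f \<Longrightarrow> nil_smooth (\<lambda>x. Re (f x))"
  by (simp add: nil_smooth_def smooth_intros)

lemma nil_smooth_Im [nil_intros]: "nil_smooth f \<Longrightarrow> nil_smooth (\<lambda>x. Im (f x))"
  by (simp add: nil_smooth_def smooth_intros)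

lemma nil_smooth_has_derivative:
  "nil_smooth f \<Longrightarrow> (f has_derivative frechet_derivative f (at x)) (at x)"
  unfolding nil_smooth_def using smooth_on_has_derivative by blast

lemma lie_const: "lie i (\<lambda>x. c) x = 0"
  by (rule lie_eqI) simp

lemma lie_add: "nil_smooth f \<Longrightarrow> nil_smooth g \<Longrightarrow> lie i (\<lambda>x. f x + g x) x = lie i f x + lie i g x"
  unfolding lie_def[of i f] lie_def[of i g]
  by (rule lie_eqI) (intro has_derivative_add nil_smooth_has_derivative)

lemma lie_diff: "nil_smooth f \<Longrightarrow> nil_smooth g \<Longrightarrow> lie i (\<lambda>x. f x - g x) x = lie i f x - lie i g x"
  unfolding lie_def[of i f] lie_def[of i g]
  by (rule lie_eqI) (intro has_derivative_diff nil_smooth_has_derivative)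

lemma lie_minus: "nil_smooth f \<Longrightarrow> lie i (\<lambda>x. - f x) x = - lie i f x"
  unfolding lie_def[of i f]
  by (rule lie_eqI) (intro has_derivative_minus nil_smooth_has_derivative)

lemma lie_mult:
  fixes f g :: "real^4 \<Rightarrow> 'b::real_normed_algebra"
  shows "nil_smooth f \<Longrightarrow> nil_smooth g \<Longrightarrow> lie i (\<lambda>x. f x * g x) x = f x * lie i g x + lie i f x * g x"
  unfolding lie_def[of i f] lie_def[of i g]
  by (rule lie_eqI) (intro has_derivative_mult nil_smooth_has_derivative)

lemma lie_divide:
  fixes f :: "real^4 \<Rightarrow> 'b::real_normed_field"
  shows "nil_smooth f \<Longrightarrow> lie i (\<lambda>x. f x / c) x = lie i f x / c"
  unfolding lie_def[of i f]
  by (rule lie_eqI) (intro bounded_linear.has_derivative[OF bounded_linear_divide] nil_smooth_has_derivative)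

lemma lie_Re: "nil_smooth f \<Longrightarrow> lie i (\<lambda>x. Re (f x)) x = Re (lie i f x)"
  unfolding lie_def[of i f]
  by (rule lie_eqI) (intro has_derivative_Re nil_smooth_has_derivative)

lemma lie_Im: "nil_smooth f \<Longrightarrow> lie i (\<lambda>x. Im (f x)) x = Im (lie i f x)"
  unfolding lie_def[of i f]
  by (rule lie_eqI) (intro has_derivative_Im nil_smooth_has_derivative)

subsection \<open>Commutators\<close>

lemma lie_cong_open:
  "open U \<Longrightarrow> x \<in> U \<Longrightarrow> (\<And>y. y \<in> U \<Longrightarrow> f y = g y) \<Longrightarrow> lie i f x = lie i g x"
  unfolding lie_def using frechet_derivative_cong_open by metis

text \<open>The first sum is symmetric in \<open>i\<close> and \<open>j\<close>, so brackets see only the derivatives of the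
  coefficients. The statement is local because the charts in the integrability argument are.\<close>

lemma lie_lie:
  fixes f :: "real^4 \<Rightarrow> real"
  assumes U: "open U" "p \<in> U" and sm: "smooth_on U f"
  shows "lie i (lie j f) p = (\<Sum>l\<in>UNIV. \<Sum>k\<in>UNIV. frame i p $ k * (frame j p $ l * partial_deriv k (partial_deriv l f) p))
      + (\<Sum>l\<in>UNIV. lie i (\<lambda>x. frame j x $ l) p * partial_deriv l f p)"
proof -
  have f: "f differentiable (at x)" "partial_deriv l f differentiable (at x)" if "x \<in> U" for x l
    using sm that smooth_on_iff by blast+
  have "lie i (lie j f) p = lie i (\<lambda>x. \<Sum>l\<in>UNIV. frame j x $ l * partial_deriv l f x) p"
    using U f by (intro lie_cong_open[of U]) (simp_all add: lie_partial)
  also have "\<dots> = (\<Sum>l\<in>UNIV. frame j p $ l * lie i (partial_deriv l f) p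
      + lie i (\<lambda>x. frame j x $ l) p * partial_deriv l f p)"
    unfolding lie_def[of i "partial_deriv _ f"] lie_def[of i "\<lambda>x. frame j x $ _"]
    using f(2)[OF U(2)] smooth_on_has_derivative[OF smooth_frame_nth]
    by (intro lie_eqI has_derivative_sum has_derivative_mult) (auto simp: frechet_derivative_works[symmetric])
  also have "\<dots> = (\<Sum>l\<in>UNIV. \<Sum>k\<in>UNIV. frame i p $ k * (frame j p $ l * partial_deriv k (partial_deriv l f) p))
      + (\<Sum>l\<in>UNIV. lie i (\<lambda>x. frame j x $ l) p * partial_deriv l f p)"
    using f(2)[OF U(2)] by (simp add: sum.distrib lie_partial sum_distrib_left algebra_simps)
  finally show ?thesis .
qed

lemma lie_coord_1: "lie i (\<lambda>x. x$1) x = frame i x $ 1"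
  by (rule lie_eqI) (rule has_derivative_coord)

lemma lie_coord_1_sq: "lie i (\<lambda>x. (x$1)^2 / 2) x = x$1 * frame i x $ 1"
proof -
  have "((\<lambda>x::real^4. (x$1)^2 / 2) has_derivative (\<lambda>v. x$1 * v$1)) (at x)"
    by (auto intro!: derivative_eq_intros has_derivative_coord)
  then show ?thesis by (rule lie_eqI)
qed

lemma lie_bracket:
  fixes f :: "real^4 \<Rightarrow> real"
  assumes U: "open U" "p \<in> U" and sm: "smooth_on U f"
  shows "lie 1 (lie 2 f) p = lie 2 (lie 1 f) p + lie 3 f p"
    "lie 1 (lie 3 f) p = lie 3 (lie 1 f) p + lie 4 f p"
    "lie 1 (lie 4 f) p = lie 4 (lie 1 f) p"
    "lie 2 (lie 3 f) p = lie 3 (lie 2 f) p"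
    "lie 2 (lie 4 f) p = lie 4 (lie 2 f) p"
    "lie 3 (lie 4 f) p = lie 4 (lie 3 f) p"
proof -
  have f: "f differentiable (at p)" using sm U smooth_on_iff by blast
  note c = partial_deriv_commute_real[OF U sm]
  note simps = lie_lie[OF U sm] sum_4 frame_nth lie_const lie_coord_1 lie_coord_1_sq
    lie_partial_simps[OF f] c[of 2 1] c[of 3 1] c[of 4 1] c[of 3 2] c[of 4 2] c[of 4 3]
  show "lie 1 (lie 2 f) p = lie 2 (lie 1 f) p + lie 3 f p" by (simp add: simps)
  show "lie 1 (lie 3 f) p = lie 3 (lie 1 f) p + lie 4 f p" by (simp add: simps)
  show "lie 1 (lie 4 f) p = lie 4 (lie 1 f) p" by (simp add: simps)
  show "lie 2 (lie 3 f) p = lie 3 (lie 2 f) p" by (simp add: simps)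
  show "lie 2 (lie 4 f) p = lie 4 (lie 2 f) p" by (simp add: simps)
  show "lie 3 (lie 4 f) p = lie 4 (lie 3 f) p" by (simp add: simps)
qed

section \<open>Integration over the nilmanifold\<close>

text \<open>The integral over \<open>\<Gamma>\<setminus>G\<close> is an iterated integral over the fundamental domain \<open>[0,2]\<^sup>4\<close>. Integrating
  out one coordinate at a time keeps all functions on the same space, and only differentiation under
  the integral sign is needed, no change of the order of integration.\<close>

definition setc :: "4 \<Rightarrow> real \<Rightarrow> real^4 \<Rightarrow> real^4" where
  "setc j s u = (\<chi> i. if i = j then s else u$i)"

lemma setc_nth: "setc j s u $ i = (if i = j then s else u$i)"
  by (simp add: setc_def)

lemma setc_commute: "j \<noteq> k \<Longrightarrow> setc j s (setc k t u) = setc k t (setc j s u)"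
  by (simp add: vec_eq_iff setc_nth)

lemma continuous_setc [continuous_intros]:
  assumes "continuous_on S s" "continuous_on S u"
  shows "continuous_on S (\<lambda>x. setc j (s x) (u x))"
  unfolding setc_def
proof (rule continuous_on_vec_lambda)
  show "continuous_on S (\<lambda>x. if i = j then s x else u x $ i)" for i
    using assms by (cases "i = j") (auto intro: continuous_intros)
qed

text \<open>The value is independent of the coordinate \<open>j\<close> of \<open>u\<close>; it remains a function of \<open>u\<close> so that
  the operation can be iterated.\<close>

definition avg :: "4 \<Rightarrow> (real^4 \<Rightarrow> real) \<Rightarrow> real^4 \<Rightarrow> real" where
  "avg j f u = integral (cbox 0 2) (\<lambda>s. f (setc j s u))"

definition nil_int :: "(real^4 \<Rightarrow> real) \<Rightarrow> real" where
  "nil_int f = avg 1 (avg 2 (avg 3 (avg 4 f))) 0"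

lemma continuous_comp_setc:
  "continuous_on UNIV f \<Longrightarrow> continuous_on S (\<lambda>s. f (setc j s u))"
  by (rule continuous_on_compose2[of UNIV f]) (auto intro!: continuous_intros)

lemma integrable_comp_setc:
  "continuous_on UNIV f \<Longrightarrow> (\<lambda>s. f (setc j s u)) integrable_on cbox 0 2" for f :: "real^4 \<Rightarrow> real"
  by (rule integrable_continuous) (rule continuous_comp_setc)

lemma continuous_avg: "continuous_on UNIV f \<Longrightarrow> continuous_on UNIV (avg j f)"
  unfolding avg_def
  by (rule integral_continuous_on_param)
    (auto intro!: continuous_on_compose2[of UNIV f] continuous_intros simp: split_beta)

lemma avg_add:
  "continuous_on UNIV f \<Longrightarrow> continuous_on UNIV g \<Longrightarrow> avg j (\<lambda>u. f u + g u) = (\<lambda>u. avg j f u + avg j g u)"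
  unfolding avg_def by (rule ext) (rule integral_add; rule integrable_comp_setc)

lemma avg_nonneg: "continuous_on UNIV f \<Longrightarrow> (\<And>u. 0 \<le> f u) \<Longrightarrow> 0 \<le> avg j f u"
  unfolding avg_def by (intro integral_nonneg integrable_comp_setc)

lemma avg_eq_0:
  assumes "continuous_on UNIV f" "\<And>u. 0 \<le> f u" "avg j f u = 0" "0 \<le> s" "s \<le> 2"
  shows "f (setc j s u) = 0"
proof (rule has_integral_0_cbox_imp_0[where f = "\<lambda>s. f (setc j s u)" and a = 0 and b = 2])
  show "continuous_on (cbox 0 2) (\<lambda>s. f (setc j s u))" by (rule continuous_comp_setc) fact
  show "((\<lambda>s. f (setc j s u)) has_integral 0) (cbox 0 2)"
    using assms integrable_integral[OF integrable_comp_setc] unfolding avg_def by metis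
qed (use assms in auto)

lemma nil_int_add:
  "continuous_on UNIV f \<Longrightarrow> continuous_on UNIV g \<Longrightarrow> nil_int (\<lambda>u. f u + g u) = nil_int f + nil_int g"
  unfolding nil_int_def by (simp add: avg_add continuous_avg)

lemma nil_int_nonneg_eq_0:
  assumes c: "continuous_on UNIV f" and nn: "\<And>u. 0 \<le> f u" and z: "nil_int f = 0"
    and u: "\<And>i. 0 \<le> u$i \<and> u$i \<le> 2"
  shows "f u = 0"
proof -
  note c4 = continuous_avg[OF c, of 4] and n4 = avg_nonneg[OF c nn, of 4]
  note c3 = continuous_avg[OF c4, of 3] and n3 = avg_nonneg[OF c4 n4, of 3]
  note c2 = continuous_avg[OF c3, of 2] and n2 = avg_nonneg[OF c3 n3, of 2]
  let ?u1 = "setc 1 (u$1) 0" let ?u2 = "setc 2 (u$2) ?u1" let ?u3 = "setc 3 (u$3) ?u2"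
  have "avg 2 (avg 3 (avg 4 f)) ?u1 = 0"
    using z u unfolding nil_int_def by (intro avg_eq_0[OF c2 n2]) auto
  then have "avg 3 (avg 4 f) ?u2 = 0" using u by (intro avg_eq_0[OF c3 n3]) auto
  then have "avg 4 f ?u3 = 0" using u by (intro avg_eq_0[OF c4 n4]) auto
  then have "f (setc 4 (u$4) ?u3) = 0" using u by (intro avg_eq_0[OF c nn]) auto
  moreover have "setc 4 (u$4) ?u3 = u" by (simp add: vec_eq_iff forall_4 setc_nth)
  ultimately show ?thesis by simp
qed

definition has_partial :: "4 \<Rightarrow> (real^4 \<Rightarrow> real) \<Rightarrow> (real^4 \<Rightarrow> real) \<Rightarrow> bool" where
  "has_partial k f g \<longleftrightarrow> continuous_on UNIV f \<and> continuous_on UNIV g \<and>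
     (\<forall>u s. ((\<lambda>s. f (setc k s u)) has_real_derivative g (setc k s u)) (at s))"

lemma has_partial_avg:
  assumes "has_partial k f g" "j \<noteq> k"
  shows "has_partial k (avg j f) (avg j g)"
proof -
  have c: "continuous_on UNIV f" "continuous_on UNIV g"
    and d: "\<And>u s. ((\<lambda>s. f (setc k s u)) has_real_derivative g (setc k s u)) (at s)"
    using assms by (auto simp: has_partial_def)
  have "((\<lambda>s. integral (cbox 0 2) (\<lambda>t. f (setc j t (setc k s u)))) has_real_derivative
      integral (cbox 0 2) (\<lambda>t. g (setc j t (setc k s u)))) (at s)" for u s
  proof (rule leibniz_rule_field_derivative[where U = UNIV, simplified])
    show "((\<lambda>x. f (setc j t (setc k x u))) has_real_derivative g (setc j t (setc k x u))) (at x)" for x t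
      using d[of "setc j t u"] assms(2) by (simp only: setc_commute[of j k] not_False_eq_True)
    show "(\<lambda>t. f (setc j t (setc k x u))) integrable_on cbox 0 2" for x
      by (rule integrable_comp_setc[OF c(1)])
    show "continuous_on (UNIV \<times> cbox 0 2) (\<lambda>(x, t). g (setc j t (setc k x u)))"
      unfolding split_beta
      by (rule continuous_on_compose2[OF c(2)]) (auto intro!: continuous_intros)
  qed
  then show ?thesis using c unfolding has_partial_def
    by (intro conjI continuous_avg allI) (simp_all add: avg_def)
qed

lemma avg_has_partial_eq_0:
  assumes "has_partial k f g" "\<And>u. f (setc k 2 u) = f (setc k 0 u)"
  shows "avg k g u = 0"
proof -
  have "((\<lambda>s. g (setc k s u)) has_integral (f (setc k 2 u) - f (setc k 0 u))) {0..2}"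
    using assms(1) unfolding has_partial_def
    by (intro fundamental_theorem_of_calculus)
      (auto intro: has_vector_derivative_at_within simp: has_real_derivative_iff_has_vector_derivative)
  then show ?thesis using assms(2) by (simp add: avg_def integral_unique)
qed

lemma avg_0: "avg j (\<lambda>u. 0) = (\<lambda>u. 0)"
  by (simp add: avg_def fun_eq_iff)

lemma avg_periodic:
  "j \<noteq> k \<Longrightarrow> (\<And>u. f (setc k 2 u) = f (setc k 0 u)) \<Longrightarrow> avg j f (setc k 2 u) = avg j f (setc k 0 u)"
  unfolding avg_def by (simp only: setc_commute[of j k] not_False_eq_True)

lemma nil_int_partial:
  assumes "has_partial k f g" and k: "k = 2 \<or> k = 3 \<or> k = 4"
    and per: "\<And>u. f (setc k 2 u) = f (setc k 0 u)"
  shows "nil_int g = 0"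
proof -
  consider "k = 4" | "k = 3" | "k = 2" using k by blast
  then show ?thesis
  proof cases
    case 1
    then have "avg 4 g = (\<lambda>u. 0)" using avg_has_partial_eq_0[OF assms(1) per] by auto
    then show ?thesis by (simp add: nil_int_def avg_0)
  next
    case 2
    then have "avg 3 (avg 4 g) = (\<lambda>u. 0)"
      using avg_has_partial_eq_0[OF has_partial_avg[OF assms(1)] avg_periodic[OF _ per], of 4] by auto
    then show ?thesis by (simp add: nil_int_def avg_0)
  next
    case 3
    then have "has_partial 2 (avg 3 (avg 4 f)) (avg 3 (avg 4 g))"
      using assms(1) by (auto intro!: has_partial_avg)
    moreover have "avg 3 (avg 4 f) (setc 2 2 u) = avg 3 (avg 4 f) (setc 2 0 u)" for u
      using per 3 by (intro avg_periodic) auto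
    ultimately have "avg 2 (avg 3 (avg 4 g)) = (\<lambda>u. 0)"
      using avg_has_partial_eq_0 by blast
    then show ?thesis by (simp add: nil_int_def avg_0)
  qed
qed

text \<open>The left side is constant in \<open>c\<close>: its derivative is the integral of the derivative of \<open>f\<close> over a
  period.\<close>

lemma avg_shift:
  assumes "has_partial k f g" "\<And>s u. f (setc k (s + 2) u) = f (setc k s u)"
  shows "integral (cbox 0 2) (\<lambda>s. f (setc k (s + c) u)) = avg k f u"
proof -
  have c: "continuous_on UNIV f" "continuous_on UNIV g"
    and d: "\<And>u s. ((\<lambda>s. f (setc k s u)) has_real_derivative g (setc k s u)) (at s)"
    using assms by (auto simp: has_partial_def)
  let ?S = "\<lambda>c. integral (cbox 0 2) (\<lambda>s. f (setc k (s + c) u))"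
  have ds: "((\<lambda>c. f (setc k (s + c) u)) has_real_derivative g (setc k (s + c) u)) (at c)" for s c
    using d[of u "s + c"] DERIV_shift[of "\<lambda>s. f (setc k s u)" _ c s] by (simp add: add.commute)
  have "(?S has_real_derivative integral (cbox 0 2) (\<lambda>s. g (setc k (s + c) u))) (at c)" for c
  proof (rule leibniz_rule_field_derivative[where U = UNIV, simplified])
    show "((\<lambda>x. f (setc k (t + x) u)) has_real_derivative g (setc k (t + x) u)) (at x)" for x t
      by (rule ds)
    have "continuous_on (cbox 0 2) (\<lambda>t. f (setc k (t + x) u))" for x
      by (rule continuous_on_compose2[OF c(1)]) (auto intro!: continuous_intros)
    then show "(\<lambda>t. f (setc k (t + x) u)) integrable_on cbox 0 2" for x
      by (rule integrable_continuous)
    show "continuous_on (UNIV \<times> cbox 0 2) (\<lambda>(x, t). g (setc k (t + x) u))"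
      unfolding split_beta
      by (rule continuous_on_compose2[OF c(2)]) (auto intro!: continuous_intros)
  qed
  moreover have "integral (cbox 0 2) (\<lambda>s. g (setc k (s + c) u)) = 0" for c
  proof -
    have "((\<lambda>s. g (setc k (s + c) u)) has_integral (f (setc k (2 + c) u) - f (setc k (0 + c) u))) {0..2}"
      using ds[where s = c, unfolded add.commute[of c]]
      by (intro fundamental_theorem_of_calculus)
        (auto intro: has_vector_derivative_at_within simp: has_real_derivative_iff_has_vector_derivative)
    then show ?thesis using assms(2)[of c u] by (simp add: integral_unique add.commute)
  qed
  ultimately have "\<forall>c. (?S has_real_derivative 0) (at c)" by simp
  then have "?S c = ?S 0" by (rule DERIV_isconst_all)
  then show ?thesis by (simp add: avg_def)
qed

lemma has_partial_smooth:
  assumes "smooth_on UNIV f" shows "has_partial k f (partial_deriv k f)"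
proof -
  have "((\<lambda>s. f (setc k s u)) has_real_derivative partial_deriv k f (setc k s u)) (at s)" for u s
  proof -
    have e: "setc k 0 u + s *\<^sub>R axis k 1 = setc k s u" for s
      by (auto simp: vec_eq_iff setc_nth axis_def)
    show ?thesis
      using has_real_derivative_line[OF smooth_on_differentiable[OF assms], where p = "setc k 0 u" and s = s and i = k]
      by (simp only: e)
  qed
  then show ?thesis
    using assms by (simp add: has_partial_def smooth_on_continuous smooth_partial_deriv)
qed

lemma nil_smooth_translate:
  assumes "nil_smooth f"
  shows "f (vector [2 * of_int a + x, 2 * of_int b + y, z + 2 * of_int a * y + 2 * of_int c,
      t + 2 * of_int a^2 * y + 2 * of_int a * z + 2 * of_int d]) = f (vector [x, y, z, t])"
proof -
  let ?g = "vector [2 * of_int a, 2 * of_int b, 2 * of_int c, 2 * of_int d] :: real^4"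
  have "?g \<in> nil_lattice" unfolding nil_lattice_coords by blast
  then have "f (nil_mult ?g (vector [x, y, z, t])) = f (vector [x, y, z, t])"
    using assms by (auto simp: nil_smooth_def)
  then show ?thesis
    by (simp add: nil_mult_def vector_4 algebra_simps power2_eq_square)
qed

lemma vector_setc:
  "setc 1 s u = vector [s, u$2, u$3, u$4]" "setc 2 s u = vector [u$1, s, u$3, u$4]"
  "setc 3 s u = vector [u$1, u$2, s, u$4]" "setc 4 s u = vector [u$1, u$2, u$3, s]"
  by (simp_all add: vec_eq_iff forall_4 setc_nth vector_4)

lemma nil_smooth_periodic:
  assumes "nil_smooth f"
  shows "k = 2 \<or> k = 3 \<or> k = 4 \<Longrightarrow> f (setc k (s + 2) u) = f (setc k s u)"
    and "f (vector [2, y, z + 2 * y, t + 2 * y + 2 * z]) = f (vector [0, y, z, t])"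
  using nil_smooth_translate[OF assms, of 0 _ 1 _ _ 0 _ 0] nil_smooth_translate[OF assms, of 0 _ 0 _ _ 1 _ 0]
    nil_smooth_translate[OF assms, of 0 _ 0 _ _ 0 _ 1] nil_smooth_translate[OF assms, of 1 0 0 y z 0 t 0]
  by (auto simp: vector_setc add.commute)

text \<open>The faces \<open>x = 0\<close> and \<open>x = 2\<close> of the fundamental domain are identified by the shear
  \<open>(y,z,t) \<mapsto> (y, z + 2y, t + 2y + 2z)\<close>. It preserves the integral over the other coordinates, since for
  fixed \<open>y, z\<close> it translates the periodic variable \<open>t\<close>, and for fixed \<open>y\<close> the periodic variable \<open>z\<close>.\<close>

lemma nil_int_partial_1:
  assumes f: "nil_smooth f"
  shows "nil_int (partial_deriv 1 f) = 0"
proof -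
  have hp: "has_partial k f (partial_deriv k f)" for k
    using f has_partial_smooth by (auto simp: nil_smooth_def)
  let ?K = "avg 4 f"
  have K: "?K (vector [2, y, z + 2 * y, t]) = ?K (vector [0, y, z, t])" for y z t
  proof -
    have "?K (vector [2, y, z + 2 * y, t])
        = integral (cbox 0 2) (\<lambda>s. f (setc 4 (s + (2 * y + 2 * z)) (vector [2, y, z + 2 * y, t])))"
      by (rule avg_shift[OF hp, symmetric]) (simp add: nil_smooth_periodic[OF f])
    also have "\<dots> = ?K (vector [0, y, z, t])"
      using nil_smooth_periodic(2)[OF f] unfolding avg_def
      by (simp add: vector_setc vector_4 add.assoc)
    finally show ?thesis .
  qed
  have hpK: "has_partial k ?K (avg 4 (partial_deriv k f))" if "k \<noteq> 4" for k
    using that by (intro has_partial_avg[OF hp]) auto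
  have Kper: "?K (setc 3 (s + 2) u) = ?K (setc 3 s u)" for s u
    unfolding avg_def by (simp add: setc_commute[of 4 3] nil_smooth_periodic[OF f])
  have L: "avg 3 ?K (setc 1 2 u) = avg 3 ?K (setc 1 0 u)" for u
  proof -
    have "avg 3 ?K (setc 1 2 u) = integral (cbox 0 2) (\<lambda>s. ?K (setc 3 (s + 2 * u$2) (setc 1 2 u)))"
      by (rule avg_shift[OF hpK, symmetric]) (simp_all add: Kper)
    also have "\<dots> = avg 3 ?K (setc 1 0 u)"
      using K unfolding avg_def[of 3] by (simp add: vector_setc vector_4)
    finally show ?thesis .
  qed
  have "avg 2 (avg 3 ?K) (setc 1 2 u) = avg 2 (avg 3 ?K) (setc 1 0 u)" for u
    by (rule avg_periodic) (auto simp: L)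
  then have M: "avg 2 (avg 3 ?K) (setc 1 2 u) = avg 2 (avg 3 ?K) (setc 1 0 u)" for u .
  have "has_partial 1 (avg 2 (avg 3 ?K)) (avg 2 (avg 3 (avg 4 (partial_deriv 1 f))))"
    by (intro has_partial_avg hp) auto
  then show ?thesis
    unfolding nil_int_def by (rule avg_has_partial_eq_0) (rule M)
qed

lemma has_partial_mult_indep:
  assumes "has_partial k f g" "continuous_on UNIV h" "\<And>s u. h (setc k s u) = h u"
  shows "has_partial k (\<lambda>x. h x * f x) (\<lambda>x. h x * g x)"
  using assms unfolding has_partial_def by (auto intro!: continuous_on_mult DERIV_cmult)

text \<open>The fields of the frame are divergence free. The coefficients of \<open>X\<^sub>2, X\<^sub>3, X\<^sub>4\<close> depend on \<open>x\<close>
  alone and these fields do not differentiate in \<open>x\<close>, so periodicity in \<open>y, z, t\<close> suffices; \<open>X\<^sub>1 = \<partial>\<^sub>x\<close>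
  is the twisted case above.\<close>

lemma nil_int_lie:
  assumes f: "nil_smooth f"
  shows "nil_int (lie i f) = 0"
proof -
  have sm: "smooth_on UNIV f" using f by (simp add: nil_smooth_def)
  have c: "continuous_on UNIV (partial_deriv k f)" for k
    using sm by (intro smooth_on_continuous smooth_partial_deriv)
  have z: "nil_int (\<lambda>x. h x * partial_deriv k f x) = 0"
    if "k = 2 \<or> k = 3 \<or> k = 4" "continuous_on UNIV h" "\<And>s u. h (setc k s u) = h u" for h k
  proof (rule nil_int_partial[OF has_partial_mult_indep[OF has_partial_smooth[OF sm]] that(1)])
    show "h (setc k 2 u) * f (setc k 2 u) = h (setc k 0 u) * f (setc k 0 u)" for u
      using nil_smooth_periodic(1)[OF f that(1), of 0 u] that(3) by simp
  qed (use that in auto)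
  have z1: "nil_int (partial_deriv k f) = 0" if "k = 2 \<or> k = 3 \<or> k = 4" for k
    using z[OF that, of "\<lambda>x. 1"] by simp
  have zx: "nil_int (\<lambda>x. x$1 * partial_deriv k f x) = 0" if "k = 3 \<or> k = 4" for k
    using that by (intro z) (auto intro!: continuous_intros simp: setc_nth)
  have zxx: "nil_int (\<lambda>x. (x$1)^2 / 2 * partial_deriv 4 f x) = 0"
    by (intro z) (auto intro!: continuous_intros simp: setc_nth)
  note l = lie_partial_simps[OF smooth_on_differentiable[OF sm]]
  have "lie 1 f = partial_deriv 1 f" "lie 4 f = partial_deriv 4 f"
    "lie 3 f = (\<lambda>x. partial_deriv 3 f x + x$1 * partial_deriv 4 f x)"
    "lie 2 f = (\<lambda>x. (partial_deriv 2 f x + x$1 * partial_deriv 3 f x) + (x$1)^2 / 2 * partial_deriv 4 f x)"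
    using l by auto
  note l = this
  have cx: "continuous_on UNIV (\<lambda>x::real^4. x$1 * partial_deriv k f x)" for k
    by (intro continuous_intros c)
  have cxx: "continuous_on UNIV (\<lambda>x::real^4. (x$1)^2 / 2 * partial_deriv 4 f x)"
    by (intro continuous_intros c) simp
  have "nil_int (lie 3 f) = 0" unfolding l
    by (subst nil_int_add[OF c cx]) (simp add: z1 zx)
  moreover have "nil_int (lie 2 f) = 0" unfolding l
    by (subst nil_int_add[OF continuous_on_add[OF c cx] cxx], subst nil_int_add[OF c cx])
      (simp only: zxx, simp add: z1 zx)
  ultimately show ?thesis
    using exhaust_4[of i] nil_int_partial_1[OF f] z1[of 4] l(1,2) by auto
qed

lemma nil_lattice_reduce:
  obtains g where "g \<in> nil_lattice" "\<And>i. 0 \<le> nil_mult g u $ i \<and> nil_mult g u $ i \<le> 2"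
proof -
  have red: "\<exists>m::int. 0 \<le> r + 2 * of_int m \<and> r + 2 * of_int m \<le> 2" for r :: real
    by (intro exI[of _ "- \<lfloor>r / 2\<rfloor>"]) (simp, linarith)
  obtain a b :: int where ab: "0 \<le> u$1 + 2 * of_int a" "u$1 + 2 * of_int a \<le> 2"
      "0 \<le> u$2 + 2 * of_int b" "u$2 + 2 * of_int b \<le> 2"
    using red by meson
  obtain c :: int where c: "0 \<le> (u$3 + 2 * of_int a * u$2) + 2 * of_int c"
      "(u$3 + 2 * of_int a * u$2) + 2 * of_int c \<le> 2"
    using red by meson
  obtain d :: int where d:
      "0 \<le> (u$4 + (1/2) * (2 * of_int a)^2 * u$2 + 2 * of_int a * u$3) + 2 * of_int d"
      "(u$4 + (1/2) * (2 * of_int a)^2 * u$2 + 2 * of_int a * u$3) + 2 * of_int d \<le> 2"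
    using red by meson
  define g :: "real^4" where
    "g = vector [2 * of_int a, 2 * of_int b, 2 * of_int c, 2 * of_int d]"
  have "g \<in> nil_lattice" unfolding g_def nil_lattice_coords by blast
  moreover have "\<forall>i. 0 \<le> nil_mult g u $ i \<and> nil_mult g u $ i \<le> 2"
    unfolding forall_4 nil_mult_nth g_def vector_4 using ab c d by simp
  ultimately show ?thesis using that by blast
qed

text \<open>Every energy identity below is used in this form: integration by parts becomes the search for
  the potentials \<open>P\<^sub>1, \<dots>, P\<^sub>4\<close> of a sum of squares.\<close>

lemma nonneg_divergence_eq_0:
  fixes Q :: "real^4 \<Rightarrow> real"
  assumes nil: "nil_smooth P1" "nil_smooth P2" "nil_smooth P3" "nil_smooth P4"
    and Q: "\<And>x. Q x = lie 1 P1 x + lie 2 P2 x + lie 3 P3 x + lie 4 P4 x" and nn: "\<And>x. 0 \<le> Q x"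
  shows "Q x = 0"
proof -
  have Qeq: "Q = (\<lambda>x. ((lie 1 P1 x + lie 2 P2 x) + lie 3 P3 x) + lie 4 P4 x)"
    using Q by auto
  have nQ: "nil_smooth Q" unfolding Qeq using nil by (intro nil_intros)
  have c: "continuous_on UNIV (lie i P)" if "nil_smooth P" for i and P :: "real^4 \<Rightarrow> real"
    using nil_smooth_lie[OF that] by (simp add: nil_smooth_def smooth_on_continuous)
  have "nil_int Q = 0"
    unfolding Qeq using nil by (simp add: nil_int_add nil_int_lie c continuous_on_add)
  obtain g where g: "g \<in> nil_lattice" "\<And>i. 0 \<le> nil_mult g x $ i \<and> nil_mult g x $ i \<le> 2"
    by (rule nil_lattice_reduce[of x]) metis
  have "continuous_on UNIV Q" using nQ unfolding nil_smooth_def by (blast intro: smooth_on_continuous)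
  from nil_int_nonneg_eq_0[OF this nn \<open>nil_int Q = 0\<close> g(2)]
  have "Q (nil_mult g x) = 0" .
  then show ?thesis using nQ g(1) unfolding nil_smooth_def by simp
qed

text \<open>The frame spans the tangent space: the four equations are triangular in the partial derivatives.\<close>

lemma lie_zero_imp_const:
  fixes f :: "real^4 \<Rightarrow> 'b::real_normed_vector"
  assumes f: "smooth_on UNIV f" and z: "\<And>i x. lie i f x = 0"
  shows "\<exists>c. \<forall>x. f x = c"
proof -
  note d = smooth_on_differentiable[OF f]
  have "partial_deriv j f x = 0" for j x
  proof -
    note l = lie_partial_simps[OF d, of x, unfolded z, symmetric]
    have 4: "partial_deriv 4 f x = 0" using l(4) .
    then have 3: "partial_deriv 3 f x = 0" using l(3) by simp
    then have 2: "partial_deriv 2 f x = 0" using l(2) 4 by simp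
    show ?thesis using exhaust_4[of j] 2 3 4 l(1) by auto
  qed
  then have "frechet_derivative f (at x) v = 0" for x v
    by (simp add: frechet_derivative_partial[OF d])
  then have "frechet_derivative f (at x) = (\<lambda>v. 0)" for x by (intro ext)
  then have "(f has_derivative (\<lambda>v. 0)) (at x)" for x
    using smooth_on_has_derivative[OF f, of x] by metis
  then have "\<exists>c. \<forall>x\<in>UNIV. f x = c"
    by (intro has_derivative_zero_constant) (auto intro: has_derivative_at_withinI)
  then show ?thesis by simp
qed

section \<open>The kernel of the Dirac type system\<close>

text \<open>The components of \<open>R = d\<gamma> - d\<^sup>c(f\<omega>)\<close>, where
  \<open>\<gamma> = a(e\<^sup>1\<^sup>2 - e\<^sup>3\<^sup>4) + b(e\<^sup>1\<^sup>3 + e\<^sup>2\<^sup>4) + c(e\<^sup>1\<^sup>4 - e\<^sup>2\<^sup>3)\<close>, along \<open>e\<^sup>i \<and> \<omega>\<close>, that is along \<open>e\<^sup>1\<^sup>3\<^sup>4\<close>,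
  \<open>e\<^sup>2\<^sup>3\<^sup>4\<close>, \<open>e\<^sup>1\<^sup>2\<^sup>3\<close>, \<open>e\<^sup>1\<^sup>2\<^sup>4\<close>. The terms of order 0 come from \<open>de\<^sup>3\<close> and \<open>de\<^sup>4\<close>. Up to these terms it
  is the Dirac operator in four variables.\<close>

definition dirac1 :: "(real^4 \<Rightarrow> 'b::real_normed_vector) \<Rightarrow> (real^4 \<Rightarrow> 'b) \<Rightarrow> (real^4 \<Rightarrow> 'b) \<Rightarrow> (real^4 \<Rightarrow> 'b) \<Rightarrow> real^4 \<Rightarrow> 'b" where
  "dirac1 f a b c x = lie 2 f x - lie 1 a x + lie 4 b x - lie 3 c x"

definition dirac2 :: "(real^4 \<Rightarrow> 'b::real_normed_vector) \<Rightarrow> (real^4 \<Rightarrow> 'b) \<Rightarrow> (real^4 \<Rightarrow> 'b) \<Rightarrow> (real^4 \<Rightarrow> 'b) \<Rightarrow> real^4 \<Rightarrow> 'b" where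
  "dirac2 f a b c x = - lie 1 f x - lie 2 a x - lie 3 b x - lie 4 c x"

definition dirac3 :: "(real^4 \<Rightarrow> 'b::real_normed_vector) \<Rightarrow> (real^4 \<Rightarrow> 'b) \<Rightarrow> (real^4 \<Rightarrow> 'b) \<Rightarrow> (real^4 \<Rightarrow> 'b) \<Rightarrow> real^4 \<Rightarrow> 'b" where
  "dirac3 f a b c x = lie 4 f x - f x + lie 3 a x - lie 2 b x - b x - lie 1 c x"

definition dirac4 :: "(real^4 \<Rightarrow> 'b::real_normed_vector) \<Rightarrow> (real^4 \<Rightarrow> 'b) \<Rightarrow> (real^4 \<Rightarrow> 'b) \<Rightarrow> (real^4 \<Rightarrow> 'b) \<Rightarrow> real^4 \<Rightarrow> 'b" where
  "dirac4 f a b c x = - lie 3 f x + lie 4 a x + a x + lie 1 b x - lie 2 c x"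

lemmas dirac_defs = dirac1_def dirac2_def dirac3_def dirac4_def

lemma nil_smooth_dirac [nil_intros]:
  assumes "nil_smooth f" "nil_smooth a" "nil_smooth b" "nil_smooth c"
  shows "nil_smooth (dirac1 f a b c)" "nil_smooth (dirac2 f a b c)"
    "nil_smooth (dirac3 f a b c)" "nil_smooth (dirac4 f a b c)"
proof -
  have "nil_smooth (\<lambda>x. lie 2 f x - lie 1 a x + lie 4 b x - lie 3 c x)"
    "nil_smooth (\<lambda>x. - lie 1 f x - lie 2 a x - lie 3 b x - lie 4 c x)"
    "nil_smooth (\<lambda>x. lie 4 f x - f x + lie 3 a x - lie 2 b x - b x - lie 1 c x)"
    "nil_smooth (\<lambda>x. - lie 3 f x + lie 4 a x + a x + lie 1 b x - lie 2 c x)"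
    by (intro nil_intros assms)+
  then show "nil_smooth (dirac1 f a b c)" "nil_smooth (dirac2 f a b c)"
    "nil_smooth (dirac3 f a b c)" "nil_smooth (dirac4 f a b c)"
    by (simp_all add: dirac_defs[abs_def])
qed

lemmas lie_rules = lie_add lie_diff lie_minus lie_mult lie_divide

text \<open>The brackets in the hypotheses are the components of the formal adjoint of the operator, applied to its
  own value \<open>T\<close>. Pairing them with \<open>(f,a,b,c)\<close> and integrating by parts gives \<open>\<integral> |T|\<^sup>2 = 0\<close>. Only these
  products enter, which allows \<open>f = 0\<close> in place of the first equation.\<close>

lemma dirac_adjoint_kernel:
  fixes f a b c T1 T2 T3 T4 :: "real^4 \<Rightarrow> real"
  assumes n: "nil_smooth f" "nil_smooth a" "nil_smooth b" "nil_smooth c"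
    and T: "T1 = dirac1 f a b c" "T2 = dirac2 f a b c" "T3 = dirac3 f a b c" "T4 = dirac4 f a b c"
    and adj: "\<And>x. f x * (lie 1 T2 x - lie 2 T1 x - T3 x + lie 3 T4 x - lie 4 T3 x) = 0"
      "\<And>x. a x * (lie 1 T1 x + lie 2 T2 x - lie 3 T3 x - lie 4 T4 x + T4 x) = 0"
      "\<And>x. b x * (- lie 1 T4 x + lie 2 T3 x - T3 x + lie 3 T2 x - lie 4 T1 x) = 0"
      "\<And>x. c x * (lie 1 T3 x + lie 2 T4 x + lie 3 T1 x + lie 4 T2 x) = 0"
  shows "T1 x = 0 \<and> T2 x = 0 \<and> T3 x = 0 \<and> T4 x = 0"
proof -
  have nT: "nil_smooth T1" "nil_smooth T2" "nil_smooth T3" "nil_smooth T4"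
    unfolding T by (intro nil_intros n)+
  have "T1 x * T1 x + T2 x * T2 x + T3 x * T3 x + T4 x * T4 x = 0"
  proof (rule nonneg_divergence_eq_0[where
        ?P1.0 = "\<lambda>x. T4 x * b x - T3 x * c x - T1 x * a x - T2 x * f x" and
        ?P2.0 = "\<lambda>x. T1 x * f x - T3 x * b x - T4 x * c x - T2 x * a x" and
        ?P3.0 = "\<lambda>x. T3 x * a x - T4 x * f x - T1 x * c x - T2 x * b x" and
        ?P4.0 = "\<lambda>x. T3 x * f x + T4 x * a x + T1 x * b x - T2 x * c x"])
    fix x
    have "T1 x * T1 x = T1 x * (lie 2 f x - lie 1 a x + lie 4 b x - lie 3 c x)"
      "T2 x * T2 x = T2 x * (- lie 1 f x - lie 2 a x - lie 3 b x - lie 4 c x)"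
      "T3 x * T3 x = T3 x * (lie 4 f x - f x + lie 3 a x - lie 2 b x - b x - lie 1 c x)"
      "T4 x * T4 x = T4 x * (- lie 3 f x + lie 4 a x + a x + lie 1 b x - lie 2 c x)"
      unfolding T dirac_defs by simp_all
    then show "T1 x * T1 x + T2 x * T2 x + T3 x * T3 x + T4 x * T4 x
      = lie 1 (\<lambda>x. T4 x * b x - T3 x * c x - T1 x * a x - T2 x * f x) x
      + lie 2 (\<lambda>x. T1 x * f x - T3 x * b x - T4 x * c x - T2 x * a x) x
      + lie 3 (\<lambda>x. T3 x * a x - T4 x * f x - T1 x * c x - T2 x * b x) x
      + lie 4 (\<lambda>x. T3 x * f x + T4 x * a x + T1 x * b x - T2 x * c x) x"
      using adj[of x] n nT
      by (simp only: lie_rules nil_smooth_add nil_smooth_diff nil_smooth_mult) (simp add: algebra_simps)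
  qed ((intro nil_intros n nT)+, simp)
  then show ?thesis by (simp add: add_nonneg_eq_0_iff)
qed

lemma nil_bracket:
  fixes f :: "real^4 \<Rightarrow> real"
  assumes "nil_smooth f"
  shows "lie 1 (lie 2 f) x = lie 2 (lie 1 f) x + lie 3 f x"
    "lie 1 (lie 3 f) x = lie 3 (lie 1 f) x + lie 4 f x"
    "lie 1 (lie 4 f) x = lie 4 (lie 1 f) x"
    "lie 2 (lie 3 f) x = lie 3 (lie 2 f) x"
    "lie 2 (lie 4 f) x = lie 4 (lie 2 f) x"
    "lie 3 (lie 4 f) x = lie 4 (lie 3 f) x"
  using lie_bracket[of UNIV x f] assms by (simp_all add: nil_smooth_def)

text \<open>Since \<open>d\<gamma> = d\<^sup>c(f\<omega>)\<close>, the 4-form \<open>dd\<^sup>c(f\<omega>)\<close> vanishes. This is the equation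
  \<open>\<Sum> X\<^sub>i\<^sup>2 f = X\<^sub>4 f\<close>, in which no zeroth order term occurs because \<open>\<omega>\<close> is Gauduchon. Multiplied by \<open>f\<close> it
  gives \<open>\<integral> \<Sum> (X\<^sub>i f)\<^sup>2 = 0\<close>, since \<open>f X\<^sub>4 f\<close> is a derivative.\<close>

lemma dirac_kernel_function_const:
  fixes f a b c :: "real^4 \<Rightarrow> real"
  assumes n: "nil_smooth f" "nil_smooth a" "nil_smooth b" "nil_smooth c"
    and z: "\<And>x. dirac1 f a b c x = 0" "\<And>x. dirac2 f a b c x = 0"
      "\<And>x. dirac3 f a b c x = 0" "\<And>x. dirac4 f a b c x = 0"
  shows "lie i f x = 0"
proof -
  note ns = nil_smooth_add nil_smooth_diff nil_smooth_minus nil_smooth_mult nil_smooth_lie n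
  have laplace: "lie 1 (lie 1 f) x + lie 2 (lie 2 f) x + lie 3 (lie 3 f) x + lie 4 (lie 4 f) x = lie 4 f x" for x
  proof -
    have "lie i (\<lambda>x. dirac1 f a b c x) x = 0" "lie i (\<lambda>x. dirac2 f a b c x) x = 0"
      "lie i (\<lambda>x. dirac3 f a b c x) x = 0" "lie i (\<lambda>x. dirac4 f a b c x) x = 0" for i
      using z by (simp_all add: lie_const)
    \<comment> \<open>The combination \<open>X\<^sub>1R\<^sub>2\<^sub>3\<^sub>4 - X\<^sub>2R\<^sub>1\<^sub>3\<^sub>4 + X\<^sub>3R\<^sub>1\<^sub>2\<^sub>4 - X\<^sub>4R\<^sub>1\<^sub>2\<^sub>3\<close>, the only component of \<open>dR\<close>.\<close>
    from this(2)[of 1] this(1)[of 2] this(4)[of 3] this(3)[of 4]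
    have "- lie 1 (lie 1 f) x - lie 1 (lie 2 a) x - lie 1 (lie 3 b) x - lie 1 (lie 4 c) x = 0"
      "lie 2 (lie 2 f) x - lie 2 (lie 1 a) x + lie 2 (lie 4 b) x - lie 2 (lie 3 c) x = 0"
      "- lie 3 (lie 3 f) x + lie 3 (lie 4 a) x + lie 3 a x + lie 3 (lie 1 b) x - lie 3 (lie 2 c) x = 0"
      "lie 4 (lie 4 f) x - lie 4 f x + lie 4 (lie 3 a) x - lie 4 (lie 2 b) x - lie 4 b x - lie 4 (lie 1 c) x = 0"
      unfolding dirac_defs by (simp_all only: lie_rules ns)
    then show ?thesis using nil_bracket[OF n(2)] nil_bracket[OF n(3)] nil_bracket[OF n(4)]
      by (simp add: algebra_simps)
  qed
  have "lie 1 f x * lie 1 f x + lie 2 f x * lie 2 f x + lie 3 f x * lie 3 f x + lie 4 f x * lie 4 f x = 0" for x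
  proof (rule nonneg_divergence_eq_0[where
        ?P1.0 = "\<lambda>x. f x * lie 1 f x" and ?P2.0 = "\<lambda>x. f x * lie 2 f x" and
        ?P3.0 = "\<lambda>x. f x * lie 3 f x" and ?P4.0 = "\<lambda>x. f x * lie 4 f x - f x * f x / 2"])
    fix x
    have "f x * (lie 1 (lie 1 f) x + lie 2 (lie 2 f) x + lie 3 (lie 3 f) x + lie 4 (lie 4 f) x) = f x * lie 4 f x"
      unfolding laplace ..
    then show "lie 1 f x * lie 1 f x + lie 2 f x * lie 2 f x + lie 3 f x * lie 3 f x + lie 4 f x * lie 4 f x
      = lie 1 (\<lambda>x. f x * lie 1 f x) x + lie 2 (\<lambda>x. f x * lie 2 f x) x
      + lie 3 (\<lambda>x. f x * lie 3 f x) x + lie 4 (\<lambda>x. f x * lie 4 f x - f x * f x / 2) x"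
      by (simp only: lie_rules nil_smooth_divide ns) (simp add: algebra_simps)
  qed ((intro nil_intros n)+, simp)
  from this[of x] show ?thesis
    using exhaust_4[of i] by (auto simp: add_nonneg_eq_0_iff)
qed

text \<open>The central field \<open>X\<^sub>4\<close> generates isometries, so the Lie derivative \<open>\<gamma>'\<close> of a closed anti-self-dual
  form \<open>\<gamma>\<close> is again closed and anti-self-dual. By Cartan it is also exact, and
  \<open>\<integral> |\<gamma>'|\<^sup>2 = - \<integral> \<gamma>' \<and> \<gamma>' = 0\<close>. The potentials below are the components of a primitive of \<open>\<gamma>' \<and> \<gamma>'\<close>.\<close>

lemma closed_asd_central:
  fixes a b c :: "real^4 \<Rightarrow> real"
  assumes n: "nil_smooth a" "nil_smooth b" "nil_smooth c"
    and z: "\<And>x. - lie 1 a x + lie 4 b x - lie 3 c x = 0" "\<And>x. - lie 2 a x - lie 3 b x - lie 4 c x = 0"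
      "\<And>x. lie 3 a x - lie 2 b x - b x - lie 1 c x = 0" "\<And>x. lie 4 a x + a x + lie 1 b x - lie 2 c x = 0"
  shows "lie 4 a x = 0 \<and> lie 4 b x = 0 \<and> lie 4 c x = 0"
proof -
  let ?a = "lie 4 a" and ?b = "lie 4 b" and ?c = "lie 4 c"
  note ns = nil_smooth_add nil_smooth_diff nil_smooth_minus nil_smooth_mult nil_smooth_lie n
  have z': "- lie 1 ?a x + lie 4 ?b x - lie 3 ?c x = 0" "- lie 2 ?a x - lie 3 ?b x - lie 4 ?c x = 0"
    "lie 4 ?a x + ?a x + lie 1 ?b x - lie 2 ?c x = 0" for x
  proof -
    have "lie 4 (\<lambda>x. - lie 1 a x + lie 4 b x - lie 3 c x) x = 0"
      "lie 4 (\<lambda>x. - lie 2 a x - lie 3 b x - lie 4 c x) x = 0"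
      "lie 4 (\<lambda>x. lie 4 a x + a x + lie 1 b x - lie 2 c x) x = 0"
      using z by (simp_all add: lie_const)
    then show "- lie 1 ?a x + lie 4 ?b x - lie 3 ?c x = 0" "- lie 2 ?a x - lie 3 ?b x - lie 4 ?c x = 0"
      "lie 4 ?a x + ?a x + lie 1 ?b x - lie 2 ?c x = 0"
      by (simp_all only: lie_rules ns nil_bracket)
  qed
  have "2 * (?a x * ?a x + ?b x * ?b x + ?c x * ?c x) = 0"
  proof (rule nonneg_divergence_eq_0[where
        ?P1.0 = "\<lambda>x. ?b x * a x - ?a x * b x" and ?P2.0 = "\<lambda>x. ?a x * c x - ?c x * a x" and
        ?P3.0 = "\<lambda>x. ?b x * c x - ?c x * b x" and ?P4.0 = "\<lambda>x. ?a x * a x + ?b x * b x + ?c x * c x"])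
    fix x
    have "?a x * (lie 4 a x + a x + lie 1 b x - lie 2 c x) = 0"
      "?b x * (- lie 1 a x + lie 4 b x - lie 3 c x) = 0"
      "?c x * (- lie 2 a x - lie 3 b x - lie 4 c x) = 0"
      "a x * (lie 4 ?a x + ?a x + lie 1 ?b x - lie 2 ?c x) = 0"
      "b x * (- lie 1 ?a x + lie 4 ?b x - lie 3 ?c x) = 0"
      "c x * (- lie 2 ?a x - lie 3 ?b x - lie 4 ?c x) = 0"
      using z[of x] z'[of x] by simp_all
    then show "2 * (?a x * ?a x + ?b x * ?b x + ?c x * ?c x)
      = lie 1 (\<lambda>x. ?b x * a x - ?a x * b x) x + lie 2 (\<lambda>x. ?a x * c x - ?c x * a x) x
      + lie 3 (\<lambda>x. ?b x * c x - ?c x * b x) x + lie 4 (\<lambda>x. ?a x * a x + ?b x * b x + ?c x * c x) x"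
      by (simp only: lie_rules ns) (simp add: algebra_simps)
  qed ((intro nil_intros n)+, simp)
  then show ?thesis by (simp add: add_nonneg_eq_0_iff)
qed

text \<open>The argument for \<open>X\<^sub>4\<close>, repeated for \<open>X\<^sub>3\<close>, which commutes with \<open>X\<^sub>1\<close> on functions killed by \<open>X\<^sub>4\<close>.
  As \<open>X\<^sub>3\<close> does not generate isometries there is an error term \<open>b X\<^sub>3a - a X\<^sub>3b\<close>; by
  \<open>X\<^sub>3b = - X\<^sub>2a\<close> it is the divergence \<open>X\<^sub>3(ab) + X\<^sub>2(a\<^sup>2)\<close>.\<close>

lemma closed_asd_fibre:
  fixes a b c :: "real^4 \<Rightarrow> real"
  assumes n: "nil_smooth a" "nil_smooth b" "nil_smooth c"
    and t: "\<And>x. lie 4 a x = 0" "\<And>x. lie 4 b x = 0" "\<And>x. lie 4 c x = 0"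
    and z: "\<And>x. - lie 1 a x - lie 3 c x = 0" "\<And>x. - lie 2 a x - lie 3 b x = 0"
      "\<And>x. lie 3 a x - lie 2 b x - b x - lie 1 c x = 0" "\<And>x. a x + lie 1 b x - lie 2 c x = 0"
  shows "lie 3 a x = 0 \<and> lie 3 b x = 0 \<and> lie 3 c x = 0"
proof -
  let ?a = "lie 3 a" and ?b = "lie 3 b" and ?c = "lie 3 c"
  note ns = nil_smooth_add nil_smooth_diff nil_smooth_minus nil_smooth_mult nil_smooth_lie n
  have comm: "lie 3 (lie 1 a) x = lie 1 ?a x" "lie 3 (lie 1 c) x = lie 1 ?c x"
    "lie 3 (lie 2 a) x = lie 2 ?a x" "lie 3 (lie 2 b) x = lie 2 ?b x" for x
    using nil_bracket(2,4)[OF n(1)] nil_bracket(4)[OF n(2)] nil_bracket(2)[OF n(3)] t by simp_all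
  have z': "- lie 1 ?a x - lie 3 ?c x = 0" "- lie 2 ?a x - lie 3 ?b x = 0"
    "lie 3 ?a x - lie 2 ?b x - ?b x - lie 1 ?c x = 0" for x
  proof -
    have "lie 3 (\<lambda>x. - lie 1 a x - lie 3 c x) x = 0"
      "lie 3 (\<lambda>x. - lie 2 a x - lie 3 b x) x = 0"
      "lie 3 (\<lambda>x. lie 3 a x - lie 2 b x - b x - lie 1 c x) x = 0"
      using z by (simp_all add: lie_const)
    then show "- lie 1 ?a x - lie 3 ?c x = 0" "- lie 2 ?a x - lie 3 ?b x = 0"
      "lie 3 ?a x - lie 2 ?b x - ?b x - lie 1 ?c x = 0"
      by (simp_all only: lie_rules ns comm)
  qed
  have "2 * (?a x * ?a x + ?b x * ?b x + ?c x * ?c x) = 0"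
  proof (rule nonneg_divergence_eq_0[where
        ?P1.0 = "\<lambda>x. ?a x * c x - ?c x * a x" and ?P2.0 = "\<lambda>x. ?a x * b x - ?b x * a x + a x * a x" and
        ?P3.0 = "\<lambda>x. ?a x * a x + ?b x * b x + ?c x * c x + a x * b x" and ?P4.0 = "\<lambda>x. 0"])
    fix x
    have "?a x * (lie 3 a x - lie 2 b x - b x - lie 1 c x) = 0"
      "?b x * (- lie 2 a x - lie 3 b x) = 0" "a x * (- lie 2 a x - lie 3 b x) = 0"
      "?c x * (- lie 1 a x - lie 3 c x) = 0"
      "a x * (lie 3 ?a x - lie 2 ?b x - ?b x - lie 1 ?c x) = 0"
      "b x * (- lie 2 ?a x - lie 3 ?b x) = 0"
      "c x * (- lie 1 ?a x - lie 3 ?c x) = 0"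
      using z[of x] z'[of x] by simp_all
    then show "2 * (?a x * ?a x + ?b x * ?b x + ?c x * ?c x)
      = lie 1 (\<lambda>x. ?a x * c x - ?c x * a x) x + lie 2 (\<lambda>x. ?a x * b x - ?b x * a x + a x * a x) x
      + lie 3 (\<lambda>x. ?a x * a x + ?b x * b x + ?c x * c x + a x * b x) x + lie 4 (\<lambda>x. 0) x"
      by (simp only: lie_rules lie_const ns) (simp add: algebra_simps)
  qed ((intro nil_intros n)+, simp)
  then show ?thesis by (simp add: add_nonneg_eq_0_iff)
qed

text \<open>Without the \<open>X\<^sub>3\<close>- and \<open>X\<^sub>4\<close>-derivatives, \<open>X\<^sub>1a = X\<^sub>2a = 0\<close> and \<open>a = X\<^sub>2c - X\<^sub>1b\<close> is a divergence,
  so \<open>a = 0\<close>. Then \<open>b = - X\<^sub>2b - X\<^sub>1c\<close> and \<open>X\<^sub>1b = X\<^sub>2c\<close>, so that \<open>b\<^sup>2\<close> is a divergence as well.\<close>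

lemma closed_asd_real:
  fixes a b c :: "real^4 \<Rightarrow> real"
  assumes n: "nil_smooth a" "nil_smooth b" "nil_smooth c"
    and z: "\<And>x. - lie 1 a x + lie 4 b x - lie 3 c x = 0" "\<And>x. - lie 2 a x - lie 3 b x - lie 4 c x = 0"
      "\<And>x. lie 3 a x - lie 2 b x - b x - lie 1 c x = 0" "\<And>x. lie 4 a x + a x + lie 1 b x - lie 2 c x = 0"
  shows "a x = 0 \<and> b x = 0 \<and> lie i c x = 0"
proof -
  note ns = nil_smooth_add nil_smooth_diff nil_smooth_minus nil_smooth_mult nil_smooth_lie n
  have t: "lie 4 a x = 0" "lie 4 b x = 0" "lie 4 c x = 0" for x
    using closed_asd_central[OF n z] by blast+
  note z3 = z[unfolded t add_0_left add_0_right diff_0_right]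
  have s: "lie 3 a x = 0" "lie 3 b x = 0" "lie 3 c x = 0" for x
    using closed_asd_fibre[OF n t z3] by blast+
  have a12: "lie 1 a x = 0" "lie 2 a x = 0" for x
    using z3(1,2)[of x] s[of x] by simp_all
  have "a x * a x = 0" for x
  proof (rule nonneg_divergence_eq_0[where ?P1.0 = "\<lambda>x. - (a x * b x)" and
        ?P2.0 = "\<lambda>x. a x * c x" and ?P3.0 = "\<lambda>x. 0" and ?P4.0 = "\<lambda>x. 0"])
    fix x
    have "a x * (a x + lie 1 b x - lie 2 c x) = 0" using z3(4) by simp
    then show "a x * a x = lie 1 (\<lambda>x. - (a x * b x)) x + lie 2 (\<lambda>x. a x * c x) x
        + lie 3 (\<lambda>x. 0) x + lie 4 (\<lambda>x. 0) x"
      by (simp only: lie_rules lie_const ns a12) (simp add: algebra_simps)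
  qed ((intro nil_intros n)+, simp)
  then have a: "a x = 0" for x by simp
  have bc: "lie 2 c x = lie 1 b x" "lie 1 c x = - lie 2 b x - b x" for x
    using z3(3,4)[of x] a[of x] s[of x] by simp_all
  have "b x * b x = 0" for x
  proof (rule nonneg_divergence_eq_0[where ?P1.0 = "\<lambda>x. - (b x * c x)" and
        ?P2.0 = "\<lambda>x. (c x * c x - b x * b x) / 2" and ?P3.0 = "\<lambda>x. 0" and ?P4.0 = "\<lambda>x. 0"])
    fix x
    show "b x * b x = lie 1 (\<lambda>x. - (b x * c x)) x + lie 2 (\<lambda>x. (c x * c x - b x * b x) / 2) x
        + lie 3 (\<lambda>x. 0) x + lie 4 (\<lambda>x. 0) x"
      by (simp only: lie_rules lie_const ns bc) (simp add: field_simps)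
  qed ((intro nil_intros n)+, simp)
  then have b: "b x = 0" for x by simp
  then have "b = (\<lambda>x. 0)" by auto
  then have "lie i c x = 0"
    using exhaust_4[of i] bc[of x] t s by (auto simp: lie_const)
  then show ?thesis using a b by blast
qed

lemma dirac_kernel_real:
  fixes f a b c :: "real^4 \<Rightarrow> real"
  assumes n: "nil_smooth f" "nil_smooth a" "nil_smooth b" "nil_smooth c"
    and z: "\<And>x. dirac1 f a b c x = 0" "\<And>x. dirac2 f a b c x = 0"
      "\<And>x. dirac3 f a b c x = 0" "\<And>x. dirac4 f a b c x = 0"
  shows "\<exists>u v. \<forall>x. f x = u \<and> a x = 0 \<and> b x = - u \<and> c x = v"
proof -
  have lf: "lie i f x = 0" for i x by (rule dirac_kernel_function_const[OF n z])
  obtain u where u: "\<And>x. f x = u"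
    using lie_zero_imp_const[OF _ lf] n by (auto simp: nil_smooth_def)
  \<comment> \<open>The term \<open>- u\<close> of \<open>dirac3\<close> is absorbed by adding \<open>u\<close> to \<open>b\<close>.\<close>
  have nb: "nil_smooth (\<lambda>x. b x + u)" using n by (intro nil_intros)
  have lb: "lie i (\<lambda>x. b x + u) x = lie i b x" for i x
    using lie_add[OF n(3) nil_smooth_const] by (simp add: lie_const)
  have z': "- lie 1 a x + lie 4 b x - lie 3 c x = 0" "- lie 2 a x - lie 3 b x - lie 4 c x = 0"
      "lie 3 a x - lie 2 b x - (b x + u) - lie 1 c x = 0" "lie 4 a x + a x + lie 1 b x - lie 2 c x = 0" for x
    using z[of x] by (simp_all add: dirac_defs lf u algebra_simps)
  have "a x = 0 \<and> b x + u = 0 \<and> lie i c x = 0" for i x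
    by (rule closed_asd_real[OF n(2) nb n(4)]) (simp_all only: lb z')
  moreover obtain v where "\<And>x. c x = v"
    using lie_zero_imp_const[of c] calculation n by (auto simp: nil_smooth_def)
  ultimately show ?thesis using u by (metis add_eq_0_iff2 add.inverse_inverse)
qed

lemma dirac_Re:
  assumes "nil_smooth f" "nil_smooth a" "nil_smooth b" "nil_smooth c"
  shows "dirac1 (\<lambda>x. Re (f x)) (\<lambda>x. Re (a x)) (\<lambda>x. Re (b x)) (\<lambda>x. Re (c x)) = (\<lambda>x. Re (dirac1 f a b c x))"
    "dirac2 (\<lambda>x. Re (f x)) (\<lambda>x. Re (a x)) (\<lambda>x. Re (b x)) (\<lambda>x. Re (c x)) = (\<lambda>x. Re (dirac2 f a b c x))"
    "dirac3 (\<lambda>x. Re (f x)) (\<lambda>x. Re (a x)) (\<lambda>x. Re (b x)) (\<lambda>x. Re (c x)) = (\<lambda>x. Re (dirac3 f a b c x))"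
    "dirac4 (\<lambda>x. Re (f x)) (\<lambda>x. Re (a x)) (\<lambda>x. Re (b x)) (\<lambda>x. Re (c x)) = (\<lambda>x. Re (dirac4 f a b c x))"
  using assms by (simp_all add: fun_eq_iff dirac_defs lie_Re)

lemma dirac_Im:
  assumes "nil_smooth f" "nil_smooth a" "nil_smooth b" "nil_smooth c"
  shows "dirac1 (\<lambda>x. Im (f x)) (\<lambda>x. Im (a x)) (\<lambda>x. Im (b x)) (\<lambda>x. Im (c x)) = (\<lambda>x. Im (dirac1 f a b c x))"
    "dirac2 (\<lambda>x. Im (f x)) (\<lambda>x. Im (a x)) (\<lambda>x. Im (b x)) (\<lambda>x. Im (c x)) = (\<lambda>x. Im (dirac2 f a b c x))"
    "dirac3 (\<lambda>x. Im (f x)) (\<lambda>x. Im (a x)) (\<lambda>x. Im (b x)) (\<lambda>x. Im (c x)) = (\<lambda>x. Im (dirac3 f a b c x))"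
    "dirac4 (\<lambda>x. Im (f x)) (\<lambda>x. Im (a x)) (\<lambda>x. Im (b x)) (\<lambda>x. Im (c x)) = (\<lambda>x. Im (dirac4 f a b c x))"
  using assms by (simp_all add: fun_eq_iff dirac_defs lie_Im)

text \<open>The operator has real coefficients, so it acts on real and imaginary parts separately.\<close>

lemma dirac_adjoint_kernel_complex:
  fixes f a b c T1 T2 T3 T4 :: "real^4 \<Rightarrow> complex"
  assumes n: "nil_smooth f" "nil_smooth a" "nil_smooth b" "nil_smooth c"
    and T: "T1 = dirac1 f a b c" "T2 = dirac2 f a b c" "T3 = dirac3 f a b c" "T4 = dirac4 f a b c"
    and adj: "(\<forall>x. f x = 0) \<or> (\<forall>x. lie 1 T2 x - lie 2 T1 x - T3 x + lie 3 T4 x - lie 4 T3 x = 0)"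
      "\<And>x. lie 1 T1 x + lie 2 T2 x - lie 3 T3 x - lie 4 T4 x + T4 x = 0"
      "\<And>x. - lie 1 T4 x + lie 2 T3 x - T3 x + lie 3 T2 x - lie 4 T1 x = 0"
      "\<And>x. lie 1 T3 x + lie 2 T4 x + lie 3 T1 x + lie 4 T2 x = 0"
  shows "\<exists>u v. \<forall>x. f x = u \<and> a x = 0 \<and> b x = - u \<and> c x = v"
proof -
  note nT = nil_smooth_dirac[OF n, folded T]
  note nRe = nil_smooth_Re[OF n(1)] nil_smooth_Re[OF n(2)] nil_smooth_Re[OF n(3)] nil_smooth_Re[OF n(4)]
  note nIm = nil_smooth_Im[OF n(1)] nil_smooth_Im[OF n(2)] nil_smooth_Im[OF n(3)] nil_smooth_Im[OF n(4)]
  have re: "Re (T1 x) = 0 \<and> Re (T2 x) = 0 \<and> Re (T3 x) = 0 \<and> Re (T4 x) = 0" for x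
  proof (rule dirac_adjoint_kernel[OF nRe])
    fix x
    show "Re (f x) * (lie 1 (\<lambda>x. Re (T2 x)) x - lie 2 (\<lambda>x. Re (T1 x)) x - Re (T3 x)
        + lie 3 (\<lambda>x. Re (T4 x)) x - lie 4 (\<lambda>x. Re (T3 x)) x) = 0"
      using adj(1) by (auto simp: lie_Re nT complex_eq_iff)
    show "Re (a x) * (lie 1 (\<lambda>x. Re (T1 x)) x + lie 2 (\<lambda>x. Re (T2 x)) x - lie 3 (\<lambda>x. Re (T3 x)) x
        - lie 4 (\<lambda>x. Re (T4 x)) x + Re (T4 x)) = 0"
      using adj(2)[of x] by (simp add: lie_Re nT complex_eq_iff)
    show "Re (b x) * (- lie 1 (\<lambda>x. Re (T4 x)) x + lie 2 (\<lambda>x. Re (T3 x)) x - Re (T3 x)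
        + lie 3 (\<lambda>x. Re (T2 x)) x - lie 4 (\<lambda>x. Re (T1 x)) x) = 0"
      using adj(3)[of x] by (simp add: lie_Re nT complex_eq_iff)
    show "Re (c x) * (lie 1 (\<lambda>x. Re (T3 x)) x + lie 2 (\<lambda>x. Re (T4 x)) x + lie 3 (\<lambda>x. Re (T1 x)) x
        + lie 4 (\<lambda>x. Re (T2 x)) x) = 0"
      using adj(4)[of x] by (simp add: lie_Re nT complex_eq_iff)
  qed (simp_all add: T dirac_Re[OF n])
  have im: "Im (T1 x) = 0 \<and> Im (T2 x) = 0 \<and> Im (T3 x) = 0 \<and> Im (T4 x) = 0" for x
  proof (rule dirac_adjoint_kernel[OF nIm])
    fix x
    show "Im (f x) * (lie 1 (\<lambda>x. Im (T2 x)) x - lie 2 (\<lambda>x. Im (T1 x)) x - Im (T3 x)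
        + lie 3 (\<lambda>x. Im (T4 x)) x - lie 4 (\<lambda>x. Im (T3 x)) x) = 0"
      using adj(1) by (auto simp: lie_Im nT complex_eq_iff)
    show "Im (a x) * (lie 1 (\<lambda>x. Im (T1 x)) x + lie 2 (\<lambda>x. Im (T2 x)) x - lie 3 (\<lambda>x. Im (T3 x)) x
        - lie 4 (\<lambda>x. Im (T4 x)) x + Im (T4 x)) = 0"
      using adj(2)[of x] by (simp add: lie_Im nT complex_eq_iff)
    show "Im (b x) * (- lie 1 (\<lambda>x. Im (T4 x)) x + lie 2 (\<lambda>x. Im (T3 x)) x - Im (T3 x)
        + lie 3 (\<lambda>x. Im (T2 x)) x - lie 4 (\<lambda>x. Im (T1 x)) x) = 0"
      using adj(3)[of x] by (simp add: lie_Im nT complex_eq_iff)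
    show "Im (c x) * (lie 1 (\<lambda>x. Im (T3 x)) x + lie 2 (\<lambda>x. Im (T4 x)) x + lie 3 (\<lambda>x. Im (T1 x)) x
        + lie 4 (\<lambda>x. Im (T2 x)) x) = 0"
      using adj(4)[of x] by (simp add: lie_Im nT complex_eq_iff)
  qed (simp_all add: T dirac_Im[OF n])
  obtain u v where re': "\<And>x. Re (f x) = u \<and> Re (a x) = 0 \<and> Re (b x) = - u \<and> Re (c x) = v"
    using dirac_kernel_real[OF nRe] re unfolding dirac_Re[OF n] T by blast
  obtain u' v' where im': "\<And>x. Im (f x) = u' \<and> Im (a x) = 0 \<and> Im (b x) = - u' \<and> Im (c x) = v'"
    using dirac_kernel_real[OF nIm] im unfolding dirac_Im[OF n] T by blast
  show ?thesis
    using re' im' by (intro exI[of _ "Complex u u'"] exI[of _ "Complex v v'"]) (simp add: complex_eq_iff)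
qed

section \<open>Forms in the invariant coframe\<close>

abbreviation covector :: "(complex^4 \<Rightarrow> complex) \<Rightarrow> bool" where
  "covector \<equiv> Vector_Spaces.linear (*s) (*)"

lemma covectorI:
  assumes "\<And>u v. f (u + v) = f u + f v" "\<And>c v. f (c *s v) = c * f v"
  shows "covector f"
  using assms by unfold_locales (simp_all add: algebra_simps)

lemma covector_add: "covector f \<Longrightarrow> f (u + v) = f u + f v"
  by (simp add: Vector_Spaces.linear_iff)

lemma covector_scale: "covector f \<Longrightarrow> f (c *s v) = c * f v"
  by (simp add: Vector_Spaces.linear_iff)

lemma covector_zero: "covector f \<Longrightarrow> f 0 = 0"
  using covector_scale[of f 0 0] by simp

lemma covector_sum: "covector f \<Longrightarrow> f (\<Sum>i\<in>I. c i *s v i) = (\<Sum>i\<in>I. c i * f (v i))"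
  by (induction I rule: infinite_finite_induct) (simp_all add: covector_zero covector_add covector_scale)

named_theorems covector_intros

lemma covector_plus [covector_intros]: "covector f \<Longrightarrow> covector g \<Longrightarrow> covector (\<lambda>v. f v + g v)"
  by (rule covectorI) (simp_all add: covector_add covector_scale algebra_simps)

lemma covector_diff [covector_intros]: "covector f \<Longrightarrow> covector g \<Longrightarrow> covector (\<lambda>v. f v - g v)"
  by (rule covectorI) (simp_all add: covector_add covector_scale algebra_simps)

lemma covector_mult_left [covector_intros]: "covector f \<Longrightarrow> covector (\<lambda>v. c * f v)"
  by (rule covectorI) (simp_all add: covector_add covector_scale algebra_simps)

lemma covector_mult_right [covector_intros]: "covector f \<Longrightarrow> covector (\<lambda>v. f v * c)"
  by (rule covectorI) (simp_all add: covector_add covector_scale algebra_simps)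

text \<open>The rows are \<open>e\<^sup>1 = dx\<close>, \<open>e\<^sup>2 = dy\<close>, \<open>e\<^sup>3 = dz - x dy\<close>, \<open>e\<^sup>4 = dt - x dz + (x\<^sup>2/2) dy\<close>.\<close>

definition coframe_mat :: "real^4 \<Rightarrow> real^4^4" where
  "coframe_mat x = vector [vector [1, 0, 0, 0], vector [0, 1, 0, 0],
     vector [0, - x$1, 1, 0], vector [0, (x$1)^2 / 2, - x$1, 1]]"

definition coframe :: "4 \<Rightarrow> real^4 \<Rightarrow> complex^4 \<Rightarrow> complex" where
  "coframe i x v = (cmat (coframe_mat x) *v v) $ i"

lemma coframe_simps:
  "coframe 1 x v = v$1" "coframe 2 x v = v$2" "coframe 3 x v = v$3 - of_real (x$1) * v$2"
  "coframe 4 x v = v$4 - of_real (x$1) * v$3 + of_real ((x$1)^2 / 2) * v$2"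
  by (simp_all add: coframe_def cmat_def matrix_vector_mult_def sum_4 coframe_mat_def vector_4)

lemma covector_coframe [covector_intros]: "covector (coframe i x)"
  by (rule covectorI) (simp_all add: coframe_def matrix_vector_right_distrib vector_scalar_commute)

lemma coframe_frame: "coframe i x (cvec (frame j x)) = (if i = j then 1 else 0)"
  using exhaust_4[of i] exhaust_4[of j]
  by (elim disjE) (simp_all add: coframe_simps cvec_def frame_nth power2_eq_square)

lemma frame_expansion: "v = (\<Sum>i\<in>UNIV. coframe i x v *s cvec (frame i x))"
  by (simp add: vec_eq_iff forall_4 sum_4 coframe_simps cvec_def frame_nth algebra_simps power2_eq_square)

lemma covector_frame: "covector f \<Longrightarrow> f v = (\<Sum>i\<in>UNIV. coframe i x v * f (cvec (frame i x)))"
  by (subst frame_expansion[of v x]) (rule covector_sum)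

lemma smooth_coframe [smooth_intros]: "smooth_on UNIV (\<lambda>x. coframe i x v)"
  using exhaust_4[of i] by (elim disjE; simp only: coframe_simps; intro smooth_intros)

lemma cmat_nil_diff:
  "(cmat (nil_diff g x) *v v) $ 1 = v$1" "(cmat (nil_diff g x) *v v) $ 2 = v$2"
  "(cmat (nil_diff g x) *v v) $ 3 = v$3 + of_real (g$1) * v$2"
  "(cmat (nil_diff g x) *v v) $ 4 = v$4 + of_real ((1/2) * (g$1)^2) * v$2 + of_real (g$1) * v$3"
  by (simp_all add: nil_diff_eq matrix_def cmat_def matrix_vector_mult_def sum_4 nil_lin_nth axis_def)

lemma coframe_nil_mult: "coframe i (nil_mult g x) (cmat (nil_diff g x) *v v) = coframe i x v"
  using exhaust_4[of i]
  by (elim disjE) (simp_all add: coframe_simps cmat_nil_diff nil_mult_nth algebra_simps power2_eq_square add_divide_distrib)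

lemma nil_diff_frame: "cmat (nil_diff g x) *v cvec (frame i x) = cvec (frame i (nil_mult g x))"
  unfolding nil_lin_frame[symmetric]
  by (simp add: vec_eq_iff forall_4 cmat_nil_diff cvec_def nil_lin_nth)

lemma coframe_conj: "coframe i x (cvec_conj v) = cnj (coframe i x v)"
  using exhaust_4[of i] by (elim disjE) (simp_all add: coframe_simps cvec_conj_def)

subsection \<open>Forms with given components\<close>

type_synonym cfun = "real^4 \<Rightarrow> complex"

definition form1 :: "cfun \<Rightarrow> cfun \<Rightarrow> cfun \<Rightarrow> cfun \<Rightarrow> cform" where
  "form1 p1 p2 p3 p4 x vs = (case vs of [u] \<Rightarrow>
     p1 x * coframe 1 x u + p2 x * coframe 2 x u + p3 x * coframe 3 x u + p4 x * coframe 4 x u | _ \<Rightarrow> 0)"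

definition coframe2 :: "4 \<Rightarrow> 4 \<Rightarrow> real^4 \<Rightarrow> complex^4 \<Rightarrow> complex^4 \<Rightarrow> complex" where
  "coframe2 i j x u v = coframe i x u * coframe j x v - coframe i x v * coframe j x u"

definition form2 :: "cfun \<Rightarrow> cfun \<Rightarrow> cfun \<Rightarrow> cfun \<Rightarrow> cfun \<Rightarrow> cfun \<Rightarrow> cform" where
  "form2 F12 F13 F14 F23 F24 F34 x vs = (case vs of [u, v] \<Rightarrow>
     F12 x * coframe2 1 2 x u v + F13 x * coframe2 1 3 x u v + F14 x * coframe2 1 4 x u v
     + F23 x * coframe2 2 3 x u v + F24 x * coframe2 2 4 x u v + F34 x * coframe2 3 4 x u v | _ \<Rightarrow> 0)"

definition nil_omega :: cform where
  "nil_omega = form2 (\<lambda>x. 1) (\<lambda>x. 0) (\<lambda>x. 0) (\<lambda>x. 0) (\<lambda>x. 0) (\<lambda>x. 1)"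

text \<open>The 3-form \<open>(\<Sum> T\<^sub>i e\<^sup>i) \<and> \<omega>\<close>. Every 3-form has a unique such description, and in it both the
  bidegrees and the Hodge operator reduce to those of 1-forms, because \<open>\<omega>\<close> has bidegree (1,1).\<close>

definition form3 :: "cfun \<Rightarrow> cfun \<Rightarrow> cfun \<Rightarrow> cfun \<Rightarrow> cform" where
  "form3 T1 T2 T3 T4 x vs = (case vs of [u, v, w] \<Rightarrow>
     form1 T1 T2 T3 T4 x [u] * nil_omega x [v, w] - form1 T1 T2 T3 T4 x [v] * nil_omega x [u, w]
     + form1 T1 T2 T3 T4 x [w] * nil_omega x [u, v] | _ \<Rightarrow> 0)"

lemma form1_eval: "form1 p1 p2 p3 p4 x [u] =
    p1 x * coframe 1 x u + p2 x * coframe 2 x u + p3 x * coframe 3 x u + p4 x * coframe 4 x u"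
  by (simp add: form1_def)

lemma form2_eval: "form2 F12 F13 F14 F23 F24 F34 x [u, v] =
     F12 x * coframe2 1 2 x u v + F13 x * coframe2 1 3 x u v + F14 x * coframe2 1 4 x u v
     + F23 x * coframe2 2 3 x u v + F24 x * coframe2 2 4 x u v + F34 x * coframe2 3 4 x u v"
  by (simp add: form2_def)

lemma form3_eval: "form3 T1 T2 T3 T4 x [u, v, w] =
     form1 T1 T2 T3 T4 x [u] * nil_omega x [v, w] - form1 T1 T2 T3 T4 x [v] * nil_omega x [u, w]
     + form1 T1 T2 T3 T4 x [w] * nil_omega x [u, v]"
  by (simp add: form3_def)

lemma nil_omega_eval: "nil_omega x [u, v] = coframe2 1 2 x u v + coframe2 3 4 x u v"
  by (simp add: nil_omega_def form2_eval)

lemma form1_length: "length vs \<noteq> 1 \<Longrightarrow> form1 p1 p2 p3 p4 x vs = 0"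
  by (auto simp: form1_def split: list.split)

lemma form2_length: "length vs \<noteq> 2 \<Longrightarrow> form2 F12 F13 F14 F23 F24 F34 x vs = 0"
  by (auto simp: form2_def split: list.split)

lemma form3_length: "length vs \<noteq> 3 \<Longrightarrow> form3 T1 T2 T3 T4 x vs = 0"
  by (auto simp: form3_def split: list.split)

lemma length_2_cases: "length vs = 2 \<Longrightarrow> \<exists>u v. vs = [u, v]"
  by (cases vs; cases "tl vs") auto

lemma length_3_cases: "length vs = 3 \<Longrightarrow> \<exists>u v w. vs = [u, v, w]"
  by (cases vs; cases "tl vs"; cases "tl (tl vs)") auto

lemma covector_coframe2 [covector_intros]:
  "covector (\<lambda>u. coframe2 i j x u v)" "covector (\<lambda>v. coframe2 i j x u v)"
  unfolding coframe2_def by (intro covector_intros)+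

lemma covector_form1 [covector_intros]: "covector (\<lambda>u. form1 p1 p2 p3 p4 x [u])"
  unfolding form1_eval by (intro covector_intros)

lemma covector_form2 [covector_intros]:
  "covector (\<lambda>u. form2 F12 F13 F14 F23 F24 F34 x [u, v])"
  "covector (\<lambda>v. form2 F12 F13 F14 F23 F24 F34 x [u, v])"
  unfolding form2_eval by (intro covector_intros)+

lemma covector_omega [covector_intros]:
  "covector (\<lambda>u. nil_omega x [u, v])" "covector (\<lambda>v. nil_omega x [u, v])"
  unfolding nil_omega_def by (rule covector_form2)+

lemma covector_form3 [covector_intros]:
  "covector (\<lambda>u. form3 T1 T2 T3 T4 x [u, v, w])"
  "covector (\<lambda>v. form3 T1 T2 T3 T4 x [u, v, w])"
  "covector (\<lambda>w. form3 T1 T2 T3 T4 x [u, v, w])"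
  unfolding form3_eval by (intro covector_intros)+

lemma form1_in_nil_forms:
  assumes n: "nil_smooth p1" "nil_smooth p2" "nil_smooth p3" "nil_smooth p4"
  shows "form1 p1 p2 p3 p4 \<in> nil_forms 1"
proof -
  have "alternating_form 1 (form1 p1 p2 p3 p4 x)" for x
    unfolding alternating_form_def
  proof (intro conjI allI impI)
    fix vs :: "(complex^4) list"
    show "length vs \<noteq> 1 \<Longrightarrow> form1 p1 p2 p3 p4 x vs = 0" by (rule form1_length)
    show "\<not> distinct vs \<Longrightarrow> form1 p1 p2 p3 p4 x vs = 0"
      by (auto simp: form1_def split: list.split)
    fix us :: "(complex^4) list"
    show "length us + length vs + 1 = 1 \<Longrightarrow> covector (\<lambda>v. form1 p1 p2 p3 p4 x (us @ v # vs))"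
      by (simp add: covector_form1)
  qed
  moreover have "smooth_on UNIV (\<lambda>x. form1 p1 p2 p3 p4 x vs)" for vs
  proof (cases "length vs = 1")
    case True
    then obtain u where "vs = [u]" by (cases vs) auto
    then show ?thesis using n by (auto simp: form1_eval nil_smooth_def intro!: smooth_intros)
  qed (simp add: form1_length smooth_const)
  moreover have "nil_invariant (form1 p1 p2 p3 p4)"
    unfolding nil_invariant_def form1_def
    using n by (auto simp: nil_smooth_def coframe_nil_mult split: list.split)
  ultimately show ?thesis by (simp add: nil_forms_def)
qed

lemma form2_in_nil_forms:
  assumes n: "nil_smooth F12" "nil_smooth F13" "nil_smooth F14" "nil_smooth F23" "nil_smooth F24" "nil_smooth F34"
  shows "form2 F12 F13 F14 F23 F24 F34 \<in> nil_forms 2" (is "?F \<in> _")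
proof -
  have "alternating_form 2 (?F x)" for x
    unfolding alternating_form_def
  proof (intro conjI allI impI)
    fix vs :: "(complex^4) list"
    show "length vs \<noteq> 2 \<Longrightarrow> ?F x vs = 0" by (rule form2_length)
    show "\<not> distinct vs \<Longrightarrow> ?F x vs = 0"
      by (cases "length vs = 2") (auto dest!: length_2_cases simp: form2_eval coframe2_def form2_length)
    fix us :: "(complex^4) list"
    assume "length us + length vs + 1 = 2"
    then consider w where "us = []" "vs = [w]" | w where "us = [w]" "vs = []"
      by (cases us; cases vs) auto
    then show "covector (\<lambda>v. ?F x (us @ v # vs))"
      by cases (simp_all add: covector_form2)
  qed
  moreover have "smooth_on UNIV (\<lambda>x. ?F x vs)" for vs
  proof (cases "length vs = 2")
    case True
    then obtain u v where "vs = [u, v]" using length_2_cases by blast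
    then show ?thesis using n
      by (auto simp: form2_eval coframe2_def nil_smooth_def intro!: smooth_intros)
  qed (simp add: form2_length smooth_const)
  moreover have "nil_invariant ?F"
    unfolding nil_invariant_def form2_def coframe2_def
    using n by (auto simp: nil_smooth_def coframe_nil_mult split: list.split)
  ultimately show ?thesis by (simp add: nil_forms_def)
qed

definition component2 :: "cform \<Rightarrow> 4 \<Rightarrow> 4 \<Rightarrow> cfun" where
  "component2 \<alpha> i j x = \<alpha> x [cvec (frame i x), cvec (frame j x)]"

lemma alternating_2:
  assumes "alternating_form 2 a"
  shows "covector (\<lambda>u. a [u, v])" "covector (\<lambda>v. a [u, v])" "a [u, u] = 0" "a [v, u] = - a [u, v]"
proof -
  have l: "length us + length vs + 1 = 2 \<Longrightarrow> covector (\<lambda>v. a (us @ v # vs))" for us vs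
    using assms unfolding alternating_form_def by blast
  have d: "\<not> distinct vs \<Longrightarrow> a vs = 0" for vs
    using assms by (auto simp: alternating_form_def)
  show c1: "covector (\<lambda>u. a [u, v])" for v using l[of "[]" "[v]"] by simp
  show c2: "covector (\<lambda>v. a [u, v])" for u using l[of "[u]" "[]"] by simp
  show c3: "a [u, u] = 0" for u using d by simp
  have "a [u + v, u + v] = a [u, u] + a [u, v] + (a [v, u] + a [v, v])"
    by (simp add: covector_add[OF c1] covector_add[OF c2])
  then have "a [u, v] + a [v, u] = 0" unfolding c3 by simp
  then show "a [v, u] = - a [u, v]" by (simp add: add_eq_0_iff)
qed

lemma nil_forms_2_eq_form2:
  assumes "\<alpha> \<in> nil_forms 2"
  shows "\<alpha> = form2 (component2 \<alpha> 1 2) (component2 \<alpha> 1 3) (component2 \<alpha> 1 4)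
     (component2 \<alpha> 2 3) (component2 \<alpha> 2 4) (component2 \<alpha> 3 4)"
proof (intro ext)
  fix x vs
  have al: "alternating_form 2 (\<alpha> x)" using assms by (simp add: nil_forms_def)
  note a = alternating_2[OF al]
  show "\<alpha> x vs = form2 (component2 \<alpha> 1 2) (component2 \<alpha> 1 3) (component2 \<alpha> 1 4)
     (component2 \<alpha> 2 3) (component2 \<alpha> 2 4) (component2 \<alpha> 3 4) x vs"
  proof (cases "length vs = 2")
    case True
    then obtain u v where vs: "vs = [u, v]" using length_2_cases by blast
    let ?X = "\<lambda>i. cvec (frame i x)"
    have "\<alpha> x [u, v] = (\<Sum>i\<in>UNIV. coframe i x u * (\<Sum>j\<in>UNIV. coframe j x v * \<alpha> x [?X i, ?X j]))"
      by (subst covector_frame[OF a(1), of _ _ x], subst covector_frame[OF a(2), of _ _ x]) (rule refl)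
    moreover have "\<alpha> x [?X 2, ?X 1] = - \<alpha> x [?X 1, ?X 2]" "\<alpha> x [?X 3, ?X 1] = - \<alpha> x [?X 1, ?X 3]"
      "\<alpha> x [?X 4, ?X 1] = - \<alpha> x [?X 1, ?X 4]" "\<alpha> x [?X 3, ?X 2] = - \<alpha> x [?X 2, ?X 3]"
      "\<alpha> x [?X 4, ?X 2] = - \<alpha> x [?X 2, ?X 4]" "\<alpha> x [?X 4, ?X 3] = - \<alpha> x [?X 3, ?X 4]"
      by (rule a(4))+
    ultimately show ?thesis
      by (simp add: vs form2_eval coframe2_def component2_def sum_4 a(3) algebra_simps)
  next
    case False
    then show ?thesis using al by (simp add: form2_length alternating_form_def)
  qed
qed

lemma nil_smooth_component2:
  assumes "\<alpha> \<in> nil_forms 2"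
  shows "nil_smooth (component2 \<alpha> i j)"
proof -
  have al: "alternating_form 2 (\<alpha> x)" for x using assms by (simp add: nil_forms_def)
  note a = alternating_2[OF al]
  have e: "cvec v = (\<Sum>k\<in>UNIV. complex_of_real (v$k) *s axis k 1)" for v :: "real^4"
    by (simp add: vec_eq_iff forall_4 cvec_def sum_4 axis_def)
  have "component2 \<alpha> i j = (\<lambda>x. \<Sum>l\<in>UNIV. complex_of_real (frame j x $ l) *
     (\<Sum>k\<in>UNIV. complex_of_real (frame i x $ k) * \<alpha> x [axis k 1, axis l 1]))"
    unfolding component2_def by (rule ext) (simp only: e covector_sum[OF a(1)] covector_sum[OF a(2)])
  moreover have "smooth_on UNIV (\<lambda>x. \<alpha> x vs)" for vs using assms by (simp add: nil_forms_def)
  ultimately have "smooth_on UNIV (component2 \<alpha> i j)"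
    by (auto intro!: smooth_intros)
  moreover have "component2 \<alpha> i j (nil_mult g x) = component2 \<alpha> i j x" if "g \<in> nil_lattice" for g x
  proof -
    have "\<alpha> (nil_mult g x) (map (\<lambda>v. cmat (nil_diff g x) *v v) [cvec (frame i x), cvec (frame j x)])
        = \<alpha> x [cvec (frame i x), cvec (frame j x)]"
      using assms that unfolding nil_forms_def nil_invariant_def by blast
    then show ?thesis by (simp add: component2_def nil_diff_frame)
  qed
  ultimately show ?thesis by (simp add: nil_smooth_def)
qed

lemma component2_form2:
  "component2 (form2 F12 F13 F14 F23 F24 F34) 1 2 = F12" "component2 (form2 F12 F13 F14 F23 F24 F34) 1 3 = F13"
  "component2 (form2 F12 F13 F14 F23 F24 F34) 1 4 = F14" "component2 (form2 F12 F13 F14 F23 F24 F34) 2 3 = F23"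
  "component2 (form2 F12 F13 F14 F23 F24 F34) 2 4 = F24" "component2 (form2 F12 F13 F14 F23 F24 F34) 3 4 = F34"
  by (simp_all add: fun_eq_iff component2_def form2_eval coframe2_def coframe_frame)

section \<open>The exterior derivative\<close>

text \<open>The derivative along the constant extension of \<open>u\<close>, as it occurs in the exterior derivative.\<close>

definition dird :: "complex^4 \<Rightarrow> cfun \<Rightarrow> cfun" where
  "dird u f x = (\<Sum>j\<in>UNIV. u$j * partial_deriv j f x)"

lemma dird_add:
  "smooth_on UNIV f \<Longrightarrow> smooth_on UNIV g \<Longrightarrow> dird u (\<lambda>x. f x + g x) x = dird u f x + dird u g x"
  unfolding dird_def
  by (subst partial_deriv_eqI[OF has_derivative_add[OF smooth_on_has_derivative smooth_on_has_derivative]])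
    (simp_all add: partial_deriv_def[symmetric] distrib_left sum.distrib)

lemma dird_diff:
  "smooth_on UNIV f \<Longrightarrow> smooth_on UNIV g \<Longrightarrow> dird u (\<lambda>x. f x - g x) x = dird u f x - dird u g x"
  unfolding dird_def
  by (subst partial_deriv_eqI[OF has_derivative_diff[OF smooth_on_has_derivative smooth_on_has_derivative]])
    (simp_all add: partial_deriv_def[symmetric] right_diff_distrib sum_subtractf)

lemma dird_mult:
  "smooth_on UNIV f \<Longrightarrow> smooth_on UNIV g \<Longrightarrow> dird u (\<lambda>x. f x * g x) x = f x * dird u g x + dird u f x * g x"
  unfolding dird_def
  by (subst partial_deriv_eqI[OF has_derivative_mult[OF smooth_on_has_derivative smooth_on_has_derivative]])
    (simp_all add: partial_deriv_def[symmetric] distrib_left sum.distrib sum_distrib_left sum_distrib_right algebra_simps)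

lemma dird_lie:
  assumes "smooth_on UNIV f"
  shows "dird u f x = coframe 1 x u * lie 1 f x + coframe 2 x u * lie 2 f x
    + coframe 3 x u * lie 3 f x + coframe 4 x u * lie 4 f x"
  unfolding lie_partial_simps[OF smooth_on_differentiable[OF assms]] coframe_simps dird_def sum_4
  by (simp add: scaleR_conv_of_real algebra_simps power2_eq_square)

text \<open>The structure equations \<open>de\<^sup>3 = -e\<^sup>1\<^sup>2\<close> and \<open>de\<^sup>4 = -e\<^sup>1\<^sup>3\<close> in disguise.\<close>

lemma dird_coframe:
  "dird u (\<lambda>y. coframe 1 y v) x = 0" "dird u (\<lambda>y. coframe 2 y v) x = 0"
  "dird u (\<lambda>y. coframe 3 y v) x = - coframe 1 x u * coframe 2 x v"
  "dird u (\<lambda>y. coframe 4 y v) x = - coframe 1 x u * coframe 3 x v"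
proof -
  have c: "partial_deriv j (\<lambda>y. c) x = 0" for j and c :: complex
    by (rule partial_deriv_eqI[where f' = "\<lambda>x. 0", simplified]) simp
  show "dird u (\<lambda>y. coframe 1 y v) x = 0" "dird u (\<lambda>y. coframe 2 y v) x = 0"
    by (simp_all add: coframe_simps dird_def c)
  have "((\<lambda>y. coframe 3 y v) has_derivative (\<lambda>h. - of_real (h$1) * v$2)) (at x)"
    unfolding coframe_simps
    by (auto intro!: derivative_eq_intros has_derivative_coord)
  then show "dird u (\<lambda>y. coframe 3 y v) x = - coframe 1 x u * coframe 2 x v"
    by (simp add: dird_def sum_4 partial_deriv_eqI axis_def coframe_simps)
  have "((\<lambda>y. coframe 4 y v) has_derivative
      (\<lambda>h. - of_real (h$1) * v$3 + of_real (x$1 * h$1) * v$2)) (at x)"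
    unfolding coframe_simps
    by (auto intro!: derivative_eq_intros has_derivative_coord simp: algebra_simps)
  then show "dird u (\<lambda>y. coframe 4 y v) x = - coframe 1 x u * coframe 3 x v"
    by (simp add: dird_def sum_4 partial_deriv_eqI axis_def coframe_simps algebra_simps)
qed

lemma ext_d_degree:
  assumes "\<And>x vs. length vs \<noteq> k \<Longrightarrow> \<alpha> x vs = 0" "length vs \<noteq> Suc k"
  shows "ext_d \<alpha> x vs = 0"
proof -
  have "\<alpha> y (nths vs (- {i})) = 0" if "i < length vs" for i y
  proof (rule assms(1))
    have "{j. j < length vs \<and> j \<in> - {i}} = {..<length vs} - {i}" by auto
    then show "length (nths vs (- {i})) \<noteq> k"
      using that assms(2) by (auto simp: length_nths)
  qed
  moreover have "partial_deriv j (\<lambda>y. 0) x = (0::complex)" for j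
    by (rule partial_deriv_eqI[where f' = "\<lambda>x. 0", simplified]) simp
  ultimately show ?thesis by (simp add: ext_d_def)
qed

lemma ext_d_eval_1: "ext_d \<alpha> x [u, v] = dird u (\<lambda>y. \<alpha> y [v]) x - dird v (\<lambda>y. \<alpha> y [u]) x"
  by (simp add: ext_d_def dird_def lessThan_Suc nths_Cons)

lemma ext_d_eval_2: "ext_d \<alpha> x [u, v, w] =
    dird u (\<lambda>y. \<alpha> y [v, w]) x - dird v (\<lambda>y. \<alpha> y [u, w]) x + dird w (\<lambda>y. \<alpha> y [u, v]) x"
  by (simp add: ext_d_def dird_def lessThan_Suc nths_Cons)

lemma ext_d_form1:
  assumes s: "smooth_on UNIV p1" "smooth_on UNIV p2" "smooth_on UNIV p3" "smooth_on UNIV p4"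
  shows "ext_d (form1 p1 p2 p3 p4) = form2 (\<lambda>x. lie 1 p2 x - lie 2 p1 x - p3 x)
     (\<lambda>x. lie 1 p3 x - lie 3 p1 x - p4 x) (\<lambda>x. lie 1 p4 x - lie 4 p1 x)
     (\<lambda>x. lie 2 p3 x - lie 3 p2 x) (\<lambda>x. lie 2 p4 x - lie 4 p2 x) (\<lambda>x. lie 3 p4 x - lie 4 p3 x)"
proof (intro ext)
  fix x and vs :: "(complex^4) list"
  let ?R = "form2 (\<lambda>x. lie 1 p2 x - lie 2 p1 x - p3 x)
     (\<lambda>x. lie 1 p3 x - lie 3 p1 x - p4 x) (\<lambda>x. lie 1 p4 x - lie 4 p1 x)
     (\<lambda>x. lie 2 p3 x - lie 3 p2 x) (\<lambda>x. lie 2 p4 x - lie 4 p2 x) (\<lambda>x. lie 3 p4 x - lie 4 p3 x)"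
  show "ext_d (form1 p1 p2 p3 p4) x vs = ?R x vs"
  proof (cases "length vs = 2")
    case True
    then obtain u v where vs: "vs = [u, v]" using length_2_cases by blast
    have D: "dird u (\<lambda>y. form1 p1 p2 p3 p4 y [v]) x =
      p1 x * dird u (\<lambda>y. coframe 1 y v) x + dird u p1 x * coframe 1 x v
      + (p2 x * dird u (\<lambda>y. coframe 2 y v) x + dird u p2 x * coframe 2 x v)
      + (p3 x * dird u (\<lambda>y. coframe 3 y v) x + dird u p3 x * coframe 3 x v)
      + (p4 x * dird u (\<lambda>y. coframe 4 y v) x + dird u p4 x * coframe 4 x v)" for u v
      unfolding form1_eval by (simp add: dird_add dird_mult s smooth_intros)
    show ?thesis
      unfolding vs ext_d_eval_1 D form2_eval coframe2_def dird_coframe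
        dird_lie[OF s(1)] dird_lie[OF s(2)] dird_lie[OF s(3)] dird_lie[OF s(4)]
      by (simp add: algebra_simps)
  next
    case False
    then show ?thesis by (simp add: form2_length ext_d_degree[of 1] form1_length)
  qed
qed

lemma ext_d_form2:
  assumes s: "smooth_on UNIV F12" "smooth_on UNIV F13" "smooth_on UNIV F14"
    "smooth_on UNIV F23" "smooth_on UNIV F24" "smooth_on UNIV F34"
  shows "ext_d (form2 F12 F13 F14 F23 F24 F34) = form3
     (\<lambda>x. lie 1 F34 x - lie 3 F14 x + lie 4 F13 x) (\<lambda>x. lie 2 F34 x - lie 3 F24 x + lie 4 F23 x)
     (\<lambda>x. lie 1 F23 x - lie 2 F13 x + lie 3 F12 x - F24 x)
     (\<lambda>x. lie 1 F24 x - lie 2 F14 x + lie 4 F12 x - F34 x)" (is "?L = ?R")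
proof (intro ext)
  fix x and vs :: "(complex^4) list"
  show "?L x vs = ?R x vs"
  proof (cases "length vs = 3")
    case True
    then obtain u v w where vs: "vs = [u, v, w]" using length_3_cases by blast
    have D2: "dird u (\<lambda>y. coframe2 i j y v w) x =
      coframe i x v * dird u (\<lambda>y. coframe j y w) x + dird u (\<lambda>y. coframe i y v) x * coframe j x w
      - (coframe i x w * dird u (\<lambda>y. coframe j y v) x + dird u (\<lambda>y. coframe i y w) x * coframe j x v)"
      for i j u v w
      unfolding coframe2_def by (simp add: dird_diff dird_mult smooth_intros)
    have s2: "smooth_on UNIV (\<lambda>y. coframe2 i j y v w)" for i j v w
      unfolding coframe2_def by (intro smooth_intros)
    have D: "dird u (\<lambda>y. form2 F12 F13 F14 F23 F24 F34 y [v, w]) x =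
      F12 x * dird u (\<lambda>y. coframe2 1 2 y v w) x + dird u F12 x * coframe2 1 2 x v w
      + (F13 x * dird u (\<lambda>y. coframe2 1 3 y v w) x + dird u F13 x * coframe2 1 3 x v w)
      + (F14 x * dird u (\<lambda>y. coframe2 1 4 y v w) x + dird u F14 x * coframe2 1 4 x v w)
      + (F23 x * dird u (\<lambda>y. coframe2 2 3 y v w) x + dird u F23 x * coframe2 2 3 x v w)
      + (F24 x * dird u (\<lambda>y. coframe2 2 4 y v w) x + dird u F24 x * coframe2 2 4 x v w)
      + (F34 x * dird u (\<lambda>y. coframe2 3 4 y v w) x + dird u F34 x * coframe2 3 4 x v w)" for u v w
      unfolding form2_eval by (simp add: dird_add dird_mult s s2 smooth_intros)
    show ?thesis
      unfolding vs ext_d_eval_2 D D2 form3_eval form1_eval nil_omega_eval dird_coframe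
        dird_lie[OF s(1)] dird_lie[OF s(2)] dird_lie[OF s(3)] dird_lie[OF s(4)]
        dird_lie[OF s(5)] dird_lie[OF s(6)]
      by (simp add: coframe2_def algebra_simps)
  next
    case False
    then show ?thesis by (simp add: form3_length ext_d_degree[of 2] form2_length)
  qed
qed

section \<open>The almost complex structure and bidegrees\<close>

text \<open>The columns express \<open>JX\<^sub>1 = X\<^sub>2\<close> and \<open>JX\<^sub>3 = X\<^sub>4\<close> in the coordinate frame.\<close>

definition nil_J :: "real^4 \<Rightarrow> real^4^4" where
  "nil_J x = vector [vector [0, -1, 0, 0], vector [1, 0, 0, 0],
     vector [x$1, - ((x$1)^2 / 2), x$1, -1],
     vector [(x$1)^2 / 2, - x$1 - (x$1)^3 / 2, 1 + (x$1)^2, - x$1]]"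

lemma cmat_nil_J:
  "(cmat (nil_J x) *v v) $ 1 = - v$2" "(cmat (nil_J x) *v v) $ 2 = v$1"
  "(cmat (nil_J x) *v v) $ 3 = of_real (x$1) * v$1 - of_real ((x$1)^2 / 2) * v$2 + of_real (x$1) * v$3 - v$4"
  "(cmat (nil_J x) *v v) $ 4 = of_real ((x$1)^2 / 2) * v$1 - of_real (x$1 + (x$1)^3 / 2) * v$2
     + of_real (1 + (x$1)^2) * v$3 - of_real (x$1) * v$4"
  by (simp_all add: nil_J_def cmat_def matrix_vector_mult_def sum_4 vector_4 algebra_simps)

lemma nil_J_nth:
  "(nil_J x *v v) $ 1 = - v$2" "(nil_J x *v v) $ 2 = v$1"
  "(nil_J x *v v) $ 3 = x$1 * v$1 - (x$1)^2 / 2 * v$2 + x$1 * v$3 - v$4"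
  "(nil_J x *v v) $ 4 = (x$1)^2 / 2 * v$1 - (x$1 + (x$1)^3 / 2) * v$2 + (1 + (x$1)^2) * v$3 - x$1 * v$4"
  by (simp_all add: nil_J_def matrix_vector_mult_def sum_4 vector_4 algebra_simps)

lemma coframe_J:
  "coframe 1 x (cmat (nil_J x) *v v) = - coframe 2 x v" "coframe 2 x (cmat (nil_J x) *v v) = coframe 1 x v"
  "coframe 3 x (cmat (nil_J x) *v v) = - coframe 4 x v" "coframe 4 x (cmat (nil_J x) *v v) = coframe 3 x v"
  by (simp_all add: coframe_simps cmat_nil_J algebra_simps power2_eq_square power3_eq_cube)

lemma cvec_J: "cvec (nil_J x *v v) = cmat (nil_J x) *v cvec v"
  by (simp add: vec_eq_iff forall_4 cmat_nil_J nil_J_nth cvec_def)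

lemma nil_J_frame:
  "nil_J x *v frame 1 x = frame 2 x" "nil_J x *v frame 2 x = - frame 1 x"
  "nil_J x *v frame 3 x = frame 4 x" "nil_J x *v frame 4 x = - frame 3 x"
  by (simp_all add: vec_eq_iff forall_4 nil_J_nth frame_nth power2_eq_square power3_eq_cube algebra_simps)

lemma almost_complex_nil_J: "almost_complex nil_J"
  unfolding almost_complex_def
proof (intro conjI allI ballI)
  have "smooth_on UNIV (\<lambda>x. nil_J x $ i $ j)" for i j
    using exhaust_4[of i] exhaust_4[of j]
    by (elim disjE; simp add: nil_J_def vector_4; intro smooth_intros)
  then have "smooth_on UNIV (\<lambda>x. \<Sum>i\<in>UNIV. \<Sum>j\<in>UNIV. nil_J x $ i $ j *\<^sub>R axis i (axis j 1) :: real^4^4)"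
    by (intro smooth_intros)
  moreover have "nil_J = (\<lambda>x. \<Sum>i\<in>UNIV. \<Sum>j\<in>UNIV. nil_J x $ i $ j *\<^sub>R axis i (axis j 1))"
    by (simp add: fun_eq_iff vec_eq_iff forall_4 sum_4 axis_def)
  ultimately show "smooth_on UNIV nil_J" by simp
next
  fix x
  show "nil_J x ** nil_J x = - mat 1"
    by (simp add: vec_eq_iff forall_4 matrix_matrix_mult_def sum_4 mat_def nil_J_def vector_4
        field_simps power2_eq_square power3_eq_cube)
next
  fix g x
  have "nil_lin g (nil_J x *v v) = nil_J (nil_mult g x) *v nil_lin g v" for v
    by (simp add: vec_eq_iff forall_4 nil_lin_nth nil_J_nth nil_mult_nth)
       (simp add: field_simps power2_eq_square power3_eq_cube)
  then show "nil_diff g x ** nil_J x = nil_J (nil_mult g x) ** nil_diff g x"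
    by (simp add: matrix_eq matrix_vector_mul_assoc[symmetric] nil_diff_vec)
qed

lemma coframe_part10:
  "coframe 1 x (part10 (nil_J x) v) = (coframe 1 x v + \<i> * coframe 2 x v) / 2"
  "coframe 2 x (part10 (nil_J x) v) = (coframe 2 x v - \<i> * coframe 1 x v) / 2"
  "coframe 3 x (part10 (nil_J x) v) = (coframe 3 x v + \<i> * coframe 4 x v) / 2"
  "coframe 4 x (part10 (nil_J x) v) = (coframe 4 x v - \<i> * coframe 3 x v) / 2"
  unfolding part10_def diff_conv_add_uminus vec.scale_minus_left[symmetric]
  by (simp_all only: covector_add[OF covector_coframe] covector_scale[OF covector_coframe] coframe_J)
    (simp_all add: field_simps)

lemma coframe_part01:
  "coframe 1 x (part01 (nil_J x) v) = (coframe 1 x v - \<i> * coframe 2 x v) / 2"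
  "coframe 2 x (part01 (nil_J x) v) = (coframe 2 x v + \<i> * coframe 1 x v) / 2"
  "coframe 3 x (part01 (nil_J x) v) = (coframe 3 x v - \<i> * coframe 4 x v) / 2"
  "coframe 4 x (part01 (nil_J x) v) = (coframe 4 x v + \<i> * coframe 3 x v) / 2"
  unfolding part01_def
  by (simp_all only: covector_add[OF covector_coframe] covector_scale[OF covector_coframe] coframe_J)
    (simp_all add: field_simps)

lemma sum_Pow_insert:
  fixes f :: "'a set \<Rightarrow> 'b::comm_monoid_add"
  assumes "finite A" "a \<notin> A"
  shows "sum f (Pow (insert a A)) = sum f (Pow A) + (\<Sum>S\<in>Pow A. f (insert a S))"
proof -
  have "sum f (Pow (insert a A)) = sum f (Pow A) + sum f (insert a ` Pow A)"
    unfolding Pow_insert by (rule sum.union_disjoint) (use assms in auto)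
  moreover have "inj_on (insert a) (Pow A)"
    using assms(2) by (auto simp: inj_on_def)
  ultimately show ?thesis by (simp add: sum.reindex)
qed

text \<open>As a sum over all subsets, the projection can be evaluated by splitting off one index at a time.\<close>

lemma bideg_Pow:
  assumes "length vs = p + q"
  shows "bideg J p q \<alpha> x vs = (\<Sum>S\<in>Pow {..<p + q}. if card S = p then
     \<alpha> x (map (\<lambda>i. (if i \<in> S then part10 (J x) else part01 (J x)) (vs ! i)) [0..<p + q]) else 0)"
proof -
  have eq: "{S. S \<subseteq> {..<p + q} \<and> card S = p} = {S \<in> Pow {..<p + q}. card S = p}" by auto
  show ?thesis
    unfolding bideg_def if_P[OF assms] eq by (rule sum.inter_filter) simp
qed

lemma lessThan_small: "{..<1} = {0::nat}" "{..<2} = {1, 0::nat}" "{..<3} = {2, 1, 0::nat}"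
  by auto

lemma upt_small: "[0..<1] = [0]" "[0..<2] = [0, 1]" "[0..<3] = [0, 1, 2]"
  by (simp_all add: upt_rec)

lemma bideg_eval_10: "bideg J 1 0 \<alpha> x [u] = \<alpha> x [part10 (J x) u]"
  by (subst bideg_Pow) (simp_all add: lessThan_small upt_small sum_Pow_insert flip: One_nat_def)

lemma bideg_eval_01: "bideg J 0 1 \<alpha> x [u] = \<alpha> x [part01 (J x) u]"
  by (subst bideg_Pow) (simp_all add: lessThan_small upt_small sum_Pow_insert flip: One_nat_def)

lemma bideg_eval_20: "bideg J 2 0 \<alpha> x [u, v] = \<alpha> x [part10 (J x) u, part10 (J x) v]"
  by (subst bideg_Pow) (simp_all add: lessThan_small upt_small sum_Pow_insert flip: One_nat_def)

lemma bideg_eval_02: "bideg J 0 2 \<alpha> x [u, v] = \<alpha> x [part01 (J x) u, part01 (J x) v]"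
  by (subst bideg_Pow) (simp_all add: lessThan_small upt_small sum_Pow_insert flip: One_nat_def)

lemma bideg_eval_11: "bideg J 1 1 \<alpha> x [u, v] =
    \<alpha> x [part10 (J x) u, part01 (J x) v] + \<alpha> x [part01 (J x) u, part10 (J x) v]"
  by (subst bideg_Pow) (simp_all add: lessThan_small upt_small sum_Pow_insert flip: One_nat_def numeral_2_eq_2)

lemma bideg_eval_21: "bideg J 2 1 \<alpha> x [u, v, w] =
    \<alpha> x [part10 (J x) u, part10 (J x) v, part01 (J x) w] + \<alpha> x [part10 (J x) u, part01 (J x) v, part10 (J x) w]
    + \<alpha> x [part01 (J x) u, part10 (J x) v, part10 (J x) w]"
  by (subst bideg_Pow) (simp_all add: lessThan_small upt_small sum_Pow_insert flip: One_nat_def)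

lemma bideg_eval_12: "bideg J 1 2 \<alpha> x [u, v, w] =
    \<alpha> x [part10 (J x) u, part01 (J x) v, part01 (J x) w] + \<alpha> x [part01 (J x) u, part10 (J x) v, part01 (J x) w]
    + \<alpha> x [part01 (J x) u, part01 (J x) v, part10 (J x) w]"
  by (subst bideg_Pow) (simp_all add: lessThan_small upt_small sum_Pow_insert flip: One_nat_def)

lemma bideg_degree:
  assumes "\<And>x vs. length vs \<noteq> k \<Longrightarrow> \<alpha> x vs = 0" "p + q \<noteq> k"
  shows "bideg J p q \<alpha> = 0"
  using assms by (auto simp: fun_eq_iff bideg_def)

text \<open>The coefficients of \<open>e\<^sup>1 + \<i>e\<^sup>2\<close> and \<open>e\<^sup>1 - \<i>e\<^sup>2\<close> in \<open>p e\<^sup>1 + q e\<^sup>2\<close>; the pair \<open>e\<^sup>3, e\<^sup>4\<close> behaves in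
  the same way.\<close>

definition proj10 :: "cfun \<Rightarrow> cfun \<Rightarrow> cfun" where
  "proj10 p q x = (p x - \<i> * q x) / 2"

definition proj01 :: "cfun \<Rightarrow> cfun \<Rightarrow> cfun" where
  "proj01 p q x = (p x + \<i> * q x) / 2"

text \<open>The general forms of the pure bidegrees that occur: \<open>p(e\<^sup>1 + \<i>e\<^sup>2) + q(e\<^sup>3 + \<i>e\<^sup>4)\<close> and its
  analogue of type (0,1), their products with \<open>\<omega>\<close>, and in bidegree (1,1) the sum of \<open>f\<omega>\<close> and the
  anti-self-dual form with the components \<open>a, b, c\<close>.\<close>

definition form10 :: "cfun \<Rightarrow> cfun \<Rightarrow> cform" where
  "form10 p q = form1 p (\<lambda>x. \<i> * p x) q (\<lambda>x. \<i> * q x)"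

definition form01 :: "cfun \<Rightarrow> cfun \<Rightarrow> cform" where
  "form01 p q = form1 p (\<lambda>x. - \<i> * p x) q (\<lambda>x. - \<i> * q x)"

definition form21 :: "cfun \<Rightarrow> cfun \<Rightarrow> cform" where
  "form21 p q = form3 p (\<lambda>x. \<i> * p x) q (\<lambda>x. \<i> * q x)"

definition form12 :: "cfun \<Rightarrow> cfun \<Rightarrow> cform" where
  "form12 p q = form3 p (\<lambda>x. - \<i> * p x) q (\<lambda>x. - \<i> * q x)"

definition form11 :: "cfun \<Rightarrow> cfun \<Rightarrow> cfun \<Rightarrow> cfun \<Rightarrow> cform" where
  "form11 f a b c = form2 (\<lambda>x. f x + a x) b c (\<lambda>x. - c x) b (\<lambda>x. f x - a x)"

lemma form1_part10: "form1 p1 p2 p3 p4 x [part10 (nil_J x) u] = form10 (proj10 p1 p2) (proj10 p3 p4) x [u]"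
  unfolding form10_def form1_eval coframe_part10 proj10_def by (simp add: field_simps)

lemma form1_part01: "form1 p1 p2 p3 p4 x [part01 (nil_J x) u] = form01 (proj01 p1 p2) (proj01 p3 p4) x [u]"
  unfolding form01_def form1_eval coframe_part01 proj01_def by (simp add: field_simps)

lemma omega_part:
  "nil_omega x [part10 (nil_J x) u, part10 (nil_J x) v] = 0"
  "nil_omega x [part01 (nil_J x) u, part01 (nil_J x) v] = 0"
  "nil_omega x [part10 (nil_J x) u, part01 (nil_J x) v] + nil_omega x [part01 (nil_J x) u, part10 (nil_J x) v]
    = nil_omega x [u, v]"
  unfolding nil_omega_eval coframe2_def coframe_part10 coframe_part01 by (simp_all add: field_simps)

lemma bideg_10_form1: "bideg nil_J 1 0 (form1 p1 p2 p3 p4) = form10 (proj10 p1 p2) (proj10 p3 p4)"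
proof (intro ext)
  fix x and vs :: "(complex^4) list"
  show "bideg nil_J 1 0 (form1 p1 p2 p3 p4) x vs = form10 (proj10 p1 p2) (proj10 p3 p4) x vs"
  proof (cases "length vs = 1")
    case True
    then obtain u where "vs = [u]" by (cases vs) auto
    then show ?thesis by (simp only: bideg_eval_10 form1_part10)
  qed (simp add: bideg_def form10_def form1_length)
qed

lemma bideg_01_form1: "bideg nil_J 0 1 (form1 p1 p2 p3 p4) = form01 (proj01 p1 p2) (proj01 p3 p4)"
proof (intro ext)
  fix x and vs :: "(complex^4) list"
  show "bideg nil_J 0 1 (form1 p1 p2 p3 p4) x vs = form01 (proj01 p1 p2) (proj01 p3 p4) x vs"
  proof (cases "length vs = 1")
    case True
    then obtain u where "vs = [u]" by (cases vs) auto
    then show ?thesis by (simp only: bideg_eval_01 form1_part01)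
  qed (simp add: bideg_def form01_def form1_length)
qed

text \<open>Of the three summands of the projection only those survive in which \<open>\<omega>\<close> receives vectors of both types,
  and these add up to \<open>\<omega>\<close> on the original vectors.\<close>

lemma bideg_21_form3: "bideg nil_J 2 1 (form3 T1 T2 T3 T4) = form21 (proj10 T1 T2) (proj10 T3 T4)"
proof (intro ext)
  fix x and vs :: "(complex^4) list"
  show "bideg nil_J 2 1 (form3 T1 T2 T3 T4) x vs = form21 (proj10 T1 T2) (proj10 T3 T4) x vs"
  proof (cases "length vs = 3")
    case True
    then obtain u v w where vs: "vs = [u, v, w]" using length_3_cases by blast
    show ?thesis
      unfolding vs bideg_eval_21 form3_eval form1_part10 omega_part(1) form21_def form10_def
      unfolding omega_part(3)[of x u v, symmetric] omega_part(3)[of x u w, symmetric]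
        omega_part(3)[of x v w, symmetric]
      by (simp add: algebra_simps)
  qed (simp add: bideg_def form21_def form3_length)
qed

lemma bideg_12_form3: "bideg nil_J 1 2 (form3 T1 T2 T3 T4) = form12 (proj01 T1 T2) (proj01 T3 T4)"
proof (intro ext)
  fix x and vs :: "(complex^4) list"
  show "bideg nil_J 1 2 (form3 T1 T2 T3 T4) x vs = form12 (proj01 T1 T2) (proj01 T3 T4) x vs"
  proof (cases "length vs = 3")
    case True
    then obtain u v w where vs: "vs = [u, v, w]" using length_3_cases by blast
    show ?thesis
      unfolding vs bideg_eval_12 form3_eval form1_part01 omega_part(2) form12_def form01_def
      unfolding omega_part(3)[of x u v, symmetric] omega_part(3)[of x u w, symmetric]
        omega_part(3)[of x v w, symmetric]
      by (simp add: algebra_simps)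
  qed (simp add: bideg_def form12_def form3_length)
qed

lemma bideg_11_form2: "bideg nil_J 1 1 (form2 F12 F13 F14 F23 F24 F34) =
    form11 (\<lambda>x. (F12 x + F34 x) / 2) (\<lambda>x. (F12 x - F34 x) / 2) (\<lambda>x. (F13 x + F24 x) / 2) (\<lambda>x. (F14 x - F23 x) / 2)"
    (is "?L = ?R")
proof (intro ext)
  fix x and vs :: "(complex^4) list"
  show "?L x vs = ?R x vs"
  proof (cases "length vs = 2")
    case True
    then obtain u v where vs: "vs = [u, v]" using length_2_cases by blast
    show ?thesis
      unfolding vs bideg_eval_11 form11_def form2_eval coframe2_def coframe_part10 coframe_part01
      by (simp add: field_simps)
  qed (simp add: bideg_def form11_def form2_length)
qed

text \<open>All projections of \<open>\<alpha>\<close> are prescribed, so that a single summand of the double sums in \<open>del\<close> and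
  \<open>delbar\<close> survives.\<close>

definition pure :: "(real^4 \<Rightarrow> real^4^4) \<Rightarrow> nat \<Rightarrow> nat \<Rightarrow> cform \<Rightarrow> bool" where
  "pure J p q \<alpha> \<longleftrightarrow> (\<forall>p' q'. bideg J p' q' \<alpha> = (if p' = p \<and> q' = q then \<alpha> else 0))"

lemma bideg_0: "bideg J p q 0 = 0"
  by (simp add: fun_eq_iff bideg_def)

lemma ext_d_0: "ext_d 0 = 0"
proof -
  have "partial_deriv j (\<lambda>y. 0) x = (0::complex)" for j x
    by (rule partial_deriv_eqI[where f' = "\<lambda>x. 0", simplified]) simp
  then show ?thesis by (simp add: fun_eq_iff ext_d_def)
qed

lemma del_pure:
  assumes "pure J p q \<alpha>" "p \<le> 2" "q \<le> 2"
  shows "del J \<alpha> = bideg J (p + 1) q (ext_d \<alpha>)"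
proof -
  have "del J \<alpha> = (\<Sum>p'\<le>2. \<Sum>q'\<le>2. if p' = p then (if q' = q then bideg J (p + 1) q (ext_d \<alpha>) else 0) else 0)"
    unfolding del_def using assms(1)
    by (intro sum.cong refl) (auto simp: pure_def ext_d_0 bideg_0)
  also have "\<dots> = bideg J (p + 1) q (ext_d \<alpha>)"
    using assms(2,3) by (subst sum.swap) (simp add: sum.delta)
  finally show ?thesis .
qed

lemma delbar_pure:
  assumes "pure J p q \<alpha>" "p \<le> 2" "q \<le> 2"
  shows "delbar J \<alpha> = bideg J p (q + 1) (ext_d \<alpha>)"
proof -
  have "delbar J \<alpha> = (\<Sum>p'\<le>2. \<Sum>q'\<le>2. if p' = p then (if q' = q then bideg J p (q + 1) (ext_d \<alpha>) else 0) else 0)"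
    unfolding delbar_def using assms(1)
    by (intro sum.cong refl) (auto simp: pure_def ext_d_0 bideg_0)
  also have "\<dots> = bideg J p (q + 1) (ext_d \<alpha>)"
    using assms(2,3) by (subst sum.swap) (simp add: sum.delta)
  finally show ?thesis .
qed

lemma form1_zero: "form1 (\<lambda>x. 0) (\<lambda>x. 0) (\<lambda>x. 0) (\<lambda>x. 0) = 0"
  by (auto simp: fun_eq_iff form1_def split: list.split)

lemma pure_form10: "pure nil_J 1 0 (form10 p q)"
  unfolding pure_def
proof (intro allI)
  fix p' q' :: nat
  consider "p' = 1 \<and> q' = 0" | "p' = 0 \<and> q' = 1" | "p' + q' \<noteq> 1" by linarith
  then show "bideg nil_J p' q' (form10 p q) = (if p' = 1 \<and> q' = 0 then form10 p q else 0)"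
  proof cases
    case 1
    have "proj10 p (\<lambda>x. \<i> * p x) = p" "proj10 q (\<lambda>x. \<i> * q x) = q"
      by (simp_all add: proj10_def fun_eq_iff)
    then show ?thesis using 1 by (simp add: form10_def[of p q] bideg_10_form1[unfolded One_nat_def])
  next
    case 2
    have "proj01 p (\<lambda>x. \<i> * p x) = (\<lambda>x. 0)" "proj01 q (\<lambda>x. \<i> * q x) = (\<lambda>x. 0)"
      by (simp_all add: proj01_def fun_eq_iff)
    then show ?thesis using 2
      by (simp add: form10_def[of p q] bideg_01_form1[unfolded One_nat_def] form01_def form1_zero)
  next
    case 3
    then have "bideg nil_J p' q' (form10 p q) = 0"
      unfolding form10_def by (intro bideg_degree[of 1]) (auto simp: form1_length)
    then show ?thesis using 3 by auto
  qed
qed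

lemma pure_form01: "pure nil_J 0 1 (form01 p q)"
  unfolding pure_def
proof (intro allI)
  fix p' q' :: nat
  consider "p' = 1 \<and> q' = 0" | "p' = 0 \<and> q' = 1" | "p' + q' \<noteq> 1" by linarith
  then show "bideg nil_J p' q' (form01 p q) = (if p' = 0 \<and> q' = 1 then form01 p q else 0)"
  proof cases
    case 2
    have "proj01 p (\<lambda>x. - \<i> * p x) = p" "proj01 q (\<lambda>x. - \<i> * q x) = q"
      by (simp_all add: proj01_def fun_eq_iff)
    then show ?thesis using 2 by (simp add: form01_def[of p q] bideg_01_form1[unfolded One_nat_def])
  next
    case 1
    have "proj10 p (\<lambda>x. - \<i> * p x) = (\<lambda>x. 0)" "proj10 q (\<lambda>x. - \<i> * q x) = (\<lambda>x. 0)"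
      by (simp_all add: proj10_def fun_eq_iff)
    then show ?thesis using 1
      by (simp add: form01_def[of p q] bideg_10_form1[unfolded One_nat_def] form10_def form1_zero)
  next
    case 3
    then have "bideg nil_J p' q' (form01 p q) = 0"
      unfolding form01_def by (intro bideg_degree[of 1]) (auto simp: form1_length)
    then show ?thesis using 3 by auto
  qed
qed

lemma pure_form11: "pure nil_J 1 1 (form11 f a b c)"
  unfolding pure_def
proof (intro allI)
  fix p' q' :: nat
  have len: "length vs \<noteq> 2 \<Longrightarrow> form11 f a b c x vs = 0" for x vs
    by (simp add: form11_def form2_length)
  consider "p' = 1 \<and> q' = 1" | "p' = 2 \<and> q' = 0" | "p' = 0 \<and> q' = 2" | "p' + q' \<noteq> 2" by linarith
  then show "bideg nil_J p' q' (form11 f a b c) = (if p' = 1 \<and> q' = 1 then form11 f a b c else 0)"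
  proof cases
    case 1
    then show ?thesis by (simp add: form11_def bideg_11_form2[unfolded One_nat_def])
  next
    case 2
    have "bideg nil_J 2 0 (form11 f a b c) x vs = 0" for x vs
    proof (cases "length vs = 2")
      case True
      then obtain u v where vs: "vs = [u, v]" using length_2_cases by blast
      show ?thesis
        unfolding vs bideg_eval_20 form11_def form2_eval coframe2_def coframe_part10
        by (simp add: field_simps)
    qed (simp add: bideg_def)
    then show ?thesis using 2 by (simp add: fun_eq_iff)
  next
    case 3
    have "bideg nil_J 0 2 (form11 f a b c) x vs = 0" for x vs
    proof (cases "length vs = 2")
      case True
      then obtain u v where vs: "vs = [u, v]" using length_2_cases by blast
      show ?thesis
        unfolding vs bideg_eval_02 form11_def form2_eval coframe2_def coframe_part01
        by (simp add: field_simps)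
    qed (simp add: bideg_def)
    then show ?thesis using 3 by (simp add: fun_eq_iff)
  next
    case 4
    then have "bideg nil_J p' q' (form11 f a b c) = 0"
      by (intro bideg_degree[of 2] len) auto
    then show ?thesis using 4 by auto
  qed
qed

section \<open>The metric and the Hodge operator\<close>

lemma coframe_cvec: "coframe i x (cvec v) = of_real ((coframe_mat x *v v) $ i)"
  by (simp add: coframe_def matrix_vector_mult_def cmat_def cvec_def)

lemma metric_eq: "metric nil_J nil_omega x = transpose (coframe_mat x) ** coframe_mat x"
proof -
  have "metric nil_J nil_omega x $ i $ j = (transpose (coframe_mat x) ** coframe_mat x) $ i $ j" for i j
  proof -
    have "metric nil_J nil_omega x $ i $ j
        = Re (\<Sum>k\<in>UNIV. coframe k x (cvec (axis i 1)) * coframe k x (cvec (axis j 1)))"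
      by (simp add: metric_def nil_omega_eval coframe2_def cvec_J coframe_J sum_4)
    also have "\<dots> = (\<Sum>k\<in>UNIV. (coframe_mat x *v axis i 1) $ k * (coframe_mat x *v axis j 1) $ k)"
      by (simp add: coframe_cvec)
    also have "\<dots> = (transpose (coframe_mat x) ** coframe_mat x) $ i $ j"
      by (simp add: matrix_matrix_mult_def transpose_def matrix_vector_mult_basis column_def)
    finally show ?thesis .
  qed
  then show ?thesis by (simp add: vec_eq_iff)
qed

lemma coframe_mat_frame: "coframe_mat x *v frame j x = axis j 1"
proof -
  have "of_real ((coframe_mat x *v frame j x) $ i) = complex_of_real (axis j 1 $ i)" for i
    using coframe_frame[of i x j] by (simp add: coframe_cvec axis_def)
  then show ?thesis by (simp add: vec_eq_iff)
qed

lemma invertible_coframe_mat: "invertible (coframe_mat x)"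
proof -
  have "coframe_mat x ** (\<chi> i j. frame j x $ i) = mat 1"
    using coframe_mat_frame[of x]
    by (auto simp: vec_eq_iff matrix_matrix_mult_def matrix_vector_mult_def mat_def axis_def)
  then show ?thesis using invertible_right_inverse by blast
qed

lemma matrix_inv_mult_vec:
  fixes A :: "real^'n^'n"
  assumes "invertible A"
  shows "matrix_inv A *v (A *v v) = v"
proof -
  have "\<exists>B. A ** B = mat 1 \<and> B ** A = mat 1" using assms by (simp add: invertible_def)
  then have "matrix_inv A ** A = mat 1"
    unfolding matrix_inv_def by (rule someI2_ex) blast
  then show ?thesis by (simp add: matrix_vector_mul_assoc)
qed

lemma dual_frame_sum:
  "(\<Sum>i\<in>UNIV. coframe j x (cvec (axis i 1)) *s cvec (dual_frame nil_J nil_omega x i)) = cvec (frame j x)"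
proof -
  let ?A = "coframe_mat x" and ?M = "metric nil_J nil_omega x"
  have "?M *v frame j x = transpose ?A *v axis j 1"
    by (simp add: metric_eq matrix_vector_mul_assoc[symmetric] coframe_mat_frame)
  also have "\<dots> = (\<Sum>i\<in>UNIV. ?A $ j $ i *\<^sub>R axis i 1)"
    using basis_expansion[of "?A $ j"]
    by (simp add: matrix_vector_mult_basis column_def transpose_def scalar_mult_eq_scaleR)
  finally have M: "?M *v frame j x = (\<Sum>i\<in>UNIV. ?A $ j $ i *\<^sub>R axis i 1)" .
  have "invertible ?M"
    unfolding metric_eq by (intro invertible_mult transpose_invertible invertible_coframe_mat)
  then have "frame j x = matrix_inv ?M *v (?M *v frame j x)"
    by (simp add: matrix_inv_mult_vec)
  also have "\<dots> = (\<Sum>i\<in>UNIV. ?A $ j $ i *\<^sub>R dual_frame nil_J nil_omega x i)"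
    unfolding M by (simp add: dual_frame_def linear_sum[OF matrix_vector_mul_linear] matrix_vector_mult_scaleR)
  finally have e: "frame j x = (\<Sum>i\<in>UNIV. ?A $ j $ i *\<^sub>R dual_frame nil_J nil_omega x i)" .
  have "coframe j x (cvec (axis i 1)) = of_real (?A $ j $ i)" for i
    by (simp add: coframe_cvec matrix_vector_mult_basis column_def)
  then show ?thesis
    by (subst e) (simp add: vec_eq_iff cvec_def)
qed

text \<open>The contraction with the metric does not depend on the frame, so the coordinate frame and its
  dual may be replaced by the orthonormal invariant frame, one argument at a time.\<close>

lemma dual_frame_contract:
  assumes b: "covector \<beta>" and d: "covector \<delta>"
  shows "(\<Sum>i\<in>UNIV. \<beta> (cvec (dual_frame nil_J nil_omega x i)) * \<delta> (cvec (axis i 1)))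
    = (\<Sum>j\<in>UNIV. \<beta> (cvec (frame j x)) * \<delta> (cvec (frame j x)))"
proof -
  have "(\<Sum>i\<in>UNIV. \<beta> (cvec (dual_frame nil_J nil_omega x i)) * \<delta> (cvec (axis i 1)))
      = (\<Sum>i\<in>UNIV. \<Sum>j\<in>UNIV. coframe j x (cvec (axis i 1)) * \<beta> (cvec (dual_frame nil_J nil_omega x i)) * \<delta> (cvec (frame j x)))"
    by (subst covector_frame[OF d, of _ x]) (simp add: sum_distrib_left algebra_simps)
  also have "\<dots> = (\<Sum>j\<in>UNIV. \<beta> (\<Sum>i\<in>UNIV. coframe j x (cvec (axis i 1)) *s cvec (dual_frame nil_J nil_omega x i))
      * \<delta> (cvec (frame j x)))"
    by (subst sum.swap) (simp add: covector_sum[OF b] sum_distrib_right)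
  finally show ?thesis by (simp only: dual_frame_sum)
qed

lemma shuffle_sign_eq:
  assumes "S \<subseteq> {..<n}"
  shows "shuffle_sign S n = (-1) ^ (\<Sum>i\<in>S. card ({..<i} - S))"
proof -
  have "{(i, j). i \<in> S \<and> j \<in> {..<n} - S \<and> j < i} = (SIGMA i:S. {..<i} - S)"
    using assms by auto
  moreover have "finite S" using assms finite_subset by blast
  ultimately show ?thesis by (simp add: shuffle_sign_def)
qed

lemma wedge_Pow:
  "wedge \<alpha> \<beta> x vs = (\<Sum>S\<in>Pow {..<length vs}. (-1) ^ (\<Sum>i\<in>S. card ({..<i} - S))
     * \<alpha> x (nths vs S) * \<beta> x (nths vs (- S)))"
  unfolding wedge_def by (intro sum.cong refl) (simp add: shuffle_sign_eq)

lemma wedge_eval_22: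
  assumes a: "\<And>vs. length vs \<noteq> 2 \<Longrightarrow> \<alpha> x vs = 0" and b: "\<And>vs. length vs \<noteq> 2 \<Longrightarrow> \<beta> x vs = 0"
  shows "wedge \<alpha> \<beta> x [p, q, r, s] = \<alpha> x [p, q] * \<beta> x [r, s] - \<alpha> x [p, r] * \<beta> x [q, s] + \<alpha> x [p, s] * \<beta> x [q, r]
    + \<alpha> x [q, r] * \<beta> x [p, s] - \<alpha> x [q, s] * \<beta> x [p, r] + \<alpha> x [r, s] * \<beta> x [p, q]"
proof -
  have "{..<length [p, q, r, s]} = {Suc (Suc (Suc 0)), Suc (Suc 0), Suc 0, 0}" by auto
  then show ?thesis
    unfolding wedge_Pow
    by (simp add: sum_Pow_insert nths_Cons insert_Diff_if lessThan_Suc del: length_Cons list.size)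
      (simp add: a b)
qed

lemma wedge_eval_12:
  assumes a: "\<And>vs. length vs \<noteq> 1 \<Longrightarrow> \<alpha> x vs = 0" and b: "\<And>vs. length vs \<noteq> 2 \<Longrightarrow> \<beta> x vs = 0"
  shows "wedge \<alpha> \<beta> x [u, v, w] = \<alpha> x [u] * \<beta> x [v, w] - \<alpha> x [v] * \<beta> x [u, w] + \<alpha> x [w] * \<beta> x [u, v]"
proof -
  have "{..<length [u, v, w]} = {Suc (Suc 0), Suc 0, 0}" by auto
  then show ?thesis
    unfolding wedge_Pow
    by (simp add: sum_Pow_insert nths_Cons insert_Diff_if lessThan_Suc del: length_Cons list.size)
      (simp add: a b)
qed

lemma wedge_degree:
  assumes a: "\<And>vs. length vs \<noteq> k \<Longrightarrow> \<alpha> x vs = 0" and b: "\<And>vs. length vs \<noteq> l \<Longrightarrow> \<beta> x vs = 0"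
    and "length vs \<noteq> k + l"
  shows "wedge \<alpha> \<beta> x vs = 0"
proof -
  have "\<alpha> x (nths vs S) = 0 \<or> \<beta> x (nths vs (- S)) = 0" for S
  proof -
    have "{i. i < length vs} = {i. i < length vs \<and> i \<in> S} \<union> {i. i < length vs \<and> i \<in> - S}" by auto
    then have "length vs = card ({i. i < length vs \<and> i \<in> S} \<union> {i. i < length vs \<and> i \<in> - S})"
      by (metis card_Collect_less_nat)
    also have "\<dots> = length (nths vs S) + length (nths vs (- S))"
      unfolding length_nths by (rule card_Un_disjoint) auto
    finally show ?thesis using assms by metis
  qed
  then show ?thesis unfolding wedge_def by (intro sum.neutral) auto
qed

lemma wedge_form1_omega: "wedge (form1 T1 T2 T3 T4) nil_omega = form3 T1 T2 T3 T4"
proof (intro ext)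
  fix x and vs :: "(complex^4) list"
  have a: "length vs \<noteq> 1 \<Longrightarrow> form1 T1 T2 T3 T4 x vs = 0" and b: "length vs \<noteq> 2 \<Longrightarrow> nil_omega x vs = 0" for vs
    by (simp_all add: form1_length nil_omega_def form2_length)
  show "wedge (form1 T1 T2 T3 T4) nil_omega x vs = form3 T1 T2 T3 T4 x vs"
  proof (cases "length vs = 3")
    case True
    then obtain u v w where vs: "vs = [u, v, w]" using length_3_cases by blast
    show ?thesis unfolding vs form3_eval by (rule wedge_eval_12) (simp_all add: a b)
  next
    case False
    then have "wedge (form1 T1 T2 T3 T4) nil_omega x vs = 0"
      by (intro wedge_degree[of 1 _ _ 2]) (simp_all add: a b)
    then show ?thesis using False by (simp add: form3_length)
  qed
qed

lemma vol_form_eval: "vol_form nil_omega x [p, q, r, s] =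
    nil_omega x [p, q] * nil_omega x [r, s] - nil_omega x [p, r] * nil_omega x [q, s]
    + nil_omega x [p, s] * nil_omega x [q, r]"
proof -
  have b: "length vs \<noteq> 2 \<Longrightarrow> nil_omega x vs = 0" for vs
    by (simp add: nil_omega_def form2_length)
  have "wedge nil_omega nil_omega x [p, q, r, s] = nil_omega x [p, q] * nil_omega x [r, s]
      - nil_omega x [p, r] * nil_omega x [q, s] + nil_omega x [p, s] * nil_omega x [q, r]
      + nil_omega x [q, r] * nil_omega x [p, s] - nil_omega x [q, s] * nil_omega x [p, r]
      + nil_omega x [r, s] * nil_omega x [p, q]"
    by (rule wedge_eval_22) (simp_all add: b)
  then show ?thesis unfolding vol_form_def by (simp only:) (simp add: algebra_simps)
qed

lemma sum_lists_0: "(\<Sum>is | length is = 0. f is) = f []"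
  by simp

lemma sum_lists_Suc:
  fixes f :: "4 list \<Rightarrow> complex"
  shows "(\<Sum>is | length is = Suc n. f is) = (\<Sum>i\<in>UNIV. \<Sum>is | length is = n. f (i # is))"
proof -
  have fin: "finite {is :: 4 list. length is = n}"
    using finite_lists_length_eq[of "UNIV :: 4 set" n] by simp
  have "{is :: 4 list. length is = Suc n} = (\<lambda>(i, is). i # is) ` (UNIV \<times> {is. length is = n})"
    by (auto simp: length_Suc_conv image_iff)
  moreover have "inj_on (\<lambda>(i, is). i # is) (UNIV \<times> {is :: 4 list. length is = n})"
    by (auto simp: inj_on_def)
  ultimately have "(\<Sum>is | length is = Suc n. f is) = (\<Sum>(i, is)\<in>UNIV \<times> {is. length is = n}. f (i # is))"
    by (simp add: sum.reindex case_prod_unfold)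
  then show ?thesis using fin by (simp add: sum.cartesian_product)
qed

lemma covector_vol [covector_intros]:
  "covector (\<lambda>p. vol_form nil_omega x [p, q, r, s])" "covector (\<lambda>q. vol_form nil_omega x [p, q, r, s])"
  "covector (\<lambda>r. vol_form nil_omega x [p, q, r, s])"
  unfolding vol_form_eval by (intro covector_intros)+

lemma hodge_degree:
  assumes "\<And>vs. length vs \<noteq> k \<Longrightarrow> \<alpha> x vs = 0" "length ws \<noteq> 4 - k" "0 < k" "k \<le> 4"
  shows "hodge J \<omega> \<alpha> x ws = 0"
proof -
  have "4 - length ws \<noteq> k" using assms(2-4) by linarith
  then have "\<alpha> x (map (\<lambda>i. cvec (dual_frame J \<omega> x i)) is) = 0" if "length is = 4 - length ws" for "is"
    using that by (intro assms(1)) simp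
  then show ?thesis by (simp add: hodge_def)
qed

lemma hodge_form2: "hodge nil_J nil_omega (form2 F12 F13 F14 F23 F24 F34)
    = form2 F34 (\<lambda>x. - F24 x) F23 F14 (\<lambda>x. - F13 x) F12" (is "hodge _ _ ?F = ?R")
proof (intro ext)
  fix x and vs :: "(complex^4) list"
  show "hodge nil_J nil_omega ?F x vs = ?R x vs"
  proof (cases "length vs = 2")
    case True
    then obtain u v where vs: "vs = [u, v]" using length_2_cases by blast
    let ?d = "\<lambda>i. cvec (dual_frame nil_J nil_omega x i)" and ?e = "\<lambda>i. cvec (axis i 1 :: real^4)"
      and ?X = "\<lambda>i. cvec (frame i x)" and ?vol = "vol_form nil_omega x"
    have "4 - length vs = Suc (Suc 0)" "fact (4 - length vs) = (2::complex)"
      using True by (simp_all add: numeral_2_eq_2)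
    then have "hodge nil_J nil_omega ?F x vs
        = 1 / 2 * (\<Sum>i\<in>UNIV. \<Sum>j\<in>UNIV. ?F x [?d i, ?d j] * ?vol [?e i, ?e j, u, v])"
      unfolding hodge_def by (simp only: sum_lists_Suc sum_lists_0) (simp add: vs)
    also have "\<dots> = 1 / 2 * (\<Sum>i\<in>UNIV. \<Sum>j\<in>UNIV. ?F x [?d i, ?X j] * ?vol [?e i, ?X j, u, v])"
      by (simp only: dual_frame_contract[OF covector_form2(2) covector_vol(2)])
    also have "\<dots> = 1 / 2 * (\<Sum>j\<in>UNIV. \<Sum>i\<in>UNIV. ?F x [?d i, ?X j] * ?vol [?e i, ?X j, u, v])"
      by (rule arg_cong[where f = "\<lambda>s. 1 / 2 * s"], rule sum.swap)
    also have "\<dots> = 1 / 2 * (\<Sum>j\<in>UNIV. \<Sum>i\<in>UNIV. ?F x [?X i, ?X j] * ?vol [?X i, ?X j, u, v])"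
      by (simp only: dual_frame_contract[OF covector_form2(1) covector_vol(1)])
    also have "\<dots> = ?R x vs"
      unfolding sum_4 form2_eval vol_form_eval nil_omega_eval coframe2_def coframe_frame vs
      by (simp add: algebra_simps)
    finally show ?thesis .
  next
    case False
    then show ?thesis by (simp add: form2_length hodge_degree[of 2])
  qed
qed

text \<open>The Hodge operator sends \<open>T \<and> \<omega>\<close> to the 1-form with \<open>e\<^sup>1 \<mapsto> e\<^sup>2\<close>, \<open>e\<^sup>2 \<mapsto> -e\<^sup>1\<close>, \<open>e\<^sup>3 \<mapsto> e\<^sup>4\<close>, \<open>e\<^sup>4 \<mapsto> -e\<^sup>3\<close>
  applied to \<open>T\<close>; it is \<open>-\<i>\<close> on the (1,0)-part and \<open>\<i>\<close> on the (0,1)-part.\<close>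

lemma hodge_form3: "hodge nil_J nil_omega (form3 T1 T2 T3 T4)
    = form1 (\<lambda>x. - T2 x) T1 (\<lambda>x. - T4 x) T3" (is "hodge _ _ ?F = ?R")
proof (intro ext)
  fix x and vs :: "(complex^4) list"
  show "hodge nil_J nil_omega ?F x vs = ?R x vs"
  proof (cases "length vs = 1")
    case True
    then obtain u where vs: "vs = [u]" by (cases vs) auto
    let ?d = "\<lambda>i. cvec (dual_frame nil_J nil_omega x i)" and ?e = "\<lambda>i. cvec (axis i 1 :: real^4)"
      and ?X = "\<lambda>i. cvec (frame i x)" and ?vol = "vol_form nil_omega x"
    have "4 - length vs = Suc (Suc (Suc 0))" "fact (4 - length vs) = (6::complex)"
      using True by (simp_all add: fact_numeral)
    then have "hodge nil_J nil_omega ?F x vs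
        = 1 / 6 * (\<Sum>i\<in>UNIV. \<Sum>j\<in>UNIV. \<Sum>k\<in>UNIV. ?F x [?d i, ?d j, ?d k] * ?vol [?e i, ?e j, ?e k, u])"
      unfolding hodge_def by (simp only: sum_lists_Suc sum_lists_0) (simp add: vs)
    also have "\<dots> = 1 / 6 * (\<Sum>i\<in>UNIV. \<Sum>j\<in>UNIV. \<Sum>k\<in>UNIV. ?F x [?d i, ?d j, ?X k] * ?vol [?e i, ?e j, ?X k, u])"
      by (simp only: dual_frame_contract[OF covector_form3(3) covector_vol(3)])
    also have "\<dots> = 1 / 6 * (\<Sum>i\<in>UNIV. \<Sum>k\<in>UNIV. \<Sum>j\<in>UNIV. ?F x [?d i, ?d j, ?X k] * ?vol [?e i, ?e j, ?X k, u])"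
      by (intro arg_cong[where f = "\<lambda>s. 1 / 6 * s"] sum.cong refl sum.swap)
    also have "\<dots> = 1 / 6 * (\<Sum>i\<in>UNIV. \<Sum>k\<in>UNIV. \<Sum>j\<in>UNIV. ?F x [?d i, ?X j, ?X k] * ?vol [?e i, ?X j, ?X k, u])"
      by (simp only: dual_frame_contract[OF covector_form3(2) covector_vol(2)])
    also have "\<dots> = 1 / 6 * (\<Sum>k\<in>UNIV. \<Sum>i\<in>UNIV. \<Sum>j\<in>UNIV. ?F x [?d i, ?X j, ?X k] * ?vol [?e i, ?X j, ?X k, u])"
      by (rule arg_cong[where f = "\<lambda>s. 1 / 6 * s"], rule sum.swap)
    also have "\<dots> = 1 / 6 * (\<Sum>k\<in>UNIV. \<Sum>j\<in>UNIV. \<Sum>i\<in>UNIV. ?F x [?d i, ?X j, ?X k] * ?vol [?e i, ?X j, ?X k, u])"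
      by (intro arg_cong[where f = "\<lambda>s. 1 / 6 * s"] sum.cong refl sum.swap)
    also have "\<dots> = 1 / 6 * (\<Sum>k\<in>UNIV. \<Sum>j\<in>UNIV. \<Sum>i\<in>UNIV. ?F x [?X i, ?X j, ?X k] * ?vol [?X i, ?X j, ?X k, u])"
      by (simp only: dual_frame_contract[OF covector_form3(1) covector_vol(1)])
    also have "\<dots> = ?R x vs"
      unfolding sum_4 form3_eval form1_eval vol_form_eval nil_omega_eval coframe2_def coframe_frame vs
      by (simp add: algebra_simps)
    finally show ?thesis .
  next
    case False
    then show ?thesis by (simp add: form1_length form3_length hodge_degree[of 3])
  qed
qed

section \<open>The almost Hermitian structure\<close>

lemma nil_omega_form11: "nil_omega = form11 (\<lambda>x. 1) (\<lambda>x. 0) (\<lambda>x. 0) (\<lambda>x. 0)"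
  by (simp add: nil_omega_def form11_def)

lemma form11_in_nil_forms:
  assumes "nil_smooth f" "nil_smooth a" "nil_smooth b" "nil_smooth c"
  shows "form11 f a b c \<in> nil_forms 2"
  unfolding form11_def by (intro form2_in_nil_forms nil_intros assms)

lemma form11_in_pq_forms:
  assumes "nil_smooth f" "nil_smooth a" "nil_smooth b" "nil_smooth c"
  shows "form11 f a b c \<in> pq_forms nil_J 1 1"
  using form11_in_nil_forms[OF assms] pure_form11[of f a b c]
  by (simp add: pq_forms_def pure_def numeral_2_eq_2)

lemma cnj_form2:
  "cnj (form2 F12 F13 F14 F23 F24 F34 x vs) = form2 (\<lambda>x. cnj (F12 x)) (\<lambda>x. cnj (F13 x)) (\<lambda>x. cnj (F14 x))
     (\<lambda>x. cnj (F23 x)) (\<lambda>x. cnj (F24 x)) (\<lambda>x. cnj (F34 x)) x (map cvec_conj vs)"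
proof (cases "length vs = 2")
  case True
  then obtain u v where "vs = [u, v]" using length_2_cases by blast
  then show ?thesis by (simp add: form2_eval coframe2_def coframe_conj)
qed (simp add: form2_length)

lemma almost_hermitian_nil: "almost_hermitian nil_J nil_omega"
  unfolding almost_hermitian_def
proof (intro conjI allI impI)
  show "almost_complex nil_J" by (rule almost_complex_nil_J)
  show "nil_omega \<in> pq_forms nil_J 1 1"
    unfolding nil_omega_form11 by (intro form11_in_pq_forms nil_intros)
  show "real_form nil_omega"
    unfolding real_form_def by (simp add: nil_omega_def cnj_form2)
  fix x v :: "real^4"
  assume "v \<noteq> 0"
  let ?r = "\<lambda>i. (coframe_mat x *v v) $ i"
  have "Re (nil_omega x [cvec v, cvec (nil_J x *v v)]) = (\<Sum>i\<in>UNIV. ?r i * ?r i)"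
    by (simp add: nil_omega_eval coframe2_def cvec_J coframe_J coframe_cvec sum_4)
  moreover have "\<exists>i. ?r i \<noteq> 0"
  proof (rule ccontr)
    assume "\<not> ?thesis"
    then have "coframe_mat x *v v = 0" by (simp add: vec_eq_iff)
    then show False
      using matrix_inv_mult_vec[OF invertible_coframe_mat, of x v] \<open>v \<noteq> 0\<close> by simp
  qed
  then obtain i where "?r i \<noteq> 0" by blast
  then have "?r i * ?r i > 0" by (metis not_real_square_gt_zero)
  then have "(\<Sum>i\<in>UNIV. ?r i * ?r i) > 0"
    by (intro sum_pos2[of UNIV i]) auto
  ultimately show "Re (nil_omega x [cvec v, cvec (nil_J x *v v)]) > 0" by simp
qed

section \<open>Non-integrability\<close>

lemma lie_differentiable:
  fixes f :: "real^4 \<Rightarrow> real"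
  assumes U: "open U" "p \<in> U" and sm: "smooth_on U f"
  shows "lie j f differentiable (at p)"
proof -
  have f: "f differentiable (at x)" "partial_deriv l f differentiable (at x)" if "x \<in> U" for x l
    using sm that smooth_on_iff by blast+
  have "(\<lambda>x. \<Sum>l\<in>UNIV. frame j x $ l * partial_deriv l f x) differentiable (at p)"
    using f(2)[OF U(2)] smooth_on_differentiable[OF smooth_frame_nth]
    by (intro differentiable_sum differentiable_mult) auto
  then show ?thesis
    using differentiable_cong_open[OF U, of "lie j f"] f(1) by (simp add: lie_partial)
qed

lemma lie_minus_differentiable:
  "f differentiable (at p) \<Longrightarrow> lie i (\<lambda>x. - f x) p = - lie i f p"
  unfolding lie_def[of i f]
  by (rule lie_eqI) (auto intro: has_derivative_minus simp: frechet_derivative_works[symmetric])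

text \<open>A holomorphic function \<open>u + \<i>v\<close> is annihilated by \<open>X\<^sub>1 + \<i>X\<^sub>2\<close> and \<open>X\<^sub>3 + \<i>X\<^sub>4\<close>, hence by their
  bracket, which is \<open>X\<^sub>4\<close>.\<close>

lemma holomorphic_lie_4:
  fixes u v :: "real^4 \<Rightarrow> real"
  assumes U: "open U" "p \<in> U" and s: "smooth_on U u" "smooth_on U v"
    and cr: "\<And>x. x \<in> U \<Longrightarrow> lie 1 u x = lie 2 v x" "\<And>x. x \<in> U \<Longrightarrow> lie 1 v x = - lie 2 u x"
      "\<And>x. x \<in> U \<Longrightarrow> lie 3 u x = lie 4 v x" "\<And>x. x \<in> U \<Longrightarrow> lie 3 v x = - lie 4 u x"
  shows "lie 4 u p = 0" "lie 4 v p = 0"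
proof -
  note bu = lie_bracket[OF U s(1)] and bv = lie_bracket[OF U s(2)]
  note du = lie_minus_differentiable[OF lie_differentiable[OF U s(1)]]
  have c: "lie i (lie 1 u) p = lie i (lie 2 v) p" "lie i (lie 3 u) p = lie i (lie 4 v) p"
    "lie i (lie 1 v) p = - lie i (lie 2 u) p" "lie i (lie 3 v) p = - lie i (lie 4 u) p" for i
    unfolding du[symmetric] by (intro lie_cong_open[OF U]; simp add: cr)+
  show "lie 4 u p = 0" using bu(2) bv(3,4) bu(5) c by simp
  show "lie 4 v p = 0" using bv(2) bu(3,4) bv(5) c by simp
qed

text \<open>The differential of a holomorphic chart would annihilate the nonzero vector \<open>X\<^sub>4\<close>.\<close>

lemma not_integrable_nil_J: "\<not> integrable_acs nil_J"
proof
  assume "integrable_acs nil_J"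
  then obtain U and \<phi> :: "real^4 \<Rightarrow> complex^2" where U: "open U" "0 \<in> U" and sm: "smooth_on U \<phi>"
    and bij: "\<And>x. x \<in> U \<Longrightarrow> bij (frechet_derivative \<phi> (at x))"
    and hol: "\<And>x v. x \<in> U \<Longrightarrow>
      frechet_derivative \<phi> (at x) (nil_J x *v v) = \<i> *s frechet_derivative \<phi> (at x) v"
    unfolding integrable_acs_def by (elim allE[of _ 0] exE conjE) blast
  let ?D = "\<lambda>x. frechet_derivative \<phi> (at x)"
  have d: "\<phi> differentiable (at x)" if "x \<in> U" for x using sm that smooth_on_iff by blast
  have "?D 0 (frame 4 0) $ k = 0" for k
  proof -
    have bl: "bounded_linear (\<lambda>w::complex^2. Re (w $ k))" "bounded_linear (\<lambda>w::complex^2. Im (w $ k))"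
      by (rule bounded_linear_compose[OF bounded_linear_Re bounded_linear_vec_nth],
          rule bounded_linear_compose[OF bounded_linear_Im bounded_linear_vec_nth])
    have s: "smooth_on U (\<lambda>x. Re (\<phi> x $ k))" "smooth_on U (\<lambda>x. Im (\<phi> x $ k))"
      using sm C_k_on_linear[OF bl(1) U(1)] C_k_on_linear[OF bl(2) U(1)]
      unfolding smooth_on_def by blast+
    have l: "lie i (\<lambda>x. Re (\<phi> x $ k)) x = Re (?D x (frame i x) $ k)"
      "lie i (\<lambda>x. Im (\<phi> x $ k)) x = Im (?D x (frame i x) $ k)" if "x \<in> U" for i x
      using d[OF that] bounded_linear.has_derivative[OF bl(1), of \<phi> "?D x" "at x"]
        bounded_linear.has_derivative[OF bl(2), of \<phi> "?D x" "at x"]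
      by (auto intro!: lie_eqI simp: frechet_derivative_works)
    have "?D x (frame 2 x) = \<i> *s ?D x (frame 1 x)" "?D x (frame 4 x) = \<i> *s ?D x (frame 3 x)"
      if "x \<in> U" for x
      using hol[OF that, of "frame 1 x"] hol[OF that, of "frame 3 x"] by (simp_all add: nil_J_frame)
    then have "lie 4 (\<lambda>x. Re (\<phi> x $ k)) 0 = 0" "lie 4 (\<lambda>x. Im (\<phi> x $ k)) 0 = 0"
      by (intro holomorphic_lie_4[OF U s]; simp add: l)+
    then show ?thesis using l U(2) by (simp add: complex_eq_iff)
  qed
  then have "?D 0 (frame 4 0) = ?D 0 0"
    using linear_frechet_derivative[OF d[OF U(2)]] by (simp add: vec_eq_iff linear_0)
  then have "frame 4 0 = (0::real^4)" using bij[OF U(2)] by (metis bij_pointE)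
  then show False using frame_nth(16)[of 0] by simp
qed

section \<open>The Lee form\<close>

lemma wedge_omega_frame:
  assumes "\<theta> \<in> nil_forms 1"
  shows "wedge \<theta> nil_omega x [cvec (frame 1 x), cvec (frame 3 x), cvec (frame 4 x)] = \<theta> x [cvec (frame 1 x)]"
    "wedge \<theta> nil_omega x [cvec (frame 2 x), cvec (frame 3 x), cvec (frame 4 x)] = \<theta> x [cvec (frame 2 x)]"
    "wedge \<theta> nil_omega x [cvec (frame 3 x), cvec (frame 1 x), cvec (frame 2 x)] = \<theta> x [cvec (frame 3 x)]"
    "wedge \<theta> nil_omega x [cvec (frame 4 x), cvec (frame 1 x), cvec (frame 2 x)] = \<theta> x [cvec (frame 4 x)]"
proof -
  have w: "wedge \<theta> nil_omega x [u, v, w] = \<theta> x [u] * nil_omega x [v, w] - \<theta> x [v] * nil_omega x [u, w]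
      + \<theta> x [w] * nil_omega x [u, v]" for u v w
    using assms by (intro wedge_eval_12) (auto simp: nil_omega_def form2_length nil_forms_def alternating_form_def)
  show "wedge \<theta> nil_omega x [cvec (frame 1 x), cvec (frame 3 x), cvec (frame 4 x)] = \<theta> x [cvec (frame 1 x)]"
    "wedge \<theta> nil_omega x [cvec (frame 2 x), cvec (frame 3 x), cvec (frame 4 x)] = \<theta> x [cvec (frame 2 x)]"
    "wedge \<theta> nil_omega x [cvec (frame 3 x), cvec (frame 1 x), cvec (frame 2 x)] = \<theta> x [cvec (frame 3 x)]"
    "wedge \<theta> nil_omega x [cvec (frame 4 x), cvec (frame 1 x), cvec (frame 2 x)] = \<theta> x [cvec (frame 4 x)]"
    unfolding w nil_omega_eval coframe2_def coframe_frame by simp_all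
qed

text \<open>The Lee form is unique: the values on suitable triples of frame vectors recover \<open>\<theta>\<close> from \<open>\<theta> \<and> \<omega>\<close>.\<close>

lemma wedge_omega_inj:
  assumes \<theta>: "\<theta> \<in> nil_forms 1" "\<theta>' \<in> nil_forms 1" and eq: "wedge \<theta> nil_omega = wedge \<theta>' nil_omega"
  shows "\<theta> = \<theta>'"
proof (intro ext)
  fix x and vs :: "(complex^4) list"
  have cov: "covector (\<lambda>v. \<eta> x [v])" if "\<eta> \<in> nil_forms 1" for \<eta>
  proof -
    have "alternating_form 1 (\<eta> x)" using that by (simp add: nil_forms_def)
    then have "covector (\<lambda>v. \<eta> x ([] @ v # []))" unfolding alternating_form_def by auto
    then show ?thesis by simp
  qed
  have "\<theta> x [cvec (frame i x)] = \<theta>' x [cvec (frame i x)]" for i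
    using wedge_omega_frame[OF \<theta>(1)] wedge_omega_frame[OF \<theta>(2)] exhaust_4[of i] unfolding eq by metis
  then have "\<theta> x [v] = \<theta>' x [v]" for v
    using covector_frame[OF cov[OF \<theta>(1)], of v x] covector_frame[OF cov[OF \<theta>(2)], of v x] by simp
  then show "\<theta> x vs = \<theta>' x vs"
    using \<theta> by (cases "length vs = 1") (auto simp: length_Suc_conv nil_forms_def alternating_form_def)
qed

lemma lee_form_nil_omega: "lee_form nil_omega = form1 (\<lambda>x. 0) (\<lambda>x. 0) (\<lambda>x. 0) (\<lambda>x. - 1)"
  unfolding lee_form_def
proof (rule the_equality)
  let ?\<theta> = "form1 (\<lambda>x. 0) (\<lambda>x. 0) (\<lambda>x. 0) (\<lambda>x. - 1)"
  have \<theta>: "?\<theta> \<in> nil_forms 1" by (intro form1_in_nil_forms nil_intros)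
  have "real_form ?\<theta>"
    unfolding real_form_def form1_def by (auto simp: coframe_conj split: list.split)
  moreover have d: "ext_d nil_omega = wedge ?\<theta> nil_omega"
    unfolding wedge_form1_omega by (simp add: nil_omega_def ext_d_form2 smooth_const lie_const)
  ultimately show "?\<theta> \<in> nil_forms 1 \<and> real_form ?\<theta> \<and> ext_d nil_omega = wedge ?\<theta> nil_omega"
    using \<theta> by blast
  show "\<theta> = ?\<theta>" if "\<theta> \<in> nil_forms 1 \<and> real_form \<theta> \<and> ext_d nil_omega = wedge \<theta> nil_omega" for \<theta>
    using wedge_omega_inj[OF _ \<theta>] that d by metis
qed

lemma not_lcak_nil_omega: "\<not> loc_conf_almost_kaehler nil_omega"
proof
  assume "loc_conf_almost_kaehler nil_omega"
  then have "form2 (\<lambda>x. 0) (\<lambda>x. 1) (\<lambda>x. 0) (\<lambda>x. 0) (\<lambda>x. 0) (\<lambda>x. 0) = 0"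
    unfolding loc_conf_almost_kaehler_def lee_form_nil_omega
    by (simp add: ext_d_form1 smooth_const lie_const)
  then have "component2 0 1 3 = (\<lambda>x. 1)" using component2_form2(2) by metis
  then show False by (simp add: component2_def fun_eq_iff)
qed

section \<open>The Laplacians\<close>

lemma form11_eq_0_iff: "form11 f a b c = 0 \<longleftrightarrow> (\<forall>x. f x = 0 \<and> a x = 0 \<and> b x = 0 \<and> c x = 0)"
proof
  assume z: "form11 f a b c = 0"
  have "component2 0 i j x = 0" for i j x by (simp add: component2_def)
  then have "f x + a x = 0" "b x = 0" "c x = 0" "f x - a x = 0" for x
    using component2_form2(1,2,3,6)[of "\<lambda>x. f x + a x" b c "\<lambda>x. - c x" b "\<lambda>x. f x - a x", folded form11_def, unfolded z]
    by metis+
  note e = this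
  have "f x = a x" "a x = 0" for x using e(1)[of x] e(4)[of x] by simp_all
  then show "\<forall>x. f x = 0 \<and> a x = 0 \<and> b x = 0 \<and> c x = 0" using e by simp
next
  assume "\<forall>x. f x = 0 \<and> a x = 0 \<and> b x = 0 \<and> c x = 0"
  then have "f = (\<lambda>x. 0)" "a = (\<lambda>x. 0)" "b = (\<lambda>x. 0)" "c = (\<lambda>x. 0)" by auto
  then show "form11 f a b c = 0"
    by (auto simp: form11_def fun_eq_iff form2_def split: list.split)
qed

lemma lie_cmult:
  fixes f :: cfun
  shows "nil_smooth f \<Longrightarrow> lie i (\<lambda>x. k * f x) x = k * lie i f x"
  using lie_mult[OF nil_smooth_const] by (simp add: lie_const)

lemma nil_smooth_proj [nil_intros]:
  assumes "nil_smooth p" "nil_smooth q"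
  shows "nil_smooth (proj10 p q)" "nil_smooth (proj01 p q)"
proof -
  have "nil_smooth (\<lambda>x. (p x - \<i> * q x) / 2)" "nil_smooth (\<lambda>x. (p x + \<i> * q x) / 2)"
    by (intro nil_intros assms)+
  then show "nil_smooth (proj10 p q)" "nil_smooth (proj01 p q)"
    by (simp_all add: proj10_def[abs_def] proj01_def[abs_def])
qed

lemma lie_proj:
  assumes "nil_smooth p" "nil_smooth q"
  shows "lie i (proj10 p q) x = (lie i p x - \<i> * lie i q x) / 2"
    "lie i (proj01 p q) x = (lie i p x + \<i> * lie i q x) / 2"
  unfolding proj10_def[abs_def] proj01_def[abs_def]
  by (simp_all add: lie_divide lie_diff lie_add lie_cmult nil_intros assms)

lemma nil_smooth_imp_smooth: "nil_smooth f \<Longrightarrow> smooth_on UNIV f"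
  by (simp add: nil_smooth_def)

lemma ext_d_form11:
  assumes n: "nil_smooth f" "nil_smooth a" "nil_smooth b" "nil_smooth c"
  shows "ext_d (form11 f a b c) = form3
     (\<lambda>x. lie 1 f x - lie 1 a x - lie 3 c x + lie 4 b x) (\<lambda>x. lie 2 f x - lie 2 a x - lie 3 b x - lie 4 c x)
     (\<lambda>x. - lie 1 c x - lie 2 b x + lie 3 f x + lie 3 a x - b x)
     (\<lambda>x. lie 1 b x - lie 2 c x + lie 4 f x + lie 4 a x - f x + a x)"
proof -
  have s: "smooth_on UNIV (\<lambda>x. f x + a x)" "smooth_on UNIV (\<lambda>x. f x - a x)"
    "smooth_on UNIV (\<lambda>x. - c x)" "smooth_on UNIV b" "smooth_on UNIV c"
    by (rule nil_smooth_imp_smooth, intro nil_intros n)+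
  show ?thesis
    unfolding form11_def ext_d_form2[OF s(1,4,5,3,4,2)]
    by (simp add: lie_add lie_diff lie_minus n algebra_simps)
qed

lemma hodge_form11: "hodge nil_J nil_omega (form11 f a b c) = form11 f (\<lambda>x. - a x) (\<lambda>x. - b x) (\<lambda>x. - c x)"
  by (simp add: form11_def hodge_form2)

lemma hodge_form21: "hodge nil_J nil_omega (form21 p q) = form10 (\<lambda>x. - \<i> * p x) (\<lambda>x. - \<i> * q x)"
  by (simp add: form21_def form10_def hodge_form3 mult.assoc[symmetric])

lemma hodge_form12: "hodge nil_J nil_omega (form12 p q) = form01 (\<lambda>x. \<i> * p x) (\<lambda>x. \<i> * q x)"
  by (simp add: form12_def form01_def hodge_form3 mult.assoc[symmetric])

lemma form1_minus: "- form1 p1 p2 p3 p4 = form1 (\<lambda>x. - p1 x) (\<lambda>x. - p2 x) (\<lambda>x. - p3 x) (\<lambda>x. - p4 x)"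
  by (auto simp: fun_eq_iff form1_def split: list.split)

lemma form10_minus: "- form10 p q = form10 (\<lambda>x. - p x) (\<lambda>x. - q x)"
  by (simp add: form10_def form1_minus)

lemma form11_minus: "- form11 f a b c = form11 (\<lambda>x. - f x) (\<lambda>x. - a x) (\<lambda>x. - b x) (\<lambda>x. - c x)"
  by (auto simp: fun_eq_iff form11_def form2_def algebra_simps split: list.split)

lemma form11_add: "form11 f a b c + form11 f' a' b' c' =
    form11 (\<lambda>x. f x + f' x) (\<lambda>x. a x + a' x) (\<lambda>x. b x + b' x) (\<lambda>x. c x + c' x)"
  by (auto simp: fun_eq_iff form11_def form2_def algebra_simps split: list.split)

lemma form11_eqI:
  "(\<And>x. f x = f' x \<and> a x = a' x \<and> b x = b' x \<and> c x = c' x) \<Longrightarrow> form11 f a b c = form11 f' a' b' c'"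
proof -
  assume "\<And>x. f x = f' x \<and> a x = a' x \<and> b x = b' x \<and> c x = c' x"
  then have "f = f'" "a = a'" "b = b'" "c = c'" by auto
  then show ?thesis by simp
qed

lemma delbar_form10:
  assumes n: "nil_smooth p" "nil_smooth q"
  shows "delbar nil_J (form10 p q) = form11
     (\<lambda>x. (\<i> * lie 1 p x - lie 2 p x - q x + \<i> * lie 3 q x - lie 4 q x) / 2)
     (\<lambda>x. (\<i> * lie 1 p x - lie 2 p x - q x - \<i> * lie 3 q x + lie 4 q x) / 2)
     (\<lambda>x. (lie 1 q x - lie 3 p x - \<i> * q x + \<i> * lie 2 q x - \<i> * lie 4 p x) / 2)
     (\<lambda>x. (\<i> * lie 1 q x - lie 4 p x - lie 2 q x + \<i> * lie 3 p x) / 2)"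
proof -
  have s: "smooth_on UNIV p" "smooth_on UNIV (\<lambda>x. \<i> * p x)" "smooth_on UNIV q" "smooth_on UNIV (\<lambda>x. \<i> * q x)"
    by (rule nil_smooth_imp_smooth, intro nil_intros n)+
  have "delbar nil_J (form10 p q) = bideg nil_J 1 1 (ext_d (form10 p q))"
    using delbar_pure[OF pure_form10, of p q] by simp
  then show ?thesis
    unfolding form10_def ext_d_form1[OF s] bideg_11_form2 by (simp add: lie_cmult n algebra_simps)
qed

lemma del_form01:
  assumes n: "nil_smooth p" "nil_smooth q"
  shows "del nil_J (form01 p q) = form11
     (\<lambda>x. (- \<i> * lie 1 p x - lie 2 p x - q x - \<i> * lie 3 q x - lie 4 q x) / 2)
     (\<lambda>x. (- \<i> * lie 1 p x - lie 2 p x - q x + \<i> * lie 3 q x + lie 4 q x) / 2)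
     (\<lambda>x. (lie 1 q x - lie 3 p x + \<i> * q x - \<i> * lie 2 q x + \<i> * lie 4 p x) / 2)
     (\<lambda>x. (- \<i> * lie 1 q x - lie 4 p x - lie 2 q x - \<i> * lie 3 p x) / 2)"
proof -
  have s: "smooth_on UNIV p" "smooth_on UNIV (\<lambda>x. - \<i> * p x)" "smooth_on UNIV q" "smooth_on UNIV (\<lambda>x. - \<i> * q x)"
    by (rule nil_smooth_imp_smooth, intro nil_intros n)+
  have "del nil_J (form01 p q) = bideg nil_J 1 1 (ext_d (form01 p q))"
    using del_pure[OF pure_form01, of p q] by simp
  then show ?thesis
    unfolding form01_def ext_d_form1[OF s] bideg_11_form2
    by (simp only: lie_cmult n) (simp add: algebra_simps)
qed

text \<open>With \<open>\<alpha> = f\<omega> + \<i>\<gamma>\<close> and \<open>d\<^sup>c = \<i>(\<partial>bar - \<partial>)\<close>, the (1,2)-part of \<open>R = d\<gamma> - d\<^sup>c(f\<omega>)\<close> is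
  \<open>\<partial>bar \<gamma> - \<i> \<partial>bar(f\<omega>) = -\<i> \<partial>bar \<alpha>\<close>.\<close>

lemma delbar_form11:
  assumes n: "nil_smooth f" "nil_smooth a" "nil_smooth b" "nil_smooth c"
  shows "delbar nil_J (form11 f (\<lambda>x. \<i> * a x) (\<lambda>x. \<i> * b x) (\<lambda>x. \<i> * c x)) =
     form12 (\<lambda>x. \<i> * proj01 (dirac1 f a b c) (dirac2 f a b c) x) (\<lambda>x. \<i> * proj01 (dirac3 f a b c) (dirac4 f a b c) x)"
proof -
  let ?\<alpha> = "form11 f (\<lambda>x. \<i> * a x) (\<lambda>x. \<i> * b x) (\<lambda>x. \<i> * c x)"
  have ni: "nil_smooth (\<lambda>x. \<i> * a x)" "nil_smooth (\<lambda>x. \<i> * b x)" "nil_smooth (\<lambda>x. \<i> * c x)"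
    by (intro nil_intros n)+
  have "delbar nil_J ?\<alpha> = bideg nil_J 1 2 (ext_d ?\<alpha>)"
    using delbar_pure[OF pure_form11, of f "\<lambda>x. \<i> * a x" "\<lambda>x. \<i> * b x" "\<lambda>x. \<i> * c x"]
    by (simp add: numeral_2_eq_2)
  then show ?thesis
    unfolding ext_d_form11[OF n(1) ni] bideg_12_form3
    by (simp add: lie_cmult n proj01_def[abs_def] dirac_defs algebra_simps)
qed

text \<open>The argument of \<open>del\<close> is \<open>*\<alpha> = f\<omega> - \<i>\<gamma>\<close>, and the (2,1)-part of \<open>R\<close> is
  \<open>\<partial>\<gamma> + \<i> \<partial>(f\<omega>) = \<i> \<partial>*\<alpha>\<close>.\<close>

lemma del_form11:
  assumes n: "nil_smooth f" "nil_smooth a" "nil_smooth b" "nil_smooth c"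
  shows "del nil_J (form11 f (\<lambda>x. - (\<i> * a x)) (\<lambda>x. - (\<i> * b x)) (\<lambda>x. - (\<i> * c x))) =
     form21 (\<lambda>x. - \<i> * proj10 (dirac1 f a b c) (dirac2 f a b c) x) (\<lambda>x. - \<i> * proj10 (dirac3 f a b c) (dirac4 f a b c) x)"
proof -
  let ?\<alpha> = "form11 f (\<lambda>x. - (\<i> * a x)) (\<lambda>x. - (\<i> * b x)) (\<lambda>x. - (\<i> * c x))"
  have ni: "nil_smooth (\<lambda>x. - (\<i> * a x))" "nil_smooth (\<lambda>x. - (\<i> * b x))" "nil_smooth (\<lambda>x. - (\<i> * c x))"
    by (intro nil_intros n)+
  have ni': "nil_smooth (\<lambda>x. \<i> * a x)" "nil_smooth (\<lambda>x. \<i> * b x)" "nil_smooth (\<lambda>x. \<i> * c x)"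
    by (intro nil_intros n)+
  have "del nil_J ?\<alpha> = bideg nil_J 2 1 (ext_d ?\<alpha>)"
    using del_pure[OF pure_form11, of f "\<lambda>x. - (\<i> * a x)" "\<lambda>x. - (\<i> * b x)" "\<lambda>x. - (\<i> * c x)"]
    by (simp add: numeral_2_eq_2)
  then show ?thesis
    unfolding ext_d_form11[OF n(1) ni] bideg_21_form3
    by (simp add: lie_minus ni' lie_cmult n proj10_def[abs_def] dirac_defs algebra_simps)
qed

text \<open>Write \<open>R = T \<and> \<omega>\<close>. Since \<open>*\<close> is \<open>\<mp>\<i>\<close> on forms of bidegree (2,1) and (1,2), the previous lemmas give
  \<open>\<partial>bar\<^sup>*\<alpha> = T\<^sup>1\<^sup>0\<close> and \<open>\<partial>bar\<^sup>*\<partial>bar \<alpha> = *\<partial>T\<^sup>0\<^sup>1\<close>. The sum \<open>\<partial>bar T\<^sup>1\<^sup>0 + *\<partial>T\<^sup>0\<^sup>1\<close> has as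
  \<open>\<omega>\<close>-component that of \<open>dT\<close> and as anti-self-dual component \<open>\<i>\<close> times that of \<open>d(*R)\<close>: up to the factor
  \<open>1/2\<close>, the adjoint of the operator \<open>(f,a,b,c) \<mapsto> R\<close> applied to \<open>R\<close>.\<close>

lemma laplace_delbar_form11:
  assumes n: "nil_smooth f" "nil_smooth a" "nil_smooth b" "nil_smooth c"
    and D: "D1 = dirac1 f a b c" "D2 = dirac2 f a b c" "D3 = dirac3 f a b c" "D4 = dirac4 f a b c"
  shows "laplace_delbar nil_J nil_omega (form11 f (\<lambda>x. \<i> * a x) (\<lambda>x. \<i> * b x) (\<lambda>x. \<i> * c x)) =
     form11 (\<lambda>x. (lie 1 D2 x - lie 2 D1 x - D3 x + lie 3 D4 x - lie 4 D3 x) / 2)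
       (\<lambda>x. \<i> * (lie 1 D1 x + lie 2 D2 x - lie 3 D3 x - lie 4 D4 x + D4 x) / 2)
       (\<lambda>x. \<i> * (- lie 1 D4 x + lie 2 D3 x - D3 x + lie 3 D2 x - lie 4 D1 x) / 2)
       (\<lambda>x. \<i> * (lie 1 D3 x + lie 2 D4 x + lie 3 D1 x + lie 4 D2 x) / 2)"
proof -
  let ?\<alpha> = "form11 f (\<lambda>x. \<i> * a x) (\<lambda>x. \<i> * b x) (\<lambda>x. \<i> * c x)"
  let ?P = "proj10 D1 D2" and ?Q = "proj10 D3 D4"
  let ?P' = "\<lambda>x. - 1 * proj01 D1 D2 x" and ?Q' = "\<lambda>x. - 1 * proj01 D3 D4 x"
  note nD = nil_smooth_dirac[OF n, folded D]
  have nP: "nil_smooth ?P" "nil_smooth ?Q" "nil_smooth ?P'" "nil_smooth ?Q'"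
    "nil_smooth (proj01 D1 D2)" "nil_smooth (proj01 D3 D4)"
    by (intro nil_intros nD)+
  have "delbar_adj nil_J nil_omega ?\<alpha> = form10 ?P ?Q"
    by (simp add: delbar_adj_def hodge_form11 del_form11[OF n] hodge_form21 form10_minus D flip: mult.assoc)
  moreover have "delbar_adj nil_J nil_omega (delbar nil_J ?\<alpha>) = - hodge nil_J nil_omega (del nil_J (form01 ?P' ?Q'))"
    unfolding delbar_adj_def delbar_form11[OF n] hodge_form12 by (simp add: D flip: mult.assoc)
  ultimately show ?thesis
    unfolding laplace_delbar_def
    by (simp only: delbar_form10[OF nP(1,2)] del_form01[OF nP(3,4)] hodge_form11 form11_minus form11_add
        lie_cmult nP lie_proj nD)
      (rule form11_eqI, simp add: proj10_def proj01_def field_simps)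
qed

text \<open>For an anti-self-dual \<open>\<gamma>\<close> the Laplacian is \<open>\<beta> - *\<beta>\<close> with \<open>\<beta> = d*d\<gamma>\<close>, twice the anti-self-dual part
  of \<open>\<beta>\<close>, and \<open>d\<gamma>\<close> is the value of the operator at \<open>(0,a,b,c)\<close>.\<close>

lemma laplace_d_form11:
  assumes n: "nil_smooth a" "nil_smooth b" "nil_smooth c"
    and D: "D1 = dirac1 (\<lambda>x. 0) a b c" "D2 = dirac2 (\<lambda>x. 0) a b c"
      "D3 = dirac3 (\<lambda>x. 0) a b c" "D4 = dirac4 (\<lambda>x. 0) a b c"
  shows "laplace_d nil_J nil_omega (form11 (\<lambda>x. 0) a b c) =
     form11 (\<lambda>x. 0) (\<lambda>x. lie 1 D1 x + lie 2 D2 x - lie 3 D3 x - lie 4 D4 x + D4 x)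
       (\<lambda>x. - lie 1 D4 x + lie 2 D3 x - D3 x + lie 3 D2 x - lie 4 D1 x)
       (\<lambda>x. lie 1 D3 x + lie 2 D4 x + lie 3 D1 x + lie 4 D2 x)"
proof -
  note n0 = nil_smooth_const[of "0::complex"]
  note nD = nil_smooth_dirac[OF n0 n, folded D]
  have nm: "nil_smooth (\<lambda>x. - a x)" "nil_smooth (\<lambda>x. - b x)" "nil_smooth (\<lambda>x. - c x)"
    by (intro nil_intros n)+
  have s: "smooth_on UNIV (\<lambda>x. - D2 x)" "smooth_on UNIV D1" "smooth_on UNIV (\<lambda>x. - D4 x)" "smooth_on UNIV D3"
    by (rule nil_smooth_imp_smooth, intro nil_intros nD)+
  have 1: "ext_d (form11 (\<lambda>x. 0) a b c) = form3 D1 D2 D3 D4"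
    unfolding ext_d_form11[OF n0 n] by (simp add: D dirac_defs[abs_def] lie_const algebra_simps)
  have 2: "ext_d (form11 (\<lambda>x. 0) (\<lambda>x. - a x) (\<lambda>x. - b x) (\<lambda>x. - c x))
      = form3 (\<lambda>x. - D1 x) (\<lambda>x. - D2 x) (\<lambda>x. - D3 x) (\<lambda>x. - D4 x)"
    unfolding ext_d_form11[OF n0 nm] by (simp add: D dirac_defs[abs_def] lie_const lie_minus n algebra_simps)
  let ?\<beta> = "form1 (\<lambda>x. - D2 x) D1 (\<lambda>x. - D4 x) D3"
  have "d_adj nil_J nil_omega (form11 (\<lambda>x. 0) a b c) = ?\<beta>"
    unfolding d_adj_def hodge_form11 2 hodge_form3 by (simp add: form1_minus)
  moreover have "d_adj nil_J nil_omega (ext_d (form11 (\<lambda>x. 0) a b c)) = - hodge nil_J nil_omega (ext_d ?\<beta>)"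
    unfolding d_adj_def 1 hodge_form3 ..
  ultimately have "laplace_d nil_J nil_omega (form11 (\<lambda>x. 0) a b c) = ext_d ?\<beta> + - hodge nil_J nil_omega (ext_d ?\<beta>)"
    by (simp only: laplace_d_def)
  note e = this
  show ?thesis
    unfolding e ext_d_form1[OF s] hodge_form2
    by (auto simp: fun_eq_iff form11_def form2_def lie_minus nD algebra_simps split: list.split)
qed

section \<open>The spaces of harmonic forms\<close>

text \<open>The form \<open>\<omega> - \<i>(e\<^sup>1\<^sup>3 + e\<^sup>2\<^sup>4)\<close>, neither self-dual nor anti-self-dual.\<close>

definition harmonic_mixed :: cform where
  "harmonic_mixed = form11 (\<lambda>x. 1) (\<lambda>x. 0) (\<lambda>x. - \<i>) (\<lambda>x. 0)"

definition harmonic_asd :: cform where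
  "harmonic_asd = form11 (\<lambda>x. 0) (\<lambda>x. 0) (\<lambda>x. 0) (\<lambda>x. 1)"

lemma cscale_form11: "cscale k (form11 f a b c) = form11 (\<lambda>x. k * f x) (\<lambda>x. k * a x) (\<lambda>x. k * b x) (\<lambda>x. k * c x)"
  by (auto simp: fun_eq_iff cscale_def form11_def form2_def algebra_simps split: list.split)

lemma pq_forms_11_eq_form11:
  assumes "\<alpha> \<in> pq_forms nil_J 1 1"
  obtains f a b c where "nil_smooth f" "nil_smooth a" "nil_smooth b" "nil_smooth c"
    "\<alpha> = form11 f (\<lambda>x. \<i> * a x) (\<lambda>x. \<i> * b x) (\<lambda>x. \<i> * c x)"
proof -
  have n2: "\<alpha> \<in> nil_forms 2" and b: "bideg nil_J 1 1 \<alpha> = \<alpha>"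
    using assms by (simp_all add: pq_forms_def numeral_2_eq_2)
  let ?F = "component2 \<alpha>"
  let ?f = "\<lambda>x. (?F 1 2 x + ?F 3 4 x) / 2" and ?a = "\<lambda>x. - \<i> * ((?F 1 2 x - ?F 3 4 x) / 2)"
    and ?b = "\<lambda>x. - \<i> * ((?F 1 3 x + ?F 2 4 x) / 2)" and ?c = "\<lambda>x. - \<i> * ((?F 1 4 x - ?F 2 3 x) / 2)"
  have "\<alpha> = bideg nil_J 1 1 (form2 (?F 1 2) (?F 1 3) (?F 1 4) (?F 2 3) (?F 2 4) (?F 3 4))"
    using b nil_forms_2_eq_form2[OF n2] by simp
  also have "\<dots> = form11 ?f (\<lambda>x. \<i> * ?a x) (\<lambda>x. \<i> * ?b x) (\<lambda>x. \<i> * ?c x)"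
    unfolding bideg_11_form2 by (rule form11_eqI) (simp add: field_simps)
  finally have e: "\<alpha> = form11 ?f (\<lambda>x. \<i> * ?a x) (\<lambda>x. \<i> * ?b x) (\<lambda>x. \<i> * ?c x)" .
  show thesis
    by (rule that[OF _ _ _ _ e]) (intro nil_intros nil_smooth_component2[OF n2])+
qed

lemma harmonic_delbar_11: "harmonic_delbar nil_J nil_omega 1 1 =
    {cscale u harmonic_mixed + cscale v harmonic_asd | u v. True}" (is "?H = ?S")
proof
  show "?H \<subseteq> ?S"
  proof
    fix \<alpha> assume "\<alpha> \<in> ?H"
    then have pq: "\<alpha> \<in> pq_forms nil_J 1 1" and L: "laplace_delbar nil_J nil_omega \<alpha> = 0"
      by (simp_all add: harmonic_delbar_def)
    obtain f a b c where n: "nil_smooth f" "nil_smooth a" "nil_smooth b" "nil_smooth c"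
      and \<alpha>: "\<alpha> = form11 f (\<lambda>x. \<i> * a x) (\<lambda>x. \<i> * b x) (\<lambda>x. \<i> * c x)"
      using pq_forms_11_eq_form11[OF pq] by metis
    obtain u v where uv: "\<And>x. f x = u \<and> a x = 0 \<and> b x = - u \<and> c x = v"
      using dirac_adjoint_kernel_complex[OF n refl refl refl refl]
        L[unfolded \<alpha> laplace_delbar_form11[OF n refl refl refl refl] form11_eq_0_iff] by auto
    have "\<alpha> = cscale u harmonic_mixed + cscale (\<i> * v) harmonic_asd"
      unfolding \<alpha> harmonic_mixed_def harmonic_asd_def cscale_form11 form11_add
      by (rule form11_eqI) (simp add: uv)
    then show "\<alpha> \<in> ?S" by blast
  qed
  show "?S \<subseteq> ?H"
  proof
    fix \<alpha> assume "\<alpha> \<in> ?S"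
    then obtain u v where "\<alpha> = cscale u harmonic_mixed + cscale v harmonic_asd" by blast
    then have \<alpha>: "\<alpha> = form11 (\<lambda>x. u) (\<lambda>x. \<i> * 0) (\<lambda>x. \<i> * - u) (\<lambda>x. \<i> * (- \<i> * v))"
      unfolding harmonic_mixed_def harmonic_asd_def cscale_form11 form11_add by (simp add: algebra_simps)
    have "\<alpha> \<in> pq_forms nil_J 1 1"
      unfolding \<alpha> by (intro form11_in_pq_forms nil_intros)
    moreover have D: "(\<lambda>x. 0) = dirac1 (\<lambda>x. u) (\<lambda>x. 0) (\<lambda>x. - u) (\<lambda>x. - \<i> * v)"
      "(\<lambda>x. 0) = dirac2 (\<lambda>x. u) (\<lambda>x. 0) (\<lambda>x. - u) (\<lambda>x. - \<i> * v)"
      "(\<lambda>x. 0) = dirac3 (\<lambda>x. u) (\<lambda>x. 0) (\<lambda>x. - u) (\<lambda>x. - \<i> * v)"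
      "(\<lambda>x. 0) = dirac4 (\<lambda>x. u) (\<lambda>x. 0) (\<lambda>x. - u) (\<lambda>x. - \<i> * v)"
      by (simp_all add: fun_eq_iff dirac_defs lie_const)
    have "laplace_delbar nil_J nil_omega \<alpha> = 0"
      unfolding \<alpha> laplace_delbar_form11[OF nil_smooth_const nil_smooth_const nil_smooth_const nil_smooth_const D]
        form11_eq_0_iff by (simp add: lie_const)
    ultimately show "\<alpha> \<in> ?H" by (simp add: harmonic_delbar_def)
  qed
qed

lemma h_delbar_11: "h_delbar nil_J nil_omega 1 1 = 2"
proof -
  interpret vector_space cscale by (rule vector_space_cscale)
  have ne: "harmonic_mixed \<noteq> cscale k harmonic_asd" for k
  proof
    assume "harmonic_mixed = cscale k harmonic_asd"
    then have "harmonic_mixed + - cscale k harmonic_asd = 0" by simp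
    then show False
      unfolding harmonic_mixed_def harmonic_asd_def cscale_form11 form11_minus form11_add form11_eq_0_iff by simp
  qed
  have ne0: "harmonic_asd \<noteq> 0"
    unfolding harmonic_asd_def form11_eq_0_iff by simp
  have "harmonic_mixed \<notin> span {harmonic_asd}" using ne by (auto simp: span_singleton)
  then have ind: "independent {harmonic_mixed, harmonic_asd}"
    using ne0 by (auto simp: independent_insert)
  have card: "card {harmonic_mixed, harmonic_asd} = 2"
    using ne[of 1] by (simp add: cscale_def)
  have "span {harmonic_mixed, harmonic_asd} = harmonic_delbar nil_J nil_omega 1 1"
    unfolding harmonic_delbar_11 span_insert span_singleton by (auto simp: algebra_simps)
  then show ?thesis
    unfolding h_delbar_def using dim_span_eq_card_independent[OF ind] card by simp
qed

lemma harmonic_asd_forms: "{\<alpha> \<in> nil_forms 2. real_form \<alpha> \<and> hodge nil_J nil_omega \<alpha> = - \<alpha> \<and> laplace_d nil_J nil_omega \<alpha> = 0}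
    = {rscale r harmonic_asd | r. True}" (is "?H = ?S")
proof
  have rs: "rscale r harmonic_asd = form11 (\<lambda>x. 0) (\<lambda>x. 0) (\<lambda>x. 0) (\<lambda>x. complex_of_real r)" for r
    unfolding harmonic_asd_def using cscale_form11[of "of_real r"] by (simp add: rscale_def cscale_def)
  show "?H \<subseteq> ?S"
  proof
    fix \<alpha> assume "\<alpha> \<in> ?H"
    then have n2: "\<alpha> \<in> nil_forms 2" and re: "real_form \<alpha>" and asd: "hodge nil_J nil_omega \<alpha> = - \<alpha>"
      and L: "laplace_d nil_J nil_omega \<alpha> = 0" by simp_all
    let ?F = "component2 \<alpha>"
    note e = nil_forms_2_eq_form2[OF n2]
    have "component2 (hodge nil_J nil_omega \<alpha>) i j x = - ?F i j x" for i j x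
      unfolding asd by (simp add: component2_def)
    moreover have "hodge nil_J nil_omega \<alpha> = form2 (?F 3 4) (\<lambda>x. - ?F 2 4 x) (?F 2 3) (?F 1 4) (\<lambda>x. - ?F 1 3 x) (?F 1 2)"
      by (subst e) (rule hodge_form2)
    ultimately have "?F 3 4 x = - ?F 1 2 x" "- ?F 2 4 x = - ?F 1 3 x" "?F 2 3 x = - ?F 1 4 x" for x
      by (metis component2_form2(1), metis component2_form2(2), metis component2_form2(3))
    then have "?F 3 4 = (\<lambda>x. 0 - ?F 1 2 x)" "?F 2 4 = ?F 1 3" "?F 2 3 = (\<lambda>x. - ?F 1 4 x)"
      "?F 1 2 = (\<lambda>x. 0 + ?F 1 2 x)" by (simp_all add: fun_eq_iff)
    then have \<alpha>: "\<alpha> = form11 (\<lambda>x. 0) (?F 1 2) (?F 1 3) (?F 1 4)"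
      using e unfolding form11_def by metis
    note n = nil_smooth_component2[OF n2]
    have "laplace_d nil_J nil_omega (form11 (\<lambda>x. 0) (?F 1 2) (?F 1 3) (?F 1 4)) = 0"
      using L \<alpha> by simp
    note Lz = this[unfolded laplace_d_form11[OF n n n refl refl refl refl] form11_eq_0_iff, rule_format]
    have "\<exists>u v. \<forall>x. (0::complex) = u \<and> ?F 1 2 x = 0 \<and> ?F 1 3 x = - u \<and> ?F 1 4 x = v"
      by (rule dirac_adjoint_kernel_complex[OF nil_smooth_const[of 0] n n n refl refl refl refl])
        (use Lz in auto)
    then obtain v where uv: "\<And>x. ?F 1 2 x = 0 \<and> ?F 1 3 x = 0 \<and> ?F 1 4 x = v" by auto
    have "cnj (?F 1 4 0) = ?F 1 4 0"
    proof -
      have "cvec_conj (cvec w) = cvec w" for w :: "real^4" by (simp add: cvec_conj_def cvec_def)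
      then show ?thesis
        using re[unfolded real_form_def, rule_format, of 0 "[cvec (frame 1 0), cvec (frame 4 0)]"]
        by (simp add: component2_def)
    qed
    then have "v = complex_of_real (Re v)" using uv by (metis complex_cnj_cancel_iff Reals_cnj_iff of_real_Re)
    then have "\<alpha> = rscale (Re v) harmonic_asd"
      unfolding rs by (subst \<alpha>, intro form11_eqI) (use uv in simp)
    then show "\<alpha> \<in> ?S" by blast
  qed
  show "?S \<subseteq> ?H"
  proof
    fix \<alpha> assume "\<alpha> \<in> ?S"
    then obtain r where \<alpha>: "\<alpha> = form11 (\<lambda>x. 0) (\<lambda>x. 0) (\<lambda>x. 0) (\<lambda>x. complex_of_real r)"
      using rs by auto
    let ?z = "\<lambda>x::real^4. 0 :: complex"
    have "\<alpha> \<in> nil_forms 2" unfolding \<alpha> by (intro form11_in_nil_forms nil_intros)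
    moreover have "real_form \<alpha>" unfolding \<alpha> real_form_def form11_def by (simp add: cnj_form2)
    moreover have "hodge nil_J nil_omega \<alpha> = - \<alpha>"
      unfolding \<alpha> hodge_form11 form11_minus by simp
    moreover have D: "(\<lambda>x. 0) = dirac1 ?z ?z ?z (\<lambda>x. complex_of_real r)" "(\<lambda>x. 0) = dirac2 ?z ?z ?z (\<lambda>x. complex_of_real r)"
      "(\<lambda>x. 0) = dirac3 ?z ?z ?z (\<lambda>x. complex_of_real r)" "(\<lambda>x. 0) = dirac4 ?z ?z ?z (\<lambda>x. complex_of_real r)"
      by (simp_all add: fun_eq_iff dirac_defs lie_const)
    have "laplace_d nil_J nil_omega \<alpha> = 0"
      unfolding \<alpha> laplace_d_form11[OF nil_smooth_const nil_smooth_const nil_smooth_const D] form11_eq_0_iff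
      by (simp add: lie_const)
    ultimately show "\<alpha> \<in> ?H" by simp
  qed
qed

lemma b_minus_nil: "b_minus nil_J nil_omega = 1"
proof -
  interpret vector_space rscale by (rule vector_space_rscale)
  have ind: "independent {harmonic_asd}"
    unfolding harmonic_asd_def by (simp add: form11_eq_0_iff)
  have "span {harmonic_asd} = {rscale r harmonic_asd | r. True}"
    unfolding span_singleton by auto
  then show ?thesis
    unfolding b_minus_def harmonic_asd_forms using dim_span_eq_card_independent[OF ind] by simp
qed

theorem proposition3p2:
  "group nil_group \<and> subgroup nil_lattice nil_group \<and> discrete nil_lattice \<and>
   compact_space nil_manifold \<and>
   (\<exists>(J :: real^4 \<Rightarrow> real^4^4) (\<omega> :: cform).
      almost_hermitian J \<omega> \<and> \<not> integrable_acs J \<and> \<not> loc_conf_almost_kaehler \<omega> \<and>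
      h_delbar J \<omega> 1 1 = 2 \<and> b_minus J \<omega> + 1 = 2)"
  using group_nil_group subgroup_nil_lattice discrete_nil_lattice compact_nil_manifold
    almost_hermitian_nil not_integrable_nil_J not_lcak_nil_omega h_delbar_11 b_minus_nil
  by auto

end
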